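(* Let $n$ be a nonnegative integer and suppose $bcd=aq$ and $ef=a^2q^{2n+1}$. If $g=a/b$ or $g=a/e$, then \begin{multline*} \sum_{k=0}^n \frac{E(aq^{3k})}{E(a)} \frac{(b,c,d;q,p)_k}{(aq^2/b,aq^2/c,aq^2/d;q^2,p)_k} \frac{(e,f,q^{-2n};q^2,p)_k}{(aq/e,aq/f,aq^{2n+1};q,p)_k}\, q^k \\ =\frac{(aq^2,a^2q^2/bce,a^2q^2/bdeg,agq^2/cd;q^2,p)_n} {(a^2q^2/beg,agq^2/c,aq^2/d,a^2q^2/bcde;q^2,p)_n} \,{_{10}\omega_9}(ag/c;a/c,gq^2/c,beg/a,d,f,g,q^{-2n};q^2,p). \end{multline*}
   Context: Let $p$ be a complex number with $|p|<1$, $q$ a nonzero complex number, and all parameters generic so that no denominator vanishes. For nonzero $x$, $E(x)=E(x;p)=\prod_{k\ge 0}(1-xp^k)(1-p^{k+1}/x)$. For a nonzero base $Q$ and integer $m$, $(a;Q,p)_m=\prod_{k=0}^{m-1}E(aQ^k)$ if $m>0$, $=1$ if $m=0$, and $=1/\prod_{k=0}^{-m-1}E(aQ^{m+k})$ if $m<0$; $(a_1,\dots,a_s;Q,p)_m=\prod_{i=1}^s(a_i;Q,p)_m$. For parameters with $(a_4\cdots a_{r+1})^2=a_1^{r-3}Q^{r-5}$ and one of $a_4,\dots,a_{r+1}$ of the form $Q^{-N}$ ($N$ a nonnegative integer), \[{_{r+1}\omega_r}(a_1;a_4,\dots,a_{r+1};Q,p)=\sum_{k\ge 0}\frac{E(a_1Q^{2k})}{E(a_1)}\frac{(a_1,a_4,\dots,a_{r+1};Q,p)_k\,Q^k}{(Q,a_1Q/a_4,\dots,a_1Q/a_{r+1};Q,p)_k}.\]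 *)

theory Defs
  imports "HOL-Analysis.Analysis"
begin

definition ell_theta :: "complex \<Rightarrow> complex \<Rightarrow> complex" where
  "ell_theta p x = (\<Prod>k. (1 - x * p ^ k) * (1 - p ^ (k + 1) / x))"

definition ell_poch :: "complex \<Rightarrow> complex \<Rightarrow> complex \<Rightarrow> nat \<Rightarrow> complex" where
  "ell_poch a Q p m = (\<Prod>k<m. ell_theta p (a * Q ^ k))"

definition ell_pochs :: "complex list \<Rightarrow> complex \<Rightarrow> complex \<Rightarrow> nat \<Rightarrow> complex" where
  "ell_pochs as Q p m = prod_list (map (\<lambda>a. ell_poch a Q p m) as)"

text \<open>Very-well-poised elliptic series {r+1}omega_r(a1; a4,...,a_{r+1}; Q, p),
  with the list argument being [a4,...,a_{r+1}].\<close>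
definition ell_omega :: "complex \<Rightarrow> complex list \<Rightarrow> complex \<Rightarrow> complex \<Rightarrow> complex" where
  "ell_omega a1 as Q p = (\<Sum>k. ell_theta p (a1 * Q ^ (2 * k)) / ell_theta p a1
      * ell_pochs (a1 # as) Q p k * Q ^ k
      / (ell_poch Q Q p k * ell_pochs (map (\<lambda>ai. a1 * Q / ai) as) Q p k))"

end

theory Submission
  imports Defs "HOL-Complex_Analysis.Complex_Analysis"
begin

text \<open>In additive notation the theta function becomes an odd entire function \<open>s\<close>, and only oddness
  and Weierstrass' addition formula (proved by Liouville's theorem) are needed for generic parameters.
  For \<open>g = a/b\<close> expand the \<open>k\<close>-dependent factors containing \<open>e\<close>, \<open>f\<close>, \<open>q\<^sup>-\<^sup>2\<^sup>n\<close> by the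
  Frenkel-Turaev sum in base \<open>q\<^sup>2\<close> and interchange the sums: the inner sum is Gasper's bibasic sum,
  which telescopes, and the outer sum is the \<open>\<^sub>1\<^sub>0\<omega>\<^sub>9\<close>. The case \<open>g = a/e\<close> follows from this one by
  Bailey's transformation. Non-generic parameters are reached by continuity: moving the parameters
  along a line, the identity fails for at most countably many values of the line parameter.\<close>

section \<open>The theta function and its addition formula\<close>

text \<open>What shapes the proof is that its intermediate identities divide by more than the
  theorem does: the expansion, the bibasic sum and Bailey's transformation have denominators such as
  \<open>spoch s (d - \<eta>) \<eta> n\<close>, while the hypotheses exclude only zeros of the
  theorem's own denominators. So the identity is first shown where thirteen linear forms in the
  logarithms stay away from all zeros of theta, and is then transferred to one point at a time.
  Countable exceptional sets suffice because the zeros of theta lie in a lattice; the base \<eta>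
  stays fixed throughout. The factor exp (-z/2) in the additive form makes the inversion x -> 1/x an
  exact sign change, so that powers of the base drop out of every balanced quotient. The price is
  that logarithms must be chosen such that the multiplicative constraints hold additively, not just
  modulo 2 pi i. The Frenkel-Turaev sum comes from an elliptic binomial theorem: an expansion in a
  free variable x whose coefficients obey Pascal's rule by the addition formula. For p = 0 one of
  the two periods is lost, so the addition formula needs a separate elementary argument.\<close>

definition q_prod :: "complex \<Rightarrow> complex \<Rightarrow> complex" where
  "q_prod p x = (\<Prod>k. 1 - x * p ^ k)"

lemma convergent_q_prod:
  assumes "cmod p < 1"
  shows "convergent_prod (\<lambda>k. 1 - x * p ^ k)"
proof (intro abs_convergent_prod_imp_convergent_prod summable_imp_abs_convergent_prod)
  have "summable (\<lambda>k. cmod x * cmod p ^ k)"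
    using assms by (intro summable_mult summable_geometric) auto
  then show "summable (\<lambda>k. norm (1 - x * p ^ k - 1))"
    by (simp add: norm_mult norm_power)
qed

lemma uniform_limit_q_prod:
  assumes "cmod p < 1"
  shows "uniform_limit (cball 0 R) (\<lambda>N x. \<Prod>k<N. 1 - x * p ^ k) (q_prod p) sequentially"
proof -
  have "uniformly_convergent_on (cball 0 R) (\<lambda>N x. \<Prod>k<N. 1 - x * p ^ k)"
  proof (rule uniformly_convergent_on_prod')
    show "uniformly_convergent_on (cball 0 R) (\<lambda>N x. \<Sum>k<N. norm (1 - x * p ^ k - 1))"
    proof (rule Weierstrass_m_test'_ev)
      show "\<forall>\<^sub>F k in sequentially. \<forall>x\<in>cball 0 R. norm (norm (1 - x * p ^ k - 1)) \<le> R * cmod p ^ k"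
        by (auto simp: norm_mult norm_power intro!: always_eventually mult_right_mono)
      show "summable (\<lambda>k. R * cmod p ^ k)"
        using assms by (intro summable_mult summable_geometric) auto
    qed
  qed (auto intro!: continuous_intros)
  then obtain g where g: "uniform_limit (cball 0 R) (\<lambda>N x. \<Prod>k<N. 1 - x * p ^ k) g sequentially"
    by (auto simp: uniformly_convergent_on_def)
  have "g x = q_prod p x" if "x \<in> cball 0 R" for x
  proof -
    have "(\<lambda>N. \<Prod>k<N. 1 - x * p ^ k) \<longlonglongrightarrow> g x"
      using g that by (rule tendsto_uniform_limitI)
    moreover have "(\<lambda>N. \<Prod>k\<le>N. 1 - x * p ^ k) \<longlonglongrightarrow> q_prod p x"
      unfolding q_prod_def by (rule convergent_prod_LIMSEQ[OF convergent_q_prod[OF assms]])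
    ultimately show ?thesis
      using LIMSEQ_lessThan_iff_atMost LIMSEQ_unique by blast
  qed
  then have "uniform_limit (cball 0 R) (\<lambda>N x. \<Prod>k<N. 1 - x * p ^ k) g sequentially \<longleftrightarrow> ?thesis"
    by (intro uniform_limit_cong') auto
  with g show ?thesis by simp
qed

lemma holomorphic_q_prod:
  assumes "cmod p < 1"
  shows "q_prod p holomorphic_on UNIV"
proof (rule holomorphic_uniform_sequence)
  fix z :: complex
  have "uniform_limit (cball z 1) (\<lambda>N x. \<Prod>k<N. 1 - x * p ^ k) (q_prod p) sequentially"
    by (rule uniform_limit_on_subset[OF uniform_limit_q_prod[OF assms, of "norm z + 1"]])
       (simp add: cball_subset_cball_iff)
  then show "\<exists>d>0. cball z d \<subseteq> UNIV \<and>
      uniform_limit (cball z d) (\<lambda>N x. \<Prod>k<N. 1 - x * p ^ k) (q_prod p) sequentially"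
    by (intro exI[of _ 1]) auto
qed (auto intro!: holomorphic_intros)

section \<open>Functional equations of the theta function\<close>

lemma q_prod_rec:
  assumes "cmod p < 1"
  shows "q_prod p x = (1 - x) * q_prod p (p * x)"
proof -
  have "(\<lambda>k. 1 - x * p ^ k) has_prod ((\<Prod>k<1. 1 - x * p ^ k) * (\<Prod>k. 1 - x * p ^ (k + 1)))"
    by (rule has_prod_ignore_initial_segment'[OF convergent_q_prod[OF assms]])
  then show ?thesis
    by (simp add: q_prod_def has_prod_iff mult_ac)
qed

lemma q_prod_eq_0:
  assumes "cmod p < 1" "q_prod p x = 0"
  shows "\<exists>k. x * p ^ k = 1"
  using prodinf_nonzero[OF convergent_q_prod[OF assms(1), of x]] assms(2)
  by (force simp: q_prod_def)

lemma ell_theta_eq: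
  assumes "cmod p < 1"
  shows "ell_theta p x = q_prod p x * q_prod p (p / x)"
  using prodinf_mult[OF convergent_q_prod[OF assms, of x] convergent_q_prod[OF assms, of "p / x"]]
  by (simp add: q_prod_def ell_theta_def)

text \<open>With the factor 1 - x split off, the rest is symmetric under x -> 1/x; inversion and
  multiplication by p then reduce to algebra.\<close>

lemma ell_theta_eq':
  assumes "cmod p < 1"
  shows "ell_theta p x = (1 - x) * q_prod p (p * x) * q_prod p (p / x)"
  using ell_theta_eq[OF assms, of x] q_prod_rec[OF assms, of x] by simp

lemma ell_theta_inverse:
  assumes "cmod p < 1" "x \<noteq> 0"
  shows "ell_theta p (1 / x) = - ell_theta p x / x"
  using assms by (simp add: ell_theta_eq'[OF assms(1)] field_simps)

lemma ell_theta_mult_p: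
  assumes "cmod p < 1" "x \<noteq> 0" "p \<noteq> 0"
  shows "ell_theta p (p * x) = - ell_theta p x / x"
proof -
  have "ell_theta p (p * x) = q_prod p (p * x) * q_prod p (1 / x)"
    using assms by (simp add: ell_theta_eq)
  also have "\<dots> = q_prod p (p * x) * ((1 - 1 / x) * q_prod p (p / x))"
    using q_prod_rec[OF assms(1), of "1 / x"] by simp
  also have "\<dots> = - ell_theta p x / x"
    using assms by (simp add: ell_theta_eq'[OF assms(1)] field_simps)
  finally show ?thesis .
qed

lemma ell_theta_0: "ell_theta 0 x = 1 - x"
proof -
  have "q_prod 0 (0::complex) = 1"
    by (simp add: q_prod_def)
  then show ?thesis
    using ell_theta_eq'[of 0 x] by simp
qed

text \<open>The odd additive form of the theta function. In terms of it the addition formula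
  and all balanced hypergeometric identities are free of powers of the base.\<close>
definition s_theta :: "complex \<Rightarrow> complex \<Rightarrow> complex" where
  "s_theta p z = exp (- z / 2) * ell_theta p (exp z)"

lemma s_theta_eq:
  assumes "cmod p < 1"
  shows "s_theta p z = exp (- z / 2) * (1 - exp z) * q_prod p (p * exp z) * q_prod p (p * exp (- z))"
proof -
  have "p / exp z = p * exp (- z)" by (simp add: exp_minus field_simps)
  then show ?thesis by (simp only: s_theta_def ell_theta_eq'[OF assms] mult.assoc)
qed

lemma holomorphic_s_theta:
  assumes "cmod p < 1"
  shows "s_theta p holomorphic_on A"
proof -
  have q: "(\<lambda>z. q_prod p (g z)) holomorphic_on A" if "g holomorphic_on A" for g
    using holomorphic_on_compose[OF that holomorphic_on_subset[OF holomorphic_q_prod[OF assms]]]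
    by (simp add: o_def)
  have "(\<lambda>z. exp (- z / 2) * (1 - exp z) * q_prod p (p * exp z) * q_prod p (p * exp (- z)))
      holomorphic_on A"
    by (intro holomorphic_intros q) auto
  then show ?thesis
    by (subst s_theta_eq[OF assms, abs_def])
qed

lemma s_theta_minus:
  assumes "cmod p < 1"
  shows "s_theta p (- z) = - s_theta p z"
proof -
  have "ell_theta p (exp (- z)) = - ell_theta p (exp z) / exp z"
    using ell_theta_inverse[OF assms, of "exp z"] by (simp add: exp_minus field_simps)
  moreover have "exp z = exp (z / 2) * exp (z / 2)"
    by (simp flip: exp_add)
  ultimately show ?thesis
    by (simp add: s_theta_def exp_minus field_simps)
qed

lemma s_theta_0 [simp]: "cmod p < 1 \<Longrightarrow> s_theta p 0 = 0"
  by (simp add: s_theta_eq[of p 0])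

lemma s_theta_add_2pi: "s_theta p (z + 2 * of_real pi * \<i>) = - s_theta p z"
proof -
  have "exp (- (z + 2 * of_real pi * \<i>) / 2) = - exp (- z / 2)"
    by (simp add: add_divide_distrib exp_add exp_diff exp_minus diff_divide_distrib)
  moreover have "exp (z + 2 * of_real pi * \<i>) = exp z"
    by (simp add: exp_add)
  ultimately show ?thesis by (simp add: s_theta_def)
qed

lemma s_theta_add_period:
  assumes "cmod p < 1" "exp t = p"
  shows "s_theta p (z + t) = - exp (- t / 2) * exp (- z) * s_theta p z"
proof -
  have "p \<noteq> 0" using assms(2) by force
  have "exp (z + t) = p * exp z" by (simp add: exp_add assms(2))
  then have "s_theta p (z + t) = exp (- (z + t) / 2) * (- ell_theta p (exp z) / exp z)"
    using ell_theta_mult_p[OF assms(1) _ \<open>p \<noteq> 0\<close>, of "exp z"] by (simp add: s_theta_def)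
  also have "exp (- (z + t) / 2) = exp (- z / 2) * exp (- t / 2)"
    by (simp add: exp_add[symmetric] add_divide_distrib diff_divide_distrib)
  also have "exp (- z / 2) * exp (- t / 2) * (- ell_theta p (exp z) / exp z)
      = - exp (- t / 2) * inverse (exp z) * (exp (- z / 2) * ell_theta p (exp z))"
    unfolding divide_inverse by (simp only: mult_minus_left mult_minus_right mult_ac)
  finally show ?thesis
    by (simp only: s_theta_def exp_minus[of z])
qed

section \<open>The zeros of \<open>s_theta\<close>: they lie in a lattice of quasi-periods and are
  simple\<close>

lemma s_theta_zeroD:
  assumes p: "cmod p < 1" and w: "s_theta p w = 0"
  obtains m n :: int where "w = of_int m * Ln p + of_int n * (2 * of_real pi * \<i>)" "p = 0 \<Longrightarrow> m = 0"
proof -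
  have "1 - exp w = 0 \<or> q_prod p (p * exp w) = 0 \<or> q_prod p (p * exp (- w)) = 0"
    using w by (simp add: s_theta_eq[OF p])
  then consider "exp w = 1" | k where "p * exp w * p ^ k = 1" | k where "p * exp (- w) * p ^ k = 1"
    using q_prod_eq_0[OF p] by fastforce
  \<comment> \<open>In each case \<open>exp w\<close> is an integer power of p: the power 0 from 1 -
    exp w, the powers -(k+1) and k+1 from the two products. For p = 0 only the first case can occur,
    and \<open>m = 0\<close> keeps the meaningless \<open>Ln 0\<close> out of the result.\<close>
  then have "\<exists>m::int. exp w = exp (of_int m * Ln p) \<and> (p = 0 \<longrightarrow> m = 0)"
  proof cases
    case 1
    then show ?thesis by (intro exI[of _ 0]) auto
  next
    case (2 k)
    then have "p \<noteq> 0" by auto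
    then have "exp (of_int (- int (Suc k)) * Ln p) = inverse (p ^ Suc k)"
      by (simp only: of_int_minus of_int_of_nat_eq mult_minus_left exp_minus exp_of_nat_mult exp_Ln not_False_eq_True)
    also have "\<dots> = exp w" using 2 \<open>p \<noteq> 0\<close> by (simp add: field_simps)
    finally show ?thesis using \<open>p \<noteq> 0\<close> by metis
  next
    case (3 k)
    then have "p \<noteq> 0" by auto
    then have "exp (of_int (int (Suc k)) * Ln p) = p ^ Suc k"
      by (simp only: of_int_of_nat_eq exp_of_nat_mult exp_Ln not_False_eq_True)
    also have "\<dots> = exp w" using 3 \<open>p \<noteq> 0\<close> by (simp add: exp_minus field_simps)
    finally show ?thesis using \<open>p \<noteq> 0\<close> by metis
  qed
  then obtain m :: int where m: "exp w = exp (of_int m * Ln p)" "p = 0 \<longrightarrow> m = 0" by blast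
  from m(1) obtain n :: int where "w = of_int m * Ln p + of_real (real_of_int (2 * n) * pi) * \<i>"
    unfolding exp_eq by blast
  then show ?thesis using m(2) by (intro that[of m n]) auto
qed

lemma countable_s_theta_zeros:
  assumes "cmod p < 1"
  shows "countable {z. s_theta p z = 0}"
proof (rule countable_subset)
  show "{z. s_theta p z = 0} \<subseteq>
      range (\<lambda>(m::int, n::int). of_int m * Ln p + of_int n * (2 * of_real pi * \<i>))"
    by (auto elim!: s_theta_zeroD[OF assms])
qed auto

text \<open>The shifts that multiply \<open>s_theta\<close> by a nonzero exponential of an affine
  function form a group. It contains 2 pi i and, for nonzero p, also \<open>Ln p\<close>, hence
  every zero. Behaviour near any zero can therefore be read off at 0.\<close>

lemma s_theta_shift_zero:
  assumes p: "cmod p < 1" and w: "s_theta p w = 0"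
  obtains C \<kappa> where "C \<noteq> 0" "\<And>z. s_theta p (w + z) = C * exp (\<kappa> * z) * s_theta p z"
proof -
  define P where "P w \<longleftrightarrow> (\<exists>C \<kappa>. C \<noteq> 0 \<and> (\<forall>z. s_theta p (w + z) = C * exp (\<kappa> * z) * s_theta p z))" for w
  have add: "P (v + w)" if v: "P v" and w: "P w" for v w
  proof -
    obtain C \<kappa> D \<mu> where *: "C \<noteq> 0" "D \<noteq> 0"
      "\<And>z. s_theta p (v + z) = C * exp (\<kappa> * z) * s_theta p z"
      "\<And>z. s_theta p (w + z) = D * exp (\<mu> * z) * s_theta p z"
      using v w unfolding P_def by metis
    have "s_theta p (v + w + z) = (C * exp (\<kappa> * w) * D) * exp ((\<kappa> + \<mu>) * z) * s_theta p z" for z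
      using *(3)[of "w + z"] *(4)[of z] by (simp add: exp_add algebra_simps)
    then show ?thesis using *(1,2) unfolding P_def by (metis exp_not_eq_zero mult_eq_0_iff)
  qed
  have neg: "P (- w)" if w: "P w" for w
  proof -
    obtain C \<kappa> where *: "C \<noteq> 0" "\<And>z. s_theta p (w + z) = C * exp (\<kappa> * z) * s_theta p z"
      using w unfolding P_def by metis
    have "s_theta p (- w + z) = (exp (\<kappa> * w) / C) * exp (- \<kappa> * z) * s_theta p z" for z
      using *(2)[of "- w + z"] *(1) by (simp add: exp_add exp_minus exp_diff field_simps)
    then show ?thesis using *(1) unfolding P_def by (metis divide_eq_0_iff exp_not_eq_zero)
  qed
  have int: "P (of_int m * w)" if "P w" for m :: int and w
  proof -
    have nat: "P (of_nat k * w)" for k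
    proof (induction k)
      case 0
      show ?case unfolding P_def by (rule exI[of _ 1], rule exI[of _ 0]) auto
    next
      case (Suc k)
      then show ?case using add[OF that Suc] by (simp add: algebra_simps)
    qed
    show ?thesis
    proof (cases m)
      case (nonneg k)
      then show ?thesis using nat by simp
    next
      case (neg k)
      then show ?thesis using nat \<open>\<And>w. P w \<Longrightarrow> P (- w)\<close> by (metis mult_minus_left of_int_minus of_int_of_nat_eq)
    qed
  qed
  have pi: "P (2 * of_real pi * \<i>)"
    unfolding P_def using s_theta_add_2pi[of p]
    by (intro exI[of _ "-1"] exI[of _ 0]) (auto simp: add.commute)
  obtain m n :: int where mn: "w = of_int m * Ln p + of_int n * (2 * of_real pi * \<i>)" "p = 0 \<Longrightarrow> m = 0"
    using s_theta_zeroD[OF assms] by blast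
  have "P (of_int m * Ln p)"
  proof (cases "p = 0")
    case True
    then have "of_int m * Ln p = 0" using mn(2) by simp
    then show ?thesis using int[OF pi, of 0] by (simp only: of_int_0 mult_zero_left)
  next
    case False
    then have "s_theta p (Ln p + z) = - exp (- Ln p / 2) * exp (- 1 * z) * s_theta p z" for z
      using s_theta_add_period[OF p exp_Ln[OF False], of z] by (simp add: add.commute)
    then have "P (Ln p)" unfolding P_def by (metis exp_not_eq_zero neg_equal_0_iff_equal)
    then show ?thesis by (rule int)
  qed
  then have "P w" unfolding mn(1) by (rule add[OF _ int[OF pi]])
  then show ?thesis using that unfolding P_def by blast
qed

text \<open>At 0 the derivative is minus the square of \<open>q_prod p p\<close>, which is nonzero;
  quasi-periodicity carries this to every other zero.\<close>

lemma has_field_derivative_s_theta_zero: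
  assumes p: "cmod p < 1" and w: "s_theta p w = 0"
  obtains d where "d \<noteq> 0" "(s_theta p has_field_derivative d) (at w)"
proof -
  define H where "H z = exp (- z / 2) * q_prod p (p * exp z) * q_prod p (p * exp (- z))" for z
  have q: "q_prod p p \<noteq> 0"
  proof
    assume "q_prod p p = 0"
    then obtain k where "p * p ^ k = 1" using q_prod_eq_0[OF p] by blast
    then have "cmod p ^ Suc k = 1" by (metis norm_one norm_power power_Suc)
    then show False using power_Suc_less_one[of "cmod p" k] p by (cases "p = 0") auto
  qed
  have qh: "(\<lambda>z. q_prod p (g z)) holomorphic_on UNIV" if "g holomorphic_on UNIV" for g
    using holomorphic_on_compose[OF that holomorphic_on_subset[OF holomorphic_q_prod[OF p]]]
    by (simp add: o_def)
  have "H holomorphic_on UNIV"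
    unfolding H_def by (intro holomorphic_intros qh) auto
  then have H: "(H has_field_derivative deriv H 0) (at 0)"
    using holomorphic_derivI by blast
  have eq: "s_theta p = (\<lambda>z. (1 - exp z) * H z)"
    by (simp add: fun_eq_iff s_theta_eq[OF p] H_def)
  have d0: "(s_theta p has_field_derivative - H 0) (at 0)"
    unfolding eq by (auto intro!: derivative_eq_intros H)
  obtain C \<kappa> where C: "C \<noteq> 0" "\<And>z. s_theta p (w + z) = C * exp (\<kappa> * z) * s_theta p z"
    using s_theta_shift_zero[OF p w] by blast
  have "((\<lambda>z. C * exp (\<kappa> * z) * s_theta p z) has_field_derivative - C * H 0) (at 0)"
    using p by (auto intro!: derivative_eq_intros d0)
  then have "((\<lambda>z. s_theta p (w + z)) has_field_derivative - C * H 0) (at 0)"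
    by (simp only: C(2))
  then have "(s_theta p has_field_derivative - C * H 0) (at w)"
    using DERIV_at_within_shift[of "s_theta p" "- C * H 0" w 0 UNIV] by simp
  moreover have "- C * H 0 \<noteq> 0" using C(1) q by (simp add: H_def)
  ultimately show ?thesis using that by blast
qed

section \<open>Tools for the Liouville argument: entire quotients, continuity off countable sets,
  boundedness from two periods\<close>

lemma holomorphic_divide_simple_zeros:
  assumes f: "f holomorphic_on UNIV" and g: "g holomorphic_on UNIV"
    and z: "\<And>z. g z = 0 \<Longrightarrow> f z = 0 \<and> deriv g z \<noteq> 0"
  obtains h where "h holomorphic_on UNIV" "\<And>z. f z = h z * g z"
proof -
  define h where "h z = (if g z = 0 then deriv f z / deriv g z else f z / g z)" for z
  have "h field_differentiable at a" for a
  proof (cases "g a = 0")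
    case False
    have "open {z. g z \<noteq> 0}"
      using holomorphic_on_imp_continuous_on[OF g] by (intro open_Collect_neq continuous_on_const)
    moreover have "h holomorphic_on {z. g z \<noteq> 0}"
    proof (rule holomorphic_transform)
      show "(\<lambda>z. f z / g z) holomorphic_on {z. g z \<noteq> 0}"
        using f g by (intro holomorphic_intros) (auto intro: holomorphic_on_subset)
    qed (auto simp: h_def)
    ultimately show ?thesis using False holomorphic_on_imp_differentiable_at by blast
  next
    case True
    \<comment> \<open>The difference quotients at \<open>a\<close> extend holomorphically. Since f
      and g both vanish at \<open>a\<close>, f1 / g1 agrees with f / g at the other points where g1
      is nonzero, and simplicity of the zero makes \<open>g1 a\<close> nonzero.\<close>
    define f1 where "f1 z = (if z = a then deriv f a else (f z - f a) / (z - a))" for z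
    define g1 where "g1 z = (if z = a then deriv g a else (g z - g a) / (z - a))" for z
    have f1: "f1 holomorphic_on UNIV" and g1: "g1 holomorphic_on UNIV"
      unfolding f1_def g1_def using pole_lemma_open f g by auto
    have "open {z. g1 z \<noteq> 0}"
      using holomorphic_on_imp_continuous_on[OF g1] by (intro open_Collect_neq continuous_on_const)
    moreover have "h holomorphic_on {z. g1 z \<noteq> 0}"
    proof (rule holomorphic_transform)
      show "(\<lambda>z. f1 z / g1 z) holomorphic_on {z. g1 z \<noteq> 0}"
        using f1 g1 by (intro holomorphic_intros) (auto intro: holomorphic_on_subset)
      show "f1 x / g1 x = h x" if "x \<in> {z. g1 z \<noteq> 0}" for x
        using that True z[OF True] by (auto simp: f1_def g1_def h_def)
    qed
    moreover have "g1 a \<noteq> 0" using z[OF True] by (simp add: g1_def)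
    ultimately show ?thesis using holomorphic_on_imp_differentiable_at by blast
  qed
  then have "h holomorphic_on UNIV" by (simp add: holomorphic_on_def)
  moreover have "f x = h x * g x" for x using z[of x] by (auto simp: h_def)
  ultimately show ?thesis using that by blast
qed

text \<open>If the values at a differed, f and g would differ on a whole ball, which is uncountable.
  This is the device by which genericity conditions are removed, both here and at the end.\<close>

lemma isCont_eq_of_countable_neq:
  fixes f g :: "complex \<Rightarrow> complex"
  assumes "isCont f a" "isCont g a" "countable {x. f x \<noteq> g x}"
  shows "f a = g a"
proof (rule ccontr)
  assume "f a \<noteq> g a"
  have "isCont (\<lambda>x. f x - g x) a" using assms by (intro continuous_intros)
  then obtain e where e: "e > 0" "\<forall>y. dist a y < e \<longrightarrow> f y - g y \<noteq> 0"
    using continuous_at_avoid[of a "\<lambda>x. f x - g x" 0] \<open>f a \<noteq> g a\<close> by auto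
  then have "ball a e \<subseteq> {x. f x \<noteq> g x}" by auto
  then have "countable (ball a e)" using assms(3) countable_subset by blast
  then show False using uncountable_ball[OF e(1), of a] by simp
qed

lemma doubly_periodic_bounded:
  fixes h :: "complex \<Rightarrow> complex"
  assumes "continuous_on UNIV h" and t: "Re t < 0"
    and h1: "\<And>z. h (z + 2 * of_real pi * \<i>) = h z" and h2: "\<And>z. h (z + t) = h z"
  shows "bounded (range h)"
proof -
  have per: "h (z + of_int m * w) = h z" if w: "\<And>z. h (z + w) = h z" for m :: int and w z
  proof -
    have nat: "h (z + of_nat k * w) = h z" for k z
    proof (induction k)
      case (Suc k)
      then show ?case using w[of "z + of_nat k * w"] by (simp add: algebra_simps)
    qed auto
    show ?thesis
    proof (cases m)
      case (neg k)
      then have "(of_int m :: complex) = - of_nat (Suc k)" by (simp only: of_int_minus of_int_of_nat_eq)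
      then have "z = (z + of_int m * w) + of_nat (Suc k) * w"
        by (simp only: mult_minus_left diff_conv_add_uminus[symmetric] diff_add_cancel)
      then show ?thesis using nat by metis
    qed (use nat in auto)
  qed
  \<comment> \<open>A rectangle instead of the parallelogram of periods: a shift by multiples of t
    first brings the real part into [Re t, 0], and the shift by multiples of 2 pi i afterwards
    leaves the real part alone.\<close>
  define K where "K = cbox (Complex (Re t) 0) (Complex 0 (2 * pi))"
  have "h z \<in> h ` K" for z
  proof -
    define m where "m = \<lfloor>Re z / Re t\<rfloor>"
    define y where "y = z + of_int (- m) * t"
    define n where "n = \<lfloor>Im y / (2 * pi)\<rfloor>"
    define x where "x = y + of_int (- n) * (2 * of_real pi * \<i>)"
    have "of_int m \<le> Re z / Re t" "Re z / Re t \<le> of_int m + 1" unfolding m_def by linarith+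
    then have "of_int m * Re t \<ge> Re z" "(of_int m + 1) * Re t \<le> Re z"
      using t by (auto simp: neg_le_divide_eq neg_divide_le_eq)
    then have y: "Re t \<le> Re y" "Re y \<le> 0" by (auto simp: y_def algebra_simps)
    have "of_int n \<le> Im y / (2 * pi)" "Im y / (2 * pi) \<le> of_int n + 1" unfolding n_def by linarith+
    then have "of_int n * (2 * pi) \<le> Im y" "Im y \<le> (of_int n + 1) * (2 * pi)"
      by (auto simp: field_simps)
    then have "0 \<le> Im x" "Im x \<le> 2 * pi" by (auto simp: x_def algebra_simps)
    moreover have "Re x = Re y" by (simp add: x_def)
    ultimately have "x \<in> K" using y by (auto simp: K_def in_cbox_complex_iff)
    moreover have "h x = h z" unfolding x_def y_def using per[OF h1] per[OF h2] by metis
    ultimately show ?thesis by (metis imageI)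
  qed
  then have "range h \<subseteq> h ` K" by auto
  moreover have "compact (h ` K)"
    using assms(1) by (intro compact_continuous_image) (auto simp: K_def intro: continuous_on_subset)
  ultimately show ?thesis using bounded_subset compact_imp_bounded by blast
qed

text \<open>As functions of x, the left side F and the factor G of the right side have the same
  multipliers under both quasi-periods. F vanishes at the zeros of G, so F / G is entire and doubly
  periodic, hence constant, and x = v gives the constant. The condition on 2u makes the zeros of G
  simple; the other two make \<open>G v\<close> nonzero.\<close>

lemma s_theta_add_generic:
  assumes p: "cmod p < 1" "p \<noteq> 0"
    and nz: "s_theta p (2 * u) \<noteq> 0" "s_theta p (v + u) \<noteq> 0" "s_theta p (v - u) \<noteq> 0"
  shows "s_theta p (x + y) * s_theta p (x - y) * s_theta p (u + v) * s_theta p (u - v)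
       - s_theta p (x + v) * s_theta p (x - v) * s_theta p (u + y) * s_theta p (u - y)
       = s_theta p (x + u) * s_theta p (x - u) * s_theta p (y + v) * s_theta p (y - v)"
proof -
  let ?s = "s_theta p"
  define F where "F x = ?s (x + y) * ?s (x - y) * ?s (u + v) * ?s (u - v)
       - ?s (x + v) * ?s (x - v) * ?s (u + y) * ?s (u - y)" for x
  define G where "G x = ?s (x + u) * ?s (x - u)" for x
  have sh: "(\<lambda>x. ?s (g x)) holomorphic_on UNIV" if "g holomorphic_on UNIV" for g
    using holomorphic_on_compose[OF that holomorphic_s_theta[OF p(1)]] by (simp add: o_def)
  have hol: "F holomorphic_on UNIV" "G holomorphic_on UNIV"
    unfolding F_def G_def by (intro holomorphic_intros sh)+
  have odd: "?s (b - a) = - ?s (a - b)" for a b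
    using s_theta_minus[OF p(1), of "a - b"] by simp
  have zeros: "F x = 0 \<and> deriv G x \<noteq> 0" if G: "G x = 0" for x
  proof -
    consider "?s (x - u) = 0" | "?s (x + u) = 0" using G by (auto simp: G_def)
    then obtain \<epsilon> w where w: "x = w + \<epsilon> * u" "?s w = 0" and \<epsilon>: "\<epsilon> = 1 \<or> \<epsilon> = - 1"
    proof cases
      case 1
      then show thesis by (intro that[of "x - u" 1]) auto
    next
      case 2
      then show thesis by (intro that[of "x + u" "-1"]) auto
    qed
    obtain C \<kappa> where C: "C \<noteq> 0" "\<And>z. ?s (w + z) = C * exp (\<kappa> * z) * ?s z"
      using s_theta_shift_zero[OF p(1) w(2)] by blast
    \<comment> \<open>Up to a factor free of z, the product at x equals the product at u. Hence
      \<open>F x\<close> is a multiple of \<open>F u\<close>, whose two terms coincide.\<close>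
    have sq: "?s (x + z) * ?s (x - z) = C\<^sup>2 * exp (2 * \<kappa> * \<epsilon> * u) * (?s (u + z) * ?s (u - z))" for z
    proof -
      have "?s (x + z) * ?s (x - z) = C\<^sup>2 * (exp (\<kappa> * (\<epsilon> * u + z)) * exp (\<kappa> * (\<epsilon> * u - z)))
          * (?s (\<epsilon> * u + z) * ?s (\<epsilon> * u - z))"
        using C(2)[of "\<epsilon> * u + z"] C(2)[of "\<epsilon> * u - z"]
        by (simp add: w(1) power2_eq_square add.assoc add_diff_eq)
      also have "exp (\<kappa> * (\<epsilon> * u + z)) * exp (\<kappa> * (\<epsilon> * u - z)) = exp (2 * \<kappa> * \<epsilon> * u)"
        by (simp add: exp_add[symmetric] algebra_simps)
      also have "?s (\<epsilon> * u + z) * ?s (\<epsilon> * u - z) = ?s (u + z) * ?s (u - z)"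
        using \<epsilon> odd[of "- u" z] odd[of z u] s_theta_minus[OF p(1), of "u + z"] by auto
      finally show ?thesis .
    qed
    have "F x = 0"
      unfolding F_def using sq[of y] sq[of v] by (simp add: algebra_simps)
    moreover obtain d where d: "d \<noteq> 0" "(?s has_field_derivative d) (at w)"
      using has_field_derivative_s_theta_zero[OF p(1) w(2)] by blast
    have "deriv G x \<noteq> 0"
      using \<epsilon>
    proof
      assume [simp]: "\<epsilon> = 1"
      have d': "(?s has_field_derivative deriv ?s (x + u)) (at (x + u))"
        using holomorphic_derivI[OF holomorphic_s_theta[OF p(1), of UNIV]] by blast
      have "((\<lambda>x. ?s (x + u)) has_field_derivative deriv ?s (x + u)) (at x)"
        unfolding DERIV_shift[symmetric] using d' .
      moreover have "((\<lambda>x. ?s (x + - u)) has_field_derivative d) (at x)"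
        unfolding DERIV_shift[symmetric] using d(2) by (simp add: w(1))
      ultimately have "(G has_field_derivative deriv ?s (x + u) * ?s (x - u) + ?s (x + u) * d) (at x)"
        unfolding G_def by (auto intro!: derivative_eq_intros)
      then have "deriv G x = ?s (x + u) * d"
        using w DERIV_imp_deriv by fastforce
      moreover have "?s (x + u) = C * exp (\<kappa> * (2 * u)) * ?s (2 * u)"
        using C(2)[of "2 * u"] by (simp add: w(1) add.assoc)
      ultimately show ?thesis using d(1) C(1) nz(1) by simp
    next
      assume [simp]: "\<epsilon> = - 1"
      have d': "(?s has_field_derivative deriv ?s (x - u)) (at (x - u))"
        using holomorphic_derivI[OF holomorphic_s_theta[OF p(1), of UNIV]] by blast
      have "((\<lambda>x. ?s (x + - u)) has_field_derivative deriv ?s (x - u)) (at x)"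
        unfolding DERIV_shift[symmetric] using d' by simp
      moreover have "((\<lambda>x. ?s (x + u)) has_field_derivative d) (at x)"
        unfolding DERIV_shift[symmetric] using d(2) by (simp add: w(1))
      ultimately have "(G has_field_derivative ?s (x - u) * d + ?s (x + u) * deriv ?s (x - u)) (at x)"
        unfolding G_def by (auto intro!: derivative_eq_intros)
      then have "deriv G x = ?s (x - u) * d"
        using w DERIV_imp_deriv by fastforce
      moreover have "?s (x - u) = C * exp (\<kappa> * - (2 * u)) * ?s (- (2 * u))"
        using C(2)[of "- (2 * u)"] by (simp add: w(1))
      moreover have "?s (- (2 * u)) \<noteq> 0" using nz(1) s_theta_minus[OF p(1), of "2 * u"] by simp
      ultimately show ?thesis using d(1) C(1) by simp
    qed
    ultimately show ?thesis by blast
  qed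
  obtain h where h: "h holomorphic_on UNIV" "\<And>x. F x = h x * G x"
    using holomorphic_divide_simple_zeros[OF hol zeros] by blast
  have hc: "isCont h x" for x
    using holomorphic_on_imp_continuous_on[OF h(1)] by (simp add: continuous_on_eq_continuous_at)
  have "countable {x. G x = 0}"
  proof (rule countable_subset)
    show "{x. G x = 0} \<subseteq> (\<lambda>z. z - u) ` {z. ?s z = 0} \<union> (\<lambda>z. z + u) ` {z. ?s z = 0}"
      by (force simp: G_def image_iff algebra_simps)
  qed (use countable_s_theta_zeros[OF p(1)] in auto)
  \<comment> \<open>Equal multipliers give equality of the quotients only where G is nonzero; on the
    countable rest it follows by continuity of h.\<close>
  then have per: "h (x + t) = h x"
    if *: "\<And>x. \<exists>c. c \<noteq> 0 \<and> F (x + t) = c * F x \<and> G (x + t) = c * G x" for t x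
  proof -
    have "{x. h (x + t) \<noteq> h x} \<subseteq> {x. G x = 0}"
      using * h(2) by (smt (verit, ccfv_SIG) Collect_mono mult.left_commute mult_cancel_left mult_cancel_right)
    then have "countable {x. h (x + t) \<noteq> h x}"
      using \<open>countable {x. G x = 0}\<close> countable_subset by blast
    moreover have "isCont (\<lambda>x. h (x + t)) x"
      by (intro isCont_o2[OF _ hc] continuous_intros)
    ultimately show ?thesis using isCont_eq_of_countable_neq[of x "\<lambda>x. h (x + t)" h] hc by blast
  qed
  have h1: "h (x + 2 * of_real pi * \<i>) = h x" for x
  proof (rule per)
    fix x
    have "?s (x + 2 * of_real pi * \<i> + z) = - ?s (x + z)" for z
      using s_theta_add_2pi[of p "x + z"] by (simp add: algebra_simps)
    from this[of y] this[of "- y"] this[of v] this[of "- v"] this[of u] this[of "- u"]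
    show "\<exists>c. c \<noteq> 0 \<and> F (x + 2 * of_real pi * \<i>) = c * F x \<and> G (x + 2 * of_real pi * \<i>) = c * G x"
      by (intro exI[of _ 1]) (simp add: F_def G_def)
  qed
  define t where "t = Ln p"
  have h2: "h (x + t) = h x" for x
  proof (rule per)
    fix x
    have "?s (x + t + z) * ?s (x + t - z) = (exp (- t / 2) * exp (- x))\<^sup>2 * (?s (x + z) * ?s (x - z))" for z
    proof -
      have e: "exp t = p" using p by (simp add: t_def)
      have "exp (- (x + z)) * exp (- (x - z)) = exp (- x) * exp (- x)"
        by (simp add: exp_add[symmetric] algebra_simps)
      moreover have "?s (x + t + z) = - exp (- t / 2) * exp (- (x + z)) * ?s (x + z)"
        using s_theta_add_period[OF p(1) e, of "x + z"] by (simp add: algebra_simps)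
      moreover have "?s (x + t - z) = - exp (- t / 2) * exp (- (x - z)) * ?s (x - z)"
        using s_theta_add_period[OF p(1) e, of "x - z"] by (simp add: algebra_simps)
      ultimately show ?thesis
        by (simp add: power2_eq_square)
    qed
    from this[of y] this[of v] this[of u]
    show "\<exists>c. c \<noteq> 0 \<and> F (x + t) = c * F x \<and> G (x + t) = c * G x"
      by (intro exI[of _ "(exp (- t / 2) * exp (- x))\<^sup>2"]) (simp add: F_def G_def right_diff_distrib)
  qed
  have "Re t < 0" using p by (simp add: t_def)
  then have "bounded (range h)"
    using doubly_periodic_bounded[of h t] h1 h2 holomorphic_on_imp_continuous_on[OF h(1)] by blast
  then obtain c where c: "\<And>x. h x = c" using Liouville_theorem[OF h(1)] by (auto simp: constant_on_def)
  \<comment> \<open>At x = v the second product of F contains s 0 = 0.\<close>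
  have "F v = ?s (y + v) * ?s (y - v) * G v"
    using odd[of v y] odd[of u v] p(1) by (simp add: F_def G_def add.commute)
  moreover have "G v \<noteq> 0" using nz by (simp add: G_def)
  ultimately have "c = ?s (y + v) * ?s (y - v)" using h(2)[of v] c by simp
  then show ?thesis using h(2)[of x] c by (simp add: F_def G_def algebra_simps)
qed

lemma isCont_s_theta:
  assumes "cmod p < 1"
  shows "isCont (s_theta p) z"
  using holomorphic_on_imp_continuous_on[OF holomorphic_s_theta[OF assms, of UNIV]]
  by (simp add: continuous_on_eq_continuous_at)

lemma countable_s_theta_affine_zeros:
  assumes p: "cmod p < 1" and "w \<noteq> 0"
  shows "countable {t. s_theta p (z + w * t) = 0}"
proof (rule countable_subset)
  show "{t. s_theta p (z + w * t) = 0} \<subseteq> (\<lambda>y. (y - z) / w) ` {z. s_theta p z = 0}"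
    using \<open>w \<noteq> 0\<close> by (auto simp: image_iff intro!: exI[of _ "z + w * _"])
qed (use countable_s_theta_zeros[OF p] in auto)

text \<open>For p = 0 the function is -2 sinh (z/2) and the formula is elementary. Otherwise the
  three conditions of the generic version fail for countably many u only, and continuity in u gives
  the rest.\<close>

theorem s_theta_addition:
  assumes p: "cmod p < 1"
  shows "s_theta p (x + y) * s_theta p (x - y) * s_theta p (u + v) * s_theta p (u - v)
       - s_theta p (x + v) * s_theta p (x - v) * s_theta p (u + y) * s_theta p (u - y)
       = s_theta p (x + u) * s_theta p (x - u) * s_theta p (y + v) * s_theta p (y - v)"
proof (cases "p = 0")
  case True
  have s: "s_theta p z = exp (- z / 2) - exp (z / 2)" for z
    by (simp add: True s_theta_def ell_theta_0 right_diff_distrib flip: exp_add)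
  define e :: "complex \<Rightarrow> complex" where "e z = exp z + exp (- z)" for z
  \<comment> \<open>Each product of two theta values is a difference of values of e, which leaves a
    polynomial identity in e x, e y, e u, e v.\<close>
  have st: "s_theta p (z + w) * s_theta p (z - w) = e z - e w" for z w
  proof -
    have "s_theta p (z + w) * s_theta p (z - w)
        = exp (- (z + w) / 2 + - (z - w) / 2) - exp (- (z + w) / 2 + (z - w) / 2)
          - exp ((z + w) / 2 + - (z - w) / 2) + exp ((z + w) / 2 + (z - w) / 2)"
      unfolding s exp_add by (simp only: algebra_simps)
    moreover have "- (z + w) / 2 + - (z - w) / 2 = - z" "- (z + w) / 2 + (z - w) / 2 = - w"
        "(z + w) / 2 + - (z - w) / 2 = w" "(z + w) / 2 + (z - w) / 2 = z"
      by (simp_all add: field_simps)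
    ultimately show ?thesis by (simp add: e_def)
  qed
  have "(e x - e y) * (e u - e v) - (e x - e v) * (e u - e y) = (e x - e u) * (e y - e v)"
    by algebra
  then show ?thesis by (simp only: st[symmetric] mult.assoc)
next
  case False
  let ?L = "\<lambda>u. s_theta p (x + y) * s_theta p (x - y) * s_theta p (u + v) * s_theta p (u - v)
       - s_theta p (x + v) * s_theta p (x - v) * s_theta p (u + y) * s_theta p (u - y)"
  let ?R = "\<lambda>u. s_theta p (x + u) * s_theta p (x - u) * s_theta p (y + v) * s_theta p (y - v)"
  show ?thesis
  proof (rule isCont_eq_of_countable_neq[of u ?L ?R])
    show "isCont ?L u" "isCont ?R u"
      by (intro continuous_intros isCont_o2[OF _ isCont_s_theta[OF p]])+
    have "{u. ?L u \<noteq> ?R u} \<subseteq> {u. s_theta p (0 + 2 * u) = 0} \<union> {u. s_theta p (v + 1 * u) = 0} \<union>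
        {u. s_theta p (v + (- 1) * u) = 0}"
      using s_theta_add_generic[OF p False] by auto
    then show "countable {u. ?L u \<noteq> ?R u}"
      by (rule countable_subset) (intro countable_Un countable_s_theta_affine_zeros[OF p], auto)
  qed
qed

section \<open>The Frenkel-Turaev sum\<close>

text \<open>The shifted factorial in additive form: for s = \<open>s_theta p\<close> it agrees with
  \<open>ell_poch (exp z) (exp h) p k\<close> up to an exponential factor.\<close>

definition spoch :: "(complex \<Rightarrow> complex) \<Rightarrow> complex \<Rightarrow> complex \<Rightarrow> nat \<Rightarrow> complex" where
  "spoch s z h k = (\<Prod>i<k. s (z + of_nat i * h))"

lemma spoch_0 [simp]: "spoch s z h 0 = 1"
  by (simp add: spoch_def)

lemma spoch_Suc: "spoch s z h (Suc k) = spoch s z h k * s (z + of_nat k * h)"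
  by (simp add: spoch_def)

lemma spoch_Suc_left: "spoch s z h (Suc k) = s z * spoch s (z + h) h k"
  by (simp only: spoch_def prod.lessThan_Suc_shift) (simp add: algebra_simps)

lemma spoch_add: "spoch s z h (m + k) = spoch s z h m * spoch s (z + of_nat m * h) h k"
  by (induction k) (simp_all add: spoch_Suc algebra_simps)

lemma spoch_eq_0_iff: "spoch s z h k = 0 \<longleftrightarrow> (\<exists>i<k. s (z + of_nat i * h) = 0)"
  by (auto simp: spoch_def)

text \<open>Two progressions of step 2h, offset by h, interleave to one of step h. This is the
  bridge between the bases q^2 and q.\<close>

lemma spoch_double: "spoch s z (2 * h) k * spoch s (z + h) (2 * h) k = spoch s z h (2 * k)"
  by (induction k) (simp_all add: spoch_Suc algebra_simps)

text \<open>The summand of \<open>\<omega>\<close> in additive notation: the factor \<open>Q\<^sup>k\<close> disappears for balanced parameters.\<close>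
definition vwp ::
  "(complex \<Rightarrow> complex) \<Rightarrow> complex \<Rightarrow> complex \<Rightarrow> complex list \<Rightarrow> nat \<Rightarrow> complex" where
  "vwp s h a as k = s (a + 2 * of_nat k * h) / s a * (spoch s a h k / spoch s h h k)
     * prod_list (map (\<lambda>x. spoch s x h k / spoch s (a + h - x) h k) as)"

locale odd_fun =
  fixes s :: "complex \<Rightarrow> complex"
  assumes odd: "s (- z) = - s z"
begin

lemma zero [simp]: "s 0 = 0"
  using odd[of 0] by (simp add: eq_neg_iff_add_eq_0)

text \<open>The progression from w, read backwards, consists of the negatives of the one from z;
  oddness gives one sign per factor.\<close>

lemma spoch_reverse:
  assumes "w = - z - (of_nat k - 1) * h"
  shows "spoch s w h k = (- 1) ^ k * spoch s z h k"
proof -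
  have "spoch s w h k = (\<Prod>i<k. s (w + of_nat (k - Suc i) * h))"
    unfolding spoch_def by (rule prod.nat_diff_reindex[symmetric])
  also have "\<dots> = (\<Prod>i<k. - s (z + of_nat i * h))"
  proof (rule prod.cong)
    fix i assume "i \<in> {..<k}"
    then have "w + of_nat (k - Suc i) * h = - (z + of_nat i * h)"
      by (simp add: assms of_nat_diff algebra_simps)
    then show "s (w + of_nat (k - Suc i) * h) = - s (z + of_nat i * h)"
      using odd by metis
  qed simp
  also have "\<dots> = (- 1) ^ k * spoch s z h k"
    by (simp add: spoch_def prod.distrib[symmetric] flip: prod_constant) (simp add: prod_uminus)
  finally show ?thesis .
qed

text \<open>Turns a factorial whose start depends on n, such as the terminating one from -nh, into a
  quotient of factorials of lengths n and n - k.\<close>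

lemma spoch_reverse_part:
  assumes "k \<le> n" "w = - z - (of_nat n - 1) * h"
  shows "spoch s w h k * spoch s z h (n - k) = (- 1) ^ k * spoch s z h n"
proof -
  have "spoch s w h k = (- 1) ^ k * spoch s (z + of_nat (n - k) * h) h k"
    by (rule spoch_reverse) (use assms in \<open>simp add: of_nat_diff algebra_simps\<close>)
  moreover have "spoch s z h n = spoch s z h (n - k) * spoch s (z + of_nat (n - k) * h) h k"
    using spoch_add[of s z h "n - k" k] assms(1) by simp
  ultimately show ?thesis by simp
qed

end

section \<open>The elliptic binomial theorem and the summation formula derived from it\<close>

locale elliptic_fun = odd_fun +
  assumes add: "s (x + y) * s (x - y) * s (u + v) * s (u - v)
       - s (x + v) * s (x - v) * s (u + y) * s (u - y)
       = s (x + u) * s (x - u) * s (y + v) * s (y - v)"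
begin

text \<open>All twelve arguments are free, so an instance is fixed by x, y, u, v and simplification
  checks linear equations. To fit a given product, x and y are the half-sum and half-difference of
  \<open>a1\<close> and \<open>a2\<close>, and u and v those of \<open>a3\<close> and
  \<open>a4\<close>.\<close>

lemma add_inst:
  assumes "a1 = x + y" "a2 = x - y" "a3 = u + v" "a4 = u - v"
    and "b1 = x + v" "b2 = x - v" "b3 = u + y" "b4 = u - y"
    and "c1 = x + u" "c2 = x - u" "c3 = y + v" "c4 = y - v"
  shows "s a1 * s a2 * s a3 * s a4 - s b1 * s b2 * s b3 * s b4 = s c1 * s c2 * s c3 * s c4"
  unfolding assms by (rule add)

text \<open>The elliptic binomial coefficient: writing \<open>[z]_k\<close> for
  \<open>spoch s z h k\<close>, the coefficient of \<open>[B+x]_k [B-x]_k [C+x]_m [C-x]_m\<close> in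
  the expansion of \<open>[A+x]_N [A-x]_N\<close>, where N = k + m.\<close>

definition ell_binom :: "complex \<Rightarrow> complex \<Rightarrow> complex \<Rightarrow> complex \<Rightarrow> nat \<Rightarrow> nat \<Rightarrow> complex" where
  "ell_binom h A B C k m = spoch s h h (k + m) / (spoch s h h k * spoch s h h m)
     * (spoch s (A + C + of_nat m * h) h k * spoch s (A - C) h k
        * spoch s (A + B + of_nat k * h) h m * spoch s (A - B) h m)
     / (spoch s (B + C) h (k + m) * spoch s (B - C - of_nat m * h) h k * spoch s (C - B - of_nat k * h) h m)"

text \<open>The two coefficients below come from writing \<open>[A + (k+m)h \<plusminus> x]\<close> as a linear
  combination of \<open>[B + kh \<plusminus> x]\<close> and \<open>[C + mh \<plusminus> x]\<close> by the addition formula, so that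
  the expansion coefficients obey a Pascal-type recurrence.\<close>
definition ell_binom_up :: "complex \<Rightarrow> complex \<Rightarrow> complex \<Rightarrow> complex \<Rightarrow> nat \<Rightarrow> nat \<Rightarrow> complex" where
  "ell_binom_up h A B C k m = s (A + C + (of_nat k + 2 * of_nat m) * h) * s (A - C + of_nat k * h)
      / (s (B + C + (of_nat k + of_nat m) * h) * s (B - C + (of_nat k - of_nat m) * h))"

definition ell_binom_down :: "complex \<Rightarrow> complex \<Rightarrow> complex \<Rightarrow> complex \<Rightarrow> nat \<Rightarrow> nat \<Rightarrow> complex" where
  "ell_binom_down h A B C k m = s (A + B + (2 * of_nat k + of_nat m) * h) * s (A - B + of_nat m * h)
      / (s (B + C + (of_nat k + of_nat m) * h) * s (C - B + (of_nat m - of_nat k) * h))"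

text \<open>The three terms share the factor -K; over a common denominator, what remains is a single
  instance of the addition formula, \<open>key\<close>.\<close>

lemma ell_binom_Suc_Suc:
  assumes h: "spoch s h h (l + m + 2) \<noteq> 0" and BC: "spoch s (B + C) h (l + m + 2) \<noteq> 0"
    and bc: "\<And>i::int. \<bar>i\<bar> \<le> int (l + m + 2) \<Longrightarrow> s (B - C + of_int i * h) \<noteq> 0"
  shows "ell_binom h A B C (Suc l) (Suc m)
    = ell_binom h A B C l (Suc m) * ell_binom_up h A B C l (Suc m) + ell_binom h A B C (Suc l) m * ell_binom_down h A B C (Suc l) m"
proof -
  define f1 f2 where "f1 = ell_binom_up h A B C l (Suc m)" "f2 = ell_binom_down h A B C (Suc l) m"
  define L M where "L = (of_nat l :: complex)" "M = (of_nat m :: complex)"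
  define Z where "Z = B - C"
  \<comment> \<open>Capital letters from here on are factorials common to the three coefficients;
    the small z-values are factors s (B - C + ih) in which their denominators differ.\<close>
  define H where "H = spoch s h h (l + m + 1)"
  define Hl where "Hl = spoch s h h l"
  define Hm where "Hm = spoch s h h m"
  define P where "P = spoch s (A + C + (M + 1) * h) h l"
  define Q where "Q = spoch s (A + B + (L + 1) * h) h m"
  define D where "D = spoch s (A - C) h l"
  define E where "E = spoch s (A - B) h m"
  define G where "G = spoch s (B + C) h (l + m + 1)"
  define W where "W = spoch s (Z - M * h) h l"
  define V where "V = spoch s (- Z - L * h) h m"
  define zp where "zp = s (Z - (M + 1) * h)"
  define zm where "zm = s (Z + (L + 1) * h)"
  define z0 where "z0 = s (Z + (L - M) * h)"
  define zl where "zl = s (Z + (L - M - 1) * h)"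
  define zr where "zr = s (Z + (L - M + 1) * h)"
  have bc': "s (Z + w) \<noteq> 0" if "w = of_int i * h" "\<bar>i\<bar> \<le> int (l + m + 2)" for i w
    using bc[OF that(2)] that(1) by (simp add: Z_def)
  have nz: "zp \<noteq> 0" "zm \<noteq> 0" "z0 \<noteq> 0" "zl \<noteq> 0" "zr \<noteq> 0"
    unfolding zp_def zm_def z0_def zl_def zr_def diff_conv_add_uminus[of Z]
    by (rule bc'[of _ "- int (m + 1)"] bc'[of _ "int (l + 1)"] bc'[of _ "int l - int m"]
        bc'[of _ "int l - int m - 1"] bc'[of _ "int l - int m + 1"]; simp add: L_M_def algebra_simps)+
  have nzp: "Hl \<noteq> 0" "Hm \<noteq> 0" "G \<noteq> 0" "s ((L + 1) * h) \<noteq> 0" "s ((M + 1) * h) \<noteq> 0"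
      "s (B + C + (L + M + 1) * h) \<noteq> 0"
  proof -
    have hh: "s (of_nat (Suc i) * h) \<noteq> 0" if "i < l + m + 2" for i
      using h that by (auto simp: spoch_eq_0_iff algebra_simps)
    show "s ((L + 1) * h) \<noteq> 0" "s ((M + 1) * h) \<noteq> 0"
      using hh[of l] hh[of m] by (auto simp: L_M_def add.commute)
    show "Hl \<noteq> 0" "Hm \<noteq> 0" "G \<noteq> 0"
      using h BC by (auto simp: Hl_def Hm_def G_def spoch_eq_0_iff)
    have "l + m + 1 < l + m + 2" by simp
    then have "s (B + C + of_nat (l + m + 1) * h) \<noteq> 0"
      using BC unfolding spoch_eq_0_iff by blast
    then show "s (B + C + (L + M + 1) * h) \<noteq> 0" by (simp add: L_M_def algebra_simps)
  qed
  have W: "W \<noteq> 0" unfolding W_def spoch_eq_0_iff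
  proof safe
    fix i assume "i < l" "s (Z - M * h + of_nat i * h) = 0"
    moreover have "\<bar>int i - int m\<bar> \<le> int (l + m + 2)" using \<open>i < l\<close> by linarith
    ultimately show False using bc'[of "of_nat i * h - M * h" "int i - int m"]
      by (simp add: L_M_def algebra_simps)
  qed
  have V: "V \<noteq> 0" unfolding V_def spoch_eq_0_iff
  proof safe
    fix i assume "i < m" "s (- Z - L * h + of_nat i * h) = 0"
    moreover have "\<bar>int l - int i\<bar> \<le> int (l + m + 2)" using \<open>i < m\<close> by linarith
    ultimately show False using bc'[of "L * h - of_nat i * h" "int l - int i"] odd[of "Z + (L - of_nat i) * h"]
      by (simp add: L_M_def algebra_simps)
  qed
  have e_h: "spoch s h h l = Hl" "spoch s h h m = Hm" "spoch s h h (Suc l) = Hl * s ((L + 1) * h)" "spoch s h h (Suc m) = Hm * s ((M + 1) * h)"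
      "spoch s h h (Suc (l + m)) = H" "spoch s h h (Suc (Suc (l + m))) = H * s ((L + M + 2) * h)"
    by (simp_all add: spoch_Suc H_def Hl_def Hm_def L_M_def algebra_simps)
  have e_P: "spoch s (A + C + of_nat (Suc m) * h) h (Suc l) = P * s (A + C + (L + M + 1) * h)"
      "spoch s (A + C + of_nat (Suc m) * h) h l = P"
      "spoch s (A + C + of_nat m * h) h (Suc l) = s (A + C + M * h) * P"
    by (simp add: spoch_Suc P_def L_M_def algebra_simps, simp add: P_def L_M_def add.commute,
        simp add: spoch_Suc_left P_def L_M_def algebra_simps)
  have e_Q: "spoch s (A + B + of_nat (Suc l) * h) h (Suc m) = Q * s (A + B + (L + M + 1) * h)"
      "spoch s (A + B + of_nat (Suc l) * h) h m = Q"
      "spoch s (A + B + of_nat l * h) h (Suc m) = s (A + B + L * h) * Q"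
    by (simp add: spoch_Suc Q_def L_M_def algebra_simps, simp add: Q_def L_M_def add.commute,
        simp add: spoch_Suc_left Q_def L_M_def algebra_simps)
  have e_D: "spoch s (A - C) h l = D" "spoch s (A - C) h (Suc l) = D * s (A - C + L * h)"
      "spoch s (A - B) h m = E" "spoch s (A - B) h (Suc m) = E * s (A - B + M * h)"
    by (simp_all add: spoch_Suc D_def E_def L_M_def)
  have e_G: "spoch s (B + C) h (Suc (l + m)) = G"
      "spoch s (B + C) h (Suc (Suc (l + m))) = G * s (B + C + (L + M + 1) * h)"
    by (simp_all add: spoch_Suc G_def L_M_def algebra_simps)
  have e_W: "spoch s (B - C - of_nat (Suc m) * h) h (Suc l) = zp * W"
      "spoch s (B - C - of_nat (Suc m) * h) h l = zp * W / zl"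
      "spoch s (B - C - of_nat m * h) h (Suc l) = W * z0"
  proof -
    show 1: "spoch s (B - C - of_nat (Suc m) * h) h (Suc l) = zp * W"
      by (simp add: spoch_Suc_left zp_def W_def Z_def L_M_def algebra_simps)
    have "spoch s (B - C - of_nat (Suc m) * h) h l * zl = spoch s (B - C - of_nat (Suc m) * h) h (Suc l)"
      by (simp add: spoch_Suc zl_def W_def Z_def L_M_def algebra_simps)
    with 1 nz show "spoch s (B - C - of_nat (Suc m) * h) h l = zp * W / zl" by (simp add: field_simps)
    show "spoch s (B - C - of_nat m * h) h (Suc l) = W * z0"
      by (simp add: spoch_Suc z0_def W_def Z_def L_M_def algebra_simps)
  qed
  have e_V: "spoch s (C - B - of_nat (Suc l) * h) h (Suc m) = - (zm * V)"
      "spoch s (C - B - of_nat (Suc l) * h) h m = zm * V / zr"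
      "spoch s (C - B - of_nat l * h) h (Suc m) = - (V * z0)"
  proof -
    have zm: "- zm = s (- Z - (L + 1) * h)" using odd[of "Z + (L + 1) * h"] by (simp add: zm_def)
    have zr: "- zr = s (- Z - (L + 1) * h + M * h)"
      using odd[of "Z + (L - M + 1) * h"] by (simp add: zr_def algebra_simps)
    have z0: "- z0 = s (- Z - L * h + M * h)"
      using odd[of "Z + (L - M) * h"] by (simp add: z0_def algebra_simps)
    have "spoch s (C - B - of_nat (Suc l) * h) h (Suc m) = - zm * V"
      unfolding zm by (simp add: spoch_Suc_left V_def Z_def L_M_def algebra_simps)
    then show 1: "spoch s (C - B - of_nat (Suc l) * h) h (Suc m) = - (zm * V)" by simp
    have "spoch s (C - B - of_nat (Suc l) * h) h m * - zr = spoch s (C - B - of_nat (Suc l) * h) h (Suc m)"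
      unfolding zr by (simp add: spoch_Suc V_def Z_def L_M_def algebra_simps)
    with 1 nz show "spoch s (C - B - of_nat (Suc l) * h) h m = zm * V / zr" by (simp add: field_simps)
    have "spoch s (C - B - of_nat l * h) h (Suc m) = V * - z0"
      unfolding z0 by (simp add: spoch_Suc V_def Z_def L_M_def algebra_simps)
    then show "spoch s (C - B - of_nat l * h) h (Suc m) = - (V * z0)" by simp
  qed
  have f: "f1 = s (A + C + (L + 2 * M + 2) * h) * s (A - C + L * h) / (s (B + C + (L + M + 1) * h) * zl)"
      "f2 = - (s (A + B + (2 * L + M + 2) * h) * s (A - B + M * h) / (s (B + C + (L + M + 1) * h) * zr))"
  proof -
    show "f1 = s (A + C + (L + 2 * M + 2) * h) * s (A - C + L * h) / (s (B + C + (L + M + 1) * h) * zl)"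
      by (simp add: f1_f2_def ell_binom_up_def zl_def Z_def L_M_def algebra_simps)
    have "s (C - B + (M - L - 1) * h) = - zr"
      unfolding zr_def odd[symmetric] by (simp add: Z_def algebra_simps)
    then show "f2 = - (s (A + B + (2 * L + M + 2) * h) * s (A - B + M * h) / (s (B + C + (L + M + 1) * h) * zr))"
      by (simp add: f1_f2_def ell_binom_down_def L_M_def algebra_simps)
  qed
  have key: "s ((L + M + 2) * h) * s (A + C + (L + M + 1) * h) * s (A + B + (L + M + 1) * h) * z0
     - s (A + C + (L + 2 * M + 2) * h) * s ((L + 1) * h) * zm * s (A + B + L * h)
     = s (A + B + (2 * L + M + 2) * h) * zp * s ((M + 1) * h) * s (A + C + M * h)"
  proof -
    have "s ((L + M + 2) * h) * s (A + C + (L + M + 1) * h) * s (A + B + (L + M + 1) * h) * s (Z + (L - M) * h)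
     - s (A + C + (L + 2 * M + 2) * h) * s ((L + 1) * h) * s (Z + (L + 1) * h) * s (A + B + L * h)
     = s (A + B + (2 * L + M + 2) * h) * s (- (Z - (M + 1) * h)) * s ((M + 1) * h) * s (- (A + C + M * h))"
      by (rule add_inst[where x = "(A + C + (2 * L + 2 * M + 3) * h) / 2" and y = "(h - A - C) / 2"
            and u = "(2 * (A + B) - (A + C) + (2 * L + 1) * h) / 2" and v = "(A + C + (2 * M + 1) * h) / 2"])
         (simp_all add: field_simps Z_def)
    then show ?thesis unfolding odd z0_def zm_def zp_def by simp
  qed
  define K where "K = H * P * Q * D * s (A - C + L * h) * E * s (A - B + M * h)
    / (Hl * Hm * G * s (B + C + (L + M + 1) * h) * W * V)"
  have "ell_binom h A B C (Suc l) (Suc m) = - K * (s ((L + M + 2) * h) * s (A + C + (L + M + 1) * h)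
      * s (A + B + (L + M + 1) * h)) / (s ((L + 1) * h) * s ((M + 1) * h) * zp * zm)"
    unfolding ell_binom_def e_h e_P e_Q e_D e_G e_W e_V K_def add_Suc add_Suc_right
    using nz nzp W V by (simp add: divide_simps)
  moreover have "ell_binom h A B C l (Suc m) * f1 = - K * (s (A + C + (L + 2 * M + 2) * h) * s (A + B + L * h))
      / (s ((M + 1) * h) * zp * z0)"
    unfolding ell_binom_def f e_h e_P e_Q e_D e_G e_W e_V K_def add_Suc add_Suc_right
    using nz nzp W V by (simp add: divide_simps)
  moreover have "ell_binom h A B C (Suc l) m * f2 = - K * (s (A + B + (2 * L + M + 2) * h) * s (A + C + M * h))
      / (s ((L + 1) * h) * z0 * zm)"
    unfolding ell_binom_def f e_h e_P e_Q e_D e_G e_W e_V K_def add_Suc add_Suc_right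
    using nz nzp W V by (simp add: divide_simps)
  moreover have "(s ((L + M + 2) * h) * s (A + C + (L + M + 1) * h)
      * s (A + B + (L + M + 1) * h)) / (s ((L + 1) * h) * s ((M + 1) * h) * zp * zm)
      = (s (A + C + (L + 2 * M + 2) * h) * s (A + B + L * h)) / (s ((M + 1) * h) * zp * z0)
       + (s (A + B + (2 * L + M + 2) * h) * s (A + C + M * h)) / (s ((L + 1) * h) * z0 * zm)"
    using nz nzp key[unfolded diff_eq_eq] by (simp add: divide_simps) (simp add: mult_ac ring_distribs)
  ultimately show ?thesis
    unfolding f1_f2_def[symmetric] by (simp only: times_divide_eq_right[symmetric] distrib_left)
qed

lemma ell_binom_0_Suc:
  assumes "spoch s h h (Suc m) \<noteq> 0"
  shows "ell_binom h A B C 0 (Suc m) = ell_binom h A B C 0 m * ell_binom_down h A B C 0 m"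
  using assms by (auto simp: ell_binom_def ell_binom_down_def spoch_Suc times_divide_times_eq mult_ac)

lemma ell_binom_Suc_0:
  assumes "spoch s h h (Suc k) \<noteq> 0"
  shows "ell_binom h A B C (Suc k) 0 = ell_binom h A B C k 0 * ell_binom_up h A B C k 0"
  using assms by (auto simp: ell_binom_def ell_binom_up_def spoch_Suc times_divide_times_eq mult_ac)

text \<open>Pascal's rule in summed form, for arbitrary weights T. The ends k = 0 and k = Suc N have
  a single predecessor each, hence the two separate hypotheses.\<close>

lemma pascal_sum:
  fixes c u d :: "nat \<Rightarrow> nat \<Rightarrow> 'a::comm_ring_1"
  assumes "c 0 (Suc N) = c 0 N * d 0 N" "c (Suc N) 0 = c N 0 * u N 0"
    and "\<And>k m. Suc (k + m) = N \<Longrightarrow> c (Suc k) (Suc m) = c k (Suc m) * u k (Suc m) + c (Suc k) m * d (Suc k) m"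
  shows "(\<Sum>k\<le>Suc N. c k (Suc N - k) * T k (Suc N - k))
    = (\<Sum>k\<le>N. c k (N - k) * (u k (N - k) * T (Suc k) (N - k) + d k (N - k) * T k (Suc (N - k))))"
proof -
  \<comment> \<open>U and D are the contributions inherited from index k - 1 and from index k; the
    values U 0 = 0 and D (Suc N) = 0 encode the missing predecessors.\<close>
  define U where "U k = (case k of 0 \<Rightarrow> 0 | Suc l \<Rightarrow> if l \<le> N then c l (N - l) * u l (N - l) else 0)" for k
  define D where "D k = (if k \<le> N then c k (N - k) * d k (N - k) else 0)" for k
  have "c k (Suc N - k) = U k + D k" if "k \<le> Suc N" for k
  proof (cases k)
    case 0
    then show ?thesis using assms(1) by (simp add: U_def D_def)
  next
    case (Suc l)
    show ?thesis
    proof (cases "l = N")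
      case True
      then show ?thesis using assms(2) Suc by (simp add: U_def D_def)
    next
      case False
      then have "l < N" using that Suc by simp
      then obtain m where "N = Suc (l + m)" using less_iff_Suc_add[of l N] by blast
      then show ?thesis using assms(3)[of l m] Suc by (simp add: U_def D_def)
    qed
  qed
  then have "(\<Sum>k\<le>Suc N. c k (Suc N - k) * T k (Suc N - k))
      = (\<Sum>k\<le>Suc N. U k * T k (Suc N - k)) + (\<Sum>k\<le>Suc N. D k * T k (Suc N - k))"
    by (simp add: distrib_right sum.distrib[symmetric] del: sum.atMost_Suc)
  also have "(\<Sum>k\<le>Suc N. U k * T k (Suc N - k)) = (\<Sum>k\<le>N. c k (N - k) * u k (N - k) * T (Suc k) (N - k))"
    unfolding sum.atMost_Suc_shift by (simp add: U_def)
  also have "(\<Sum>k\<le>Suc N. D k * T k (Suc N - k)) = (\<Sum>k\<le>N. c k (N - k) * d k (N - k) * T k (Suc (N - k)))"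
    by (simp add: D_def Suc_diff_le)
  finally show ?thesis
    by (simp add: sum.distrib[symmetric] algebra_simps)
qed

text \<open>Induction on N. In the k-th term the new pair of factors f is split, with coefficients
  depending on k, into the pair that lengthens the B-factorials and the pair that lengthens the
  C-factorials; \<open>pascal_sum\<close> collects equal products.\<close>

theorem elliptic_binomial:
  assumes h: "spoch s h h N \<noteq> 0" and BC: "spoch s (B + C) h N \<noteq> 0"
    and bc: "\<And>i::int. \<bar>i\<bar> \<le> int N \<Longrightarrow> s (B - C + of_int i * h) \<noteq> 0"
  shows "spoch s (A + x) h N * spoch s (A - x) h N = (\<Sum>k\<le>N. ell_binom h A B C k (N - k) *
    (spoch s (B + x) h k * spoch s (B - x) h k * (spoch s (C + x) h (N - k) * spoch s (C - x) h (N - k))))"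
  using assms
proof (induction N)
  case 0
  then show ?case by (simp add: ell_binom_def)
next
  case (Suc N)
  have IH: "spoch s (A + x) h N * spoch s (A - x) h N = (\<Sum>k\<le>N. ell_binom h A B C k (N - k) *
    (spoch s (B + x) h k * spoch s (B - x) h k * (spoch s (C + x) h (N - k) * spoch s (C - x) h (N - k))))"
    using Suc.prems by (intro Suc.IH) (auto simp: spoch_Suc)
  define T where "T k m = spoch s (B + x) h k * spoch s (B - x) h k * (spoch s (C + x) h m * spoch s (C - x) h m)" for k m
  define f where "f = s (A + x + of_nat N * h) * s (A - x + of_nat N * h)"
  have step: "f * T k (N - k) = ell_binom_up h A B C k (N - k) * T (Suc k) (N - k)
      + ell_binom_down h A B C k (N - k) * T k (Suc (N - k))" if "k \<le> N" for k
  proof -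
    define m where "m = N - k"
    define K M where "K = (of_nat k :: complex)" "M = (of_nat m :: complex)"
    have N: "N = k + m" using that by (simp add: m_def)
    define d where "d = s (B + C + (K + M) * h) * s (B - C + (K - M) * h)"
    have d': "s (C - B + (M - K) * h) = - s (B - C + (K - M) * h)"
      unfolding odd[symmetric] by (simp add: algebra_simps)
    have "d \<noteq> 0"
    proof -
      have "s (B + C + of_nat N * h) \<noteq> 0" using Suc.prems(2) by (simp add: spoch_Suc)
      then have "s (B + C + (K + M) * h) \<noteq> 0" by (simp add: N K_M_def)
      moreover have "s (B - C + (K - M) * h) \<noteq> 0"
        using Suc.prems(3)[of "int k - int m"] N by (simp add: K_M_def)
      ultimately show ?thesis by (simp add: d_def)
    qed
    have "s (A + x + (K + M) * h) * s (A - x + (K + M) * h) * s (B + C + (K + M) * h) * s (B - C + (K - M) * h)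
      - s (A + C + (K + 2 * M) * h) * s (A - C + K * h) * s (B + x + K * h) * s (B - x + K * h)
      = s (A + B + (2 * K + M) * h) * s (A - B + M * h) * s (C + x + M * h) * s (- (C - x + M * h))"
      by (rule add_inst[where x = "A + (K + M) * h" and y = x and u = "B + K * h" and v = "C + M * h"])
         (simp_all add: algebra_simps)
    then have "f * d = s (A + C + (K + 2 * M) * h) * s (A - C + K * h) * (s (B + x + K * h) * s (B - x + K * h))
      - s (A + B + (2 * K + M) * h) * s (A - B + M * h) * (s (C + x + M * h) * s (C - x + M * h))"
      unfolding odd f_def d_def N of_nat_add K_M_def[symmetric] by (simp add: algebra_simps)
    then have "f = ell_binom_up h A B C k m * (s (B + x + K * h) * s (B - x + K * h))
        + ell_binom_down h A B C k m * (s (C + x + M * h) * s (C - x + M * h))"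
      using \<open>d \<noteq> 0\<close> unfolding ell_binom_up_def ell_binom_down_def K_M_def[symmetric] d'
      by (simp add: d_def field_simps)
    then show ?thesis
      unfolding m_def[symmetric] T_def spoch_Suc K_M_def[symmetric] by (simp add: algebra_simps)
  qed
  have "spoch s (A + x) h (Suc N) * spoch s (A - x) h (Suc N) = f * (\<Sum>k\<le>N. ell_binom h A B C k (N - k) * T k (N - k))"
    unfolding T_def IH[symmetric] by (simp add: spoch_Suc f_def)
  also have "\<dots> = (\<Sum>k\<le>N. ell_binom h A B C k (N - k) * (f * T k (N - k)))"
    by (simp add: sum_distrib_left mult_ac)
  also have "\<dots> = (\<Sum>k\<le>N. ell_binom h A B C k (N - k) * (ell_binom_up h A B C k (N - k) * T (Suc k) (N - k)
      + ell_binom_down h A B C k (N - k) * T k (Suc (N - k))))"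
    using step by (intro sum.cong) auto
  also have "\<dots> = (\<Sum>k\<le>Suc N. ell_binom h A B C k (Suc N - k) * T k (Suc N - k))"
  proof (rule pascal_sum[symmetric])
    fix k m assume "Suc (k + m) = N"
    then have "k + m + 2 = Suc N" by simp
    then show "ell_binom h A B C (Suc k) (Suc m)
      = ell_binom h A B C k (Suc m) * ell_binom_up h A B C k (Suc m) + ell_binom h A B C (Suc k) m * ell_binom_down h A B C (Suc k) m"
      using Suc.prems by (intro ell_binom_Suc_Suc) simp_all
  qed (use Suc.prems in \<open>simp_all add: ell_binom_0_Suc ell_binom_Suc_0\<close>)
  finally show ?case by (simp only: T_def)
qed

text \<open>The elliptic binomial theorem in other variables: with d and e as B + x and B - x, the
  k-th term of the expansion is the k-th term of the series times a factor free of k.\<close>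

theorem frenkel_turaev:
  assumes bal: "b + c + d + e = 2 * a + (of_nat N + 1) * h"
    and nz: "spoch s h h N \<noteq> 0" "spoch s a h (2 * N + 1) \<noteq> 0" "spoch s (a + h - b) h N \<noteq> 0"
      "spoch s (a + h - c) h N \<noteq> 0" "spoch s (a + h - d) h N \<noteq> 0" "spoch s (a + h - b - c - d) h N \<noteq> 0"
      "spoch s (a + h - b - c) h N \<noteq> 0"
  shows "(\<Sum>k\<le>N. vwp s h a [b, c, d, e, - (of_nat N * h)] k)
    = spoch s (a + h) h N * spoch s (a + h - b - c) h N * spoch s (a + h - b - d) h N * spoch s (a + h - c - d) h N
    / (spoch s (a + h - b) h N * spoch s (a + h - c) h N * spoch s (a + h - d) h N * spoch s (a + h - b - c - d) h N)"
proof -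
  define B where "B = (d + e) / 2"
  define x where "x = (d - e) / 2"
  \<comment> \<open>C and A are chosen so that B - C = a + Nh and A - C = b. The balancing condition
    then gives B + C = a + h - b - c and lets c appear after reversal.\<close>
  define C where "C = B - a - of_nat N * h"
  define A where "A = C + b"
  have d: "d = B + x" and e: "e = B - x" by (simp_all add: B_def x_def field_simps)
  have B2: "2 * B = 2 * a + (of_nat N + 1) * h - b - c"
  proof -
    have "2 * B = d + e" by (simp add: B_def)
    then show ?thesis unfolding bal[symmetric] by simp
  qed
  have an: "s (a + of_nat i * h) \<noteq> 0" if "i \<le> 2 * N" for i
    using nz(2) that by (auto simp: spoch_eq_0_iff)
  have sa: "s a \<noteq> 0" using an[of 0] by simp
  have e': "spoch s (a + h - e) h N = (- 1) ^ N * spoch s (a + h - b - c - d) h N"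
  proof (rule spoch_reverse)
    have "e = 2 * a + (of_nat N + 1) * h - b - c - d" unfolding bal[symmetric] by simp
    then show "a + h - e = - (a + h - b - c - d) - (of_nat N - 1) * h" by (simp add: algebra_simps)
  qed
  have "spoch s (A + x) h N * spoch s (A - x) h N = (\<Sum>k\<le>N. ell_binom h A B C k (N - k) *
    (spoch s (B + x) h k * spoch s (B - x) h k * (spoch s (C + x) h (N - k) * spoch s (C - x) h (N - k))))"
  proof (rule elliptic_binomial[OF nz(1)])
    have "B + C = a + h - b - c" using B2 by (simp add: C_def algebra_simps)
    then show "spoch s (B + C) h N \<noteq> 0" using nz(7) by simp
    \<comment> \<open>Here B - C + ih = a + (N + i)h, with indices from 0 to 2N: the 2N + 1 factors
      assumed nonzero.\<close>
    fix i :: int assume "\<bar>i\<bar> \<le> int N"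
    then show "s (B - C + of_int i * h) \<noteq> 0"
      using an[of "nat (int N + i)"] by (simp add: C_def algebra_simps nat_le_iff)
  qed
  also have "spoch s (A + x) h N = (- 1) ^ N * spoch s (a + h - b - d) h N"
    by (rule spoch_reverse) (simp add: A_def C_def d algebra_simps)
  also have "A - x = a + h - c - d"
    using B2 by (simp add: A_def C_def d algebra_simps)
  also have "(\<Sum>k\<le>N. ell_binom h A B C k (N - k) *
      (spoch s (B + x) h k * spoch s (B - x) h k * (spoch s (C + x) h (N - k) * spoch s (C - x) h (N - k))))
    = (\<Sum>k\<le>N. vwp s h a [b, c, d, e, - (of_nat N * h)] k) * (spoch s (a + h - b) h N * spoch s (a + h - c) h N
      * spoch s (a + h - d) h N * spoch s (a + h - e) h N / (spoch s (a + h - b - c) h N * spoch s (a + h) h N))"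
    unfolding sum_distrib_right
  proof (rule sum.cong)
    fix k assume "k \<in> {..N}"
    then have k: "k \<le> N" by simp
    define m where "m = N - k"
    have N: "N = k + m" using k by (simp add: m_def)
    have nzk: "spoch s z h k \<noteq> 0" if "spoch s z h N \<noteq> 0" for z
      using that k by (auto simp: spoch_eq_0_iff)
    \<comment> \<open>The identities r1 to r7 trade factorials involving m = N - k for ones whose
      dependence on k matches the series, with explicit signs.\<close>
    have r1: "spoch s (- (of_nat N * h)) h k * spoch s h h m = (- 1) ^ k * spoch s h h N"
      unfolding m_def by (rule spoch_reverse_part[OF k]) (simp add: algebra_simps)
    have r2: "spoch s (A + C + of_nat m * h) h k = (- 1) ^ k * spoch s c h k"
      by (rule spoch_reverse) (use B2 in \<open>simp add: A_def C_def N algebra_simps\<close>)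
    have r3: "spoch s (A - C) h k = spoch s b h k" by (simp add: A_def)
    have r4: "spoch s (a + h - c) h N = spoch s (a + h - c) h k * spoch s (A + B + of_nat k * h) h m"
    proof -
      have "A + B + of_nat k * h = a + h - c + of_nat k * h"
        using B2 by (simp add: A_def C_def algebra_simps)
      then show ?thesis by (simp only: N spoch_add)
    qed
    have r5: "spoch s (a + h - z) h k * spoch s (z - a - of_nat N * h) h m = (- 1) ^ k * (- 1) ^ N * spoch s (a + h - z) h N" for z
    proof -
      have "spoch s (a + h - z) h N = (- 1) ^ N * spoch s (z - a - of_nat N * h) h N"
        by (rule spoch_reverse) (simp add: algebra_simps)
      moreover have "spoch s (a + h - z) h k * spoch s (z - a - of_nat N * h) h m = (- 1) ^ k * spoch s (z - a - of_nat N * h) h N"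
        unfolding m_def by (rule spoch_reverse_part[OF k]) (simp add: algebra_simps)
      ultimately show ?thesis by simp
    qed
    have r6: "spoch s a h (2 * k) = spoch s a h k * spoch s (B - C - of_nat m * h) h k"
    proof -
      have "B - C - of_nat m * h = a + of_nat k * h" by (simp add: C_def N algebra_simps)
      then show ?thesis using spoch_add[of s a h k k] by (simp add: mult_2)
    qed
    \<comment> \<open>Up to sign, the two denominator factorials of \<open>ell_binom\<close> built
      on B - C and C - B run through a + kh, ..., a + (k + N)h with a + 2kh left out. This gap is
      the origin of the very-well-poised factor.\<close>
    have r7: "spoch s a h (2 * k) * s (a + 2 * of_nat k * h) * spoch s (C - B - of_nat k * h) h m
        = (- 1) ^ m * (s a * spoch s (a + h) h N * spoch s (a + h + of_nat N * h) h k)"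
    proof -
      have "spoch s (C - B - of_nat k * h) h m = (- 1) ^ m * spoch s (a + of_nat (Suc (2 * k)) * h) h m"
        by (rule spoch_reverse) (simp add: C_def N algebra_simps)
      moreover have "spoch s a h (Suc (2 * k)) * spoch s (a + of_nat (Suc (2 * k)) * h) h m
          = spoch s a h (Suc (N + k))"
        unfolding spoch_add[symmetric] by (rule arg_cong) (simp add: N)
      moreover have "spoch s a h (Suc (N + k)) = s a * spoch s (a + h) h N * spoch s (a + h + of_nat N * h) h k"
        by (simp add: spoch_Suc_left spoch_add)
      ultimately show ?thesis by (simp add: spoch_Suc mult_ac)
    qed
    \<comment> \<open>Signs are treated as variables with values 1 and -1, so that a case split
      leaves pure field arithmetic.\<close>
    define \<sigma> \<tau> where "\<sigma> = (- 1 :: complex) ^ k" "\<tau> = (- 1 :: complex) ^ m"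
    have sgn: "(- 1) ^ N = \<sigma> * \<tau>" "\<sigma> = 1 \<or> \<sigma> = - 1" "\<tau> = 1 \<or> \<tau> = - 1"
      by (simp_all add: N \<sigma>_\<tau>_def power_add minus_one_power_iff)
    have nz': "spoch s h h k \<noteq> 0" "spoch s h h m \<noteq> 0" "spoch s a h (2 * k) \<noteq> 0" "spoch s a h k \<noteq> 0"
        "s (a + 2 * of_nat k * h) \<noteq> 0" "spoch s (a + h) h N \<noteq> 0" "spoch s (a + h + of_nat N * h) h k \<noteq> 0"
        "spoch s (a + h - e) h N \<noteq> 0"
    proof -
      show "spoch s h h k \<noteq> 0" "spoch s h h m \<noteq> 0" using nz(1) by (auto simp: N spoch_eq_0_iff)
      show "spoch s a h (2 * k) \<noteq> 0" "spoch s a h k \<noteq> 0" using nz(2) k by (auto simp: spoch_eq_0_iff)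
      show "s (a + 2 * of_nat k * h) \<noteq> 0" using an[of "2 * k"] k by (simp add: mult.assoc)
      have "spoch s a h (Suc (N + k)) \<noteq> 0" using an k by (auto simp: spoch_eq_0_iff)
      then show "spoch s (a + h) h N \<noteq> 0" "spoch s (a + h + of_nat N * h) h k \<noteq> 0"
        by (simp_all add: spoch_Suc_left spoch_add)
      show "spoch s (a + h - e) h N \<noteq> 0" using e' nz(6) by simp
    qed
    have b1: "spoch s h h N / (spoch s h h k * spoch s h h m) = \<sigma> * (spoch s (- (of_nat N * h)) h k / spoch s h h k)"
      using r1 nz' sgn(2) unfolding \<sigma>_\<tau>_def[symmetric] N[symmetric]
      by (elim disjE) (simp_all add: field_simps)
    have b4: "spoch s (A + B + of_nat k * h) h m = spoch s (a + h - c) h N / spoch s (a + h - c) h k"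
      using r4 nzk[OF nz(4)] by (simp add: field_simps)
    have b5: "spoch s (z - a - of_nat N * h) h m = \<tau> * (spoch s (a + h - z) h N / spoch s (a + h - z) h k)"
      if "spoch s (a + h - z) h N \<noteq> 0" for z
      using r5[of z] nzk[OF that] sgn(2,3) unfolding sgn(1) \<sigma>_\<tau>_def[symmetric]
      by (elim disjE) (simp_all add: field_simps)
    have b6: "spoch s (B - C - of_nat m * h) h k = spoch s a h (2 * k) / spoch s a h k"
      using r6 nz' by (simp add: field_simps)
    have b7: "spoch s (C - B - of_nat k * h) h m
        = \<tau> * (s a * spoch s (a + h) h N * spoch s (a + h + of_nat N * h) h k / (spoch s a h (2 * k) * s (a + 2 * of_nat k * h)))"
      using r7 nz' unfolding \<sigma>_\<tau>_def[symmetric] by (simp add: field_simps)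
    have args: "A - B = b - a - of_nat N * h" "C + x = d - a - of_nat N * h" "C - x = e - a - of_nat N * h"
        "B + x = d" "B - x = e" "B + C = a + h - b - c" "N - k = m"
      using B2 by (simp_all add: A_def C_def d e m_def algebra_simps)
    have ell_binom: "ell_binom h A B C k m = \<sigma> * (spoch s (- (of_nat N * h)) h k / spoch s h h k)
        * (\<sigma> * spoch s c h k * spoch s b h k * (spoch s (a + h - c) h N / spoch s (a + h - c) h k)
          * (\<tau> * (spoch s (a + h - b) h N / spoch s (a + h - b) h k)))
        / (spoch s (a + h - b - c) h N * (spoch s a h (2 * k) / spoch s a h k)
          * (\<tau> * (s a * spoch s (a + h) h N * spoch s (a + h + of_nat N * h) h k / (spoch s a h (2 * k) * s (a + 2 * of_nat k * h)))))"
      unfolding ell_binom_def b1 r2 r3 b4 b6 b7 args(1,6) b5[OF nz(3)] \<sigma>_\<tau>_def(1)[symmetric] N[symmetric] by simp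
    have vwp: "vwp s h a [b, c, d, e, - (of_nat N * h)] k = s (a + 2 * of_nat k * h) / s a * (spoch s a h k / spoch s h h k)
      * (spoch s b h k / spoch s (a + h - b) h k * (spoch s c h k / spoch s (a + h - c) h k * (spoch s d h k / spoch s (a + h - d) h k
      * (spoch s e h k / spoch s (a + h - e) h k * (spoch s (- (of_nat N * h)) h k / spoch s (a + h + of_nat N * h) h k)))))"
      by (simp add: vwp_def)
    have nz'': "spoch s (a + h - b) h k \<noteq> 0" "spoch s (a + h - c) h k \<noteq> 0" "spoch s (a + h - d) h k \<noteq> 0" "spoch s (a + h - e) h k \<noteq> 0"
      using nz nz' nzk by blast+
    show "ell_binom h A B C k (N - k) * (spoch s (B + x) h k * spoch s (B - x) h k * (spoch s (C + x) h (N - k) * spoch s (C - x) h (N - k)))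
      = vwp s h a [b, c, d, e, - (of_nat N * h)] k * (spoch s (a + h - b) h N * spoch s (a + h - c) h N
      * spoch s (a + h - d) h N * spoch s (a + h - e) h N / (spoch s (a + h - b - c) h N * spoch s (a + h) h N))"
      unfolding args ell_binom vwp b5[OF nz(5)] b5[OF nz'(8)]
      using nz' nz'' nz sa sgn(2,3) by (elim disjE) (simp_all add: divide_simps)
  qed simp
  finally have *: "(- 1) ^ N * spoch s (a + h - b - d) h N * spoch s (a + h - c - d) h N
    = (\<Sum>k\<le>N. vwp s h a [b, c, d, e, - (of_nat N * h)] k) * (spoch s (a + h - b) h N * spoch s (a + h - c) h N
      * spoch s (a + h - d) h N * ((- 1) ^ N * spoch s (a + h - b - c - d) h N) / (spoch s (a + h - b - c) h N * spoch s (a + h) h N))"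
    unfolding e' .
  define \<sigma> where "\<sigma> = (- 1 :: complex) ^ N"
  have "\<sigma> = 1 \<or> \<sigma> = - 1" by (simp add: \<sigma>_def minus_one_power_iff)
  moreover have "spoch s (a + h) h N \<noteq> 0"
    using an by (auto simp: spoch_eq_0_iff) (metis (no_types, opaque_lifting) Suc_leI add.assoc distrib_right mult_1 of_nat_Suc trans_le_add1 mult_2)
  ultimately show ?thesis
    using * nz unfolding \<sigma>_def[symmetric] by (elim disjE) (simp_all add: field_simps)
qed

end

section \<open>Bailey's transformation\<close>

lemma sum_swap_atMost:
  "(\<Sum>k\<le>n::nat. \<Sum>j\<le>k. (a j k :: 'a::comm_monoid_add)) = (\<Sum>j\<le>n. \<Sum>k=j..n. a j k)"
  by (induction n) (auto simp: sum.distrib)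

context elliptic_fun begin

text \<open>A Frenkel-Turaev sum of length k with base point \<mu>, read from right to left. The
  choice of \<mu> makes it balanced and makes the three pairwise quantities of the evaluation equal
  to d, c and b.\<close>

lemma bailey_lemma_inner:
  assumes lam: "\<mu> = 2 * a + h - b - c - d"
    and nz: "spoch s h h k \<noteq> 0" "spoch s \<mu> h (2 * k + 1) \<noteq> 0" "spoch s a h k \<noteq> 0" "spoch s (a + h - b) h k \<noteq> 0"
      "spoch s (a + h - c) h k \<noteq> 0" "spoch s (a + h - d) h k \<noteq> 0" "spoch s (a - \<mu>) h k \<noteq> 0" "spoch s d h k \<noteq> 0"
  shows "spoch s a h k / spoch s h h k * (spoch s b h k * spoch s c h k * spoch s d h k
      / (spoch s (a + h - b) h k * spoch s (a + h - c) h k * spoch s (a + h - d) h k))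
    = (\<Sum>j\<le>k. vwp s h \<mu> [] j * (spoch s (\<mu> + b - a) h j * spoch s (\<mu> + c - a) h j * spoch s (\<mu> + d - a) h j
        / (spoch s (a + h - b) h j * spoch s (a + h - c) h j * spoch s (a + h - d) h j))
        * (spoch s a h (k + j) * spoch s (a - \<mu>) h (k - j) / (spoch s h h (k - j) * spoch s (\<mu> + h) h (k + j))))"
proof -
  define F where "F j = vwp s h \<mu> [] j * (spoch s (\<mu> + b - a) h j * spoch s (\<mu> + c - a) h j * spoch s (\<mu> + d - a) h j
        / (spoch s (a + h - b) h j * spoch s (a + h - c) h j * spoch s (a + h - d) h j))" for j
  have args: "\<mu> + h - (\<mu> + b - a) = a + h - b" "\<mu> + h - (\<mu> + c - a) = a + h - c" "\<mu> + h - (\<mu> + d - a) = a + h - d"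
    "\<mu> + h - (\<mu> + b - a) - (\<mu> + c - a) = d" "\<mu> + h - (\<mu> + b - a) - (\<mu> + d - a) = c"
    "\<mu> + h - (\<mu> + c - a) - (\<mu> + d - a) = b"
    "\<mu> + h - (\<mu> + b - a) - (\<mu> + c - a) - (\<mu> + d - a) = a - \<mu>"
    by (simp_all add: lam)
  have FT: "(\<Sum>j\<le>k. vwp s h \<mu> [\<mu> + b - a, \<mu> + c - a, \<mu> + d - a, a + of_nat k * h, - (of_nat k * h)] j)
    = spoch s (\<mu> + h) h k * spoch s d h k * spoch s c h k * spoch s b h k
      / (spoch s (a + h - b) h k * spoch s (a + h - c) h k * spoch s (a + h - d) h k * spoch s (a - \<mu>) h k)"
    using frenkel_turaev[of "\<mu> + b - a" "\<mu> + c - a" "\<mu> + d - a" "a + of_nat k * h" \<mu> k h] nz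
    unfolding args by (simp add: lam algebra_simps)
  have lh: "spoch s (\<mu> + h) h (2 * k) \<noteq> 0"
    using nz(2) by (simp add: spoch_Suc_left)
  have tm: "vwp s h \<mu> [\<mu> + b - a, \<mu> + c - a, \<mu> + d - a, a + of_nat k * h, - (of_nat k * h)] j
    = F j * (spoch s a h (k + j) * spoch s (a - \<mu>) h (k - j) / (spoch s h h (k - j) * spoch s (\<mu> + h) h (k + j)))
      * (spoch s (\<mu> + h) h k * spoch s h h k / (spoch s a h k * spoch s (a - \<mu>) h k))"
    if j: "j \<le> k" for j
  proof -
    define \<sigma> where "\<sigma> = (- 1 :: complex) ^ j"
    have \<sigma>: "\<sigma> = 1 \<or> \<sigma> = - 1" by (simp add: \<sigma>_def minus_one_power_iff)
    have nz': "spoch s (\<mu> + h) h k \<noteq> 0" "spoch s (\<mu> + h + of_nat k * h) h j \<noteq> 0" "spoch s h h (k - j) \<noteq> 0" "spoch s (a - \<mu>) h (k - j) \<noteq> 0"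
    proof -
      have "spoch s (\<mu> + h) h (k + j) \<noteq> 0" using lh j by (auto simp: spoch_eq_0_iff)
      then show "spoch s (\<mu> + h) h k \<noteq> 0" "spoch s (\<mu> + h + of_nat k * h) h j \<noteq> 0" by (simp_all add: spoch_add)
      show "spoch s h h (k - j) \<noteq> 0" "spoch s (a - \<mu>) h (k - j) \<noteq> 0" using nz(1,7) j by (auto simp: spoch_eq_0_iff)
    qed
    have r1: "spoch s (- (of_nat k * h)) h j = \<sigma> * spoch s h h k / spoch s h h (k - j)"
      using spoch_reverse_part[OF j, of "- (of_nat k * h)" h h] nz' unfolding \<sigma>_def[symmetric]
      by (simp add: field_simps)
    have r2: "spoch s (\<mu> + h - (a + of_nat k * h)) h j = \<sigma> * spoch s (a - \<mu>) h k / spoch s (a - \<mu>) h (k - j)"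
      using spoch_reverse_part[OF j, of "\<mu> + h - (a + of_nat k * h)" "a - \<mu>" h] nz' unfolding \<sigma>_def[symmetric]
      by (simp add: field_simps)
    have "vwp s h \<mu> [\<mu> + b - a, \<mu> + c - a, \<mu> + d - a, a + of_nat k * h, - (of_nat k * h)] j
      = F j * (spoch s (a + of_nat k * h) h j / spoch s (\<mu> + h - (a + of_nat k * h)) h j
          * (spoch s (- (of_nat k * h)) h j / spoch s (\<mu> + h + of_nat k * h) h j))"
      by (simp add: vwp_def F_def args mult_ac)
    also have "\<dots> = F j * (spoch s a h (k + j) * spoch s (a - \<mu>) h (k - j) / (spoch s h h (k - j) * spoch s (\<mu> + h) h (k + j)))
      * (spoch s (\<mu> + h) h k * spoch s h h k / (spoch s a h k * spoch s (a - \<mu>) h k))"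
      unfolding r1 r2 spoch_add using nz nz' \<sigma> by (elim disjE) (simp_all add: divide_simps)
    finally show ?thesis .
  qed
  have "(\<Sum>j\<le>k. vwp s h \<mu> [\<mu> + b - a, \<mu> + c - a, \<mu> + d - a, a + of_nat k * h, - (of_nat k * h)] j)
    = (\<Sum>j\<le>k. F j * (spoch s a h (k + j) * spoch s (a - \<mu>) h (k - j) / (spoch s h h (k - j) * spoch s (\<mu> + h) h (k + j))))
      * (spoch s (\<mu> + h) h k * spoch s h h k / (spoch s a h k * spoch s (a - \<mu>) h k))"
    unfolding sum_distrib_right by (intro sum.cong tm) auto
  moreover have "spoch s (\<mu> + h) h k \<noteq> 0" using lh by (auto simp: spoch_eq_0_iff)
  ultimately show ?thesis
    unfolding FT F_def[symmetric] using nz by (simp add: field_simps)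
qed

text \<open>The substitution k = i + j turns the sum into a Frenkel-Turaev sum of length n - j with
  base point a + 2jh and parameters e + jh, f + jh, a - \<mu>, g + jh.\<close>

lemma bailey_lemma_outer:
  assumes bal: "e + f + g = a + \<mu> + (of_nat n + 1) * h" and j: "j \<le> n"
    and nz: "spoch s h h n \<noteq> 0" "spoch s a h (2 * n + 1) \<noteq> 0" "spoch s (\<mu> + h) h (2 * n) \<noteq> 0" "spoch s (a + h - e) h n \<noteq> 0"
      "spoch s (a + h - f) h n \<noteq> 0" "spoch s (\<mu> + h - e - f) h n \<noteq> 0" "spoch s (a + h - e - f) h n \<noteq> 0"
      "spoch s (\<mu> + h - e) h n \<noteq> 0" "spoch s (\<mu> + h - f) h n \<noteq> 0"
  shows "(\<Sum>k=j..n. s (a + 2 * of_nat k * h) / s a * (spoch s e h k * spoch s f h k * spoch s g h k * spoch s (- (of_nat n * h)) h k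
        / (spoch s (a + h - e) h k * spoch s (a + h - f) h k * spoch s (a + h - g) h k * spoch s (a + h + of_nat n * h) h k))
      * (spoch s a h (k + j) * spoch s (a - \<mu>) h (k - j) / (spoch s h h (k - j) * spoch s (\<mu> + h) h (k + j))))
    = spoch s (a + h) h n * spoch s (a + h - e - f) h n * spoch s (\<mu> + h - e) h n * spoch s (\<mu> + h - f) h n
      / (spoch s (a + h - e) h n * spoch s (a + h - f) h n * spoch s (\<mu> + h - e - f) h n * spoch s (\<mu> + h) h n)
      * (spoch s e h j * spoch s f h j * spoch s g h j * spoch s (- (of_nat n * h)) h j
        / (spoch s (\<mu> + h - e) h j * spoch s (\<mu> + h - f) h j * spoch s (\<mu> + h - g) h j * spoch s (\<mu> + h + of_nat n * h) h j))"
    (is "(\<Sum>k=j..n. ?t k) = ?R")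
proof -
  define N where "N = n - j"
  have n: "n = j + N" using j by (simp add: N_def)
  define J where "J = of_nat j * h"
  define \<sigma> where "\<sigma> = (- 1 :: complex) ^ j"
  have \<sigma>: "\<sigma> = 1 \<or> \<sigma> = - 1" by (simp add: \<sigma>_def minus_one_power_iff)
  have g: "g = a + \<mu> + (of_nat n + 1) * h - e - f" unfolding bal[symmetric] by simp
  have an: "s (a + of_nat i * h) \<noteq> 0" if "i \<le> 2 * n" for i
    using nz(2) that by (auto simp: spoch_eq_0_iff)
  have sa: "s a \<noteq> 0" "s (a + 2 * J) \<noteq> 0"
    using an[of 0] an[of "2 * j"] j by (auto simp: J_def mult.assoc)
  have le: "spoch s z h k \<noteq> 0" if "spoch s z h m \<noteq> 0" "k \<le> m" for z k m
    using that by (auto simp: spoch_eq_0_iff)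
  have sh: "spoch s (z + J) h N \<noteq> 0" if "spoch s z h n \<noteq> 0" for z
    using that by (simp add: n spoch_add J_def)
  have a2: "spoch s (a + 2 * J) h (2 * N + 1) \<noteq> 0"
  proof -
    have "spoch s a h (2 * j + (2 * N + 1)) \<noteq> 0" using nz(2) by (simp add: n algebra_simps)
    then show ?thesis unfolding spoch_add[of s a h "2 * j"] by (simp add: J_def mult.assoc)
  qed
  have l2: "spoch s (\<mu> + h + 2 * J) h N \<noteq> 0" "spoch s (\<mu> + h) h (2 * j) \<noteq> 0"
  proof -
    have "spoch s (\<mu> + h) h (2 * j + N) \<noteq> 0" by (rule le[OF nz(3)]) (simp add: n)
    then show "spoch s (\<mu> + h + 2 * J) h N \<noteq> 0" "spoch s (\<mu> + h) h (2 * j) \<noteq> 0"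
      unfolding spoch_add[of s "\<mu> + h" h "2 * j"] by (simp_all add: J_def mult.assoc)
  qed
  define C where "C = s (a + 2 * J) / s a * (spoch s e h j * spoch s f h j * spoch s g h j * spoch s (- (of_nat n * h)) h j
        / (spoch s (a + h - e) h j * spoch s (a + h - f) h j * spoch s (a + h - g) h j * spoch s (a + h + of_nat n * h) h j))
      * (spoch s a h (2 * j) / spoch s (\<mu> + h) h (2 * j))"
  have tm: "?t (i + j) = C * vwp s h (a + 2 * J) [e + J, f + J, a - \<mu>, g + J, - (of_nat N * h)] i" for i
  proof -
    have ad: "spoch s z h (i + j) = spoch s z h j * spoch s (z + J) h i" for z
      using spoch_add[of s z h j i] by (simp add: J_def add.commute)
    have ad2: "spoch s z h (i + j + j) = spoch s z h (2 * j) * spoch s (z + 2 * J) h i" for z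
    proof -
      have "spoch s z h (i + j + j) = spoch s z h (2 * j + i)" by (rule arg_cong) simp
      then show ?thesis by (simp add: spoch_add J_def mult.assoc)
    qed
    have args: "a + 2 * J + h - (z + J) = a + h - z + J" "a + 2 * J + h - (a - \<mu>) = \<mu> + h + 2 * J"
      "a + 2 * J + h - - (of_nat N * h) = a + h + of_nat n * h + J"
      "- (of_nat N * h) = - (of_nat n * h) + J" "a + 2 * of_nat (i + j) * h = a + 2 * J + 2 * of_nat i * h"
      "i + j - j = i" for z
      by (simp_all add: J_def n algebra_simps)
    show ?thesis
      unfolding vwp_def C_def list.map prod_list.Cons prod_list.Nil args(1-3) unfolding args(4-6) ad ad2
      using sa by (simp add: divide_simps)
  qed
  have "(\<Sum>k=j..n. ?t k) = (\<Sum>k=0+j..N+j. ?t k)" by (simp add: n add.commute)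
  also have "\<dots> = (\<Sum>i\<le>N. ?t (i + j))"
    unfolding sum.shift_bounds_cl_nat_ivl by (simp add: atMost_atLeast0)
  also have "\<dots> = C * (\<Sum>i\<le>N. vwp s h (a + 2 * J) [e + J, f + J, a - \<mu>, g + J, - (of_nat N * h)] i)"
    unfolding tm sum_distrib_left ..
  also have "(\<Sum>i\<le>N. vwp s h (a + 2 * J) [e + J, f + J, a - \<mu>, g + J, - (of_nat N * h)] i)
    = spoch s (a + h + 2 * J) h N * spoch s (a + h - e - f) h N * spoch s (\<mu> + h - e + J) h N * spoch s (\<mu> + h - f + J) h N
    / (spoch s (a + h - e + J) h N * spoch s (a + h - f + J) h N * spoch s (\<mu> + h + 2 * J) h N * spoch s (\<mu> + h - e - f) h N)"
  proof -
    have args: "a + 2 * J + h - (e + J) = a + h - e + J" "a + 2 * J + h - (f + J) = a + h - f + J"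
      "a + 2 * J + h - (a - \<mu>) = \<mu> + h + 2 * J"
      "a + h - e + J - (f + J) = a + h - e - f" "a + h - e - f - (a - \<mu>) = \<mu> + h - e - f"
      "a + h - e + J - (a - \<mu>) = \<mu> + h - e + J" "a + h - f + J - (a - \<mu>) = \<mu> + h - f + J"
      "a + 2 * J + h = a + h + 2 * J"
      by (simp_all add: algebra_simps)
    have "e + J + (f + J) + (a - \<mu>) + (g + J) = 2 * (a + 2 * J) + (of_nat N + 1) * h"
      by (simp add: g J_def n algebra_simps)
    note FT = frenkel_turaev[OF this _ a2, unfolded args(1-7), unfolded args(8)]
    have "N \<le> n" by (simp add: n)
    then show ?thesis
      by (intro FT sh nz l2(1) le[OF nz(1)] le[OF nz(6)] le[OF nz(7)])
  qed
  also have "C * \<dots> = ?R"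
  proof -
    \<comment> \<open>Shifted factorials of length N = n - j are rewritten as factorials of length n
      over factorials of length j, so that the dependence on j separates from the prefactor.\<close>
    have b1: "spoch s (z + J) h N = spoch s z h n / spoch s z h j" if "spoch s z h n \<noteq> 0" for z
      using le[OF that j] by (simp add: n spoch_add J_def)
    have b2: "s (a + 2 * J) * spoch s a h (2 * j) * spoch s (a + h + 2 * J) h N
        = s a * (spoch s (a + h) h n * spoch s (a + h + of_nat n * h) h j)"
    proof -
      have e: "a + of_nat (Suc (2 * j)) * h = a + h + 2 * J" "a + of_nat (2 * j) * h = a + 2 * J"
        by (simp_all add: J_def algebra_simps)
      have "spoch s a h (Suc (2 * j)) * spoch s (a + h + 2 * J) h N = spoch s a h (Suc (n + j))"
        unfolding e[symmetric] spoch_add[symmetric] by (rule arg_cong) (simp add: n)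
      moreover have "spoch s a h (Suc (n + j)) = s a * (spoch s (a + h) h n * spoch s (a + h + of_nat n * h) h j)"
        by (simp add: spoch_Suc_left spoch_add)
      moreover have "spoch s a h (Suc (2 * j)) = s (a + 2 * J) * spoch s a h (2 * j)"
        unfolding spoch_Suc e by (rule mult.commute)
      ultimately show ?thesis by simp
    qed
    have b3: "spoch s (\<mu> + h) h (2 * j) * spoch s (\<mu> + h + 2 * J) h N = spoch s (\<mu> + h) h n * spoch s (\<mu> + h + of_nat n * h) h j"
    proof -
      have "spoch s (\<mu> + h) h (2 * j + N) = spoch s (\<mu> + h) h (n + j)" by (rule arg_cong) (simp add: n)
      then show ?thesis unfolding spoch_add by (simp add: J_def mult.assoc)
    qed
    have b4: "spoch s (\<mu> + h - g) h j * spoch s (a + h - e - f) h N = \<sigma> * spoch s (a + h - e - f) h n"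
      unfolding N_def \<sigma>_def by (rule spoch_reverse_part[OF j]) (simp add: g algebra_simps)
    have b5: "spoch s (a + h - g) h j * spoch s (\<mu> + h - e - f) h N = \<sigma> * spoch s (\<mu> + h - e - f) h n"
      unfolding N_def \<sigma>_def by (rule spoch_reverse_part[OF j]) (simp add: g algebra_simps)
    have nzN: "spoch s (a + h - e - f) h N \<noteq> 0" "spoch s (\<mu> + h - e - f) h N \<noteq> 0"
        "spoch s (a + h + 2 * J) h N \<noteq> 0" "spoch s a h (2 * j) \<noteq> 0" "spoch s (\<mu> + h) h n \<noteq> 0"
    proof -
      show "spoch s (a + h - e - f) h N \<noteq> 0" "spoch s (\<mu> + h - e - f) h N \<noteq> 0"
        using le[OF nz(6)] le[OF nz(7)] by (auto simp: N_def)
      have "spoch s a h (Suc (n + j)) \<noteq> 0" "spoch s a h (2 * j) \<noteq> 0" using le[OF nz(2)] j by auto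
      moreover from this have "spoch s (a + h) h n * spoch s (a + h + of_nat n * h) h j \<noteq> 0" by (simp add: spoch_Suc_left spoch_add)
      ultimately show "spoch s (a + h + 2 * J) h N \<noteq> 0" "spoch s a h (2 * j) \<noteq> 0" using b2 sa by auto
      show "spoch s (\<mu> + h) h n \<noteq> 0" using le[OF nz(3)] by auto
    qed
    have c4: "spoch s (\<mu> + h - g) h j = \<sigma> * spoch s (a + h - e - f) h n / spoch s (a + h - e - f) h N"
      using b4 nzN by (simp add: field_simps)
    have c5: "spoch s (a + h - g) h j = \<sigma> * spoch s (\<mu> + h - e - f) h n / spoch s (\<mu> + h - e - f) h N"
      using b5 nzN by (simp add: field_simps)
    have c2: "spoch s (a + h + of_nat n * h) h j = s (a + 2 * J) * spoch s a h (2 * j) * spoch s (a + h + 2 * J) h N / (s a * spoch s (a + h) h n)"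
      and an0: "spoch s (a + h) h n \<noteq> 0"
      using b2 sa nzN by (auto simp: field_simps)
    have c3: "spoch s (\<mu> + h + of_nat n * h) h j = spoch s (\<mu> + h) h (2 * j) * spoch s (\<mu> + h + 2 * J) h N / spoch s (\<mu> + h) h n"
      using b3 nzN by (simp add: field_simps)
    show ?thesis
      unfolding C_def c2 c3 c4 c5 b1[OF nz(4)] b1[OF nz(5)] b1[OF nz(8)] b1[OF nz(9)]
      using nz nzN l2 sa an0 le[OF nz(4) j] le[OF nz(5) j] le[OF nz(8) j] le[OF nz(9) j] \<sigma>
      by (elim disjE) (simp_all add: divide_simps)
  qed
  finally show ?thesis .
qed

text \<open>The factors with b, c, d are expanded over j, the triangular double sum is interchanged,
  and the sum over k is evaluated; both evaluations are Frenkel-Turaev sums.\<close>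

theorem bailey_transformation:
  assumes bal: "b + c + d + e + f + g = 3 * a + (of_nat n + 2) * h" and lam: "\<mu> = 2 * a + h - b - c - d"
    and nz: "spoch s h h n \<noteq> 0" "spoch s a h (2 * n + 1) \<noteq> 0" "spoch s \<mu> h (2 * n + 1) \<noteq> 0" "spoch s (a + h - b) h n \<noteq> 0"
      "spoch s (a + h - c) h n \<noteq> 0" "spoch s (a + h - d) h n \<noteq> 0" "spoch s (a + h - e) h n \<noteq> 0" "spoch s (a + h - f) h n \<noteq> 0"
      "spoch s (a - \<mu>) h n \<noteq> 0" "spoch s d h n \<noteq> 0" "spoch s (\<mu> + h - e - f) h n \<noteq> 0" "spoch s (a + h - e - f) h n \<noteq> 0"
      "spoch s (\<mu> + h - e) h n \<noteq> 0" "spoch s (\<mu> + h - f) h n \<noteq> 0"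
  shows "(\<Sum>k\<le>n. vwp s h a [b, c, d, e, f, g, - (of_nat n * h)] k)
    = spoch s (a + h) h n * spoch s (a + h - e - f) h n * spoch s (\<mu> + h - e) h n * spoch s (\<mu> + h - f) h n
      / (spoch s (a + h - e) h n * spoch s (a + h - f) h n * spoch s (\<mu> + h - e - f) h n * spoch s (\<mu> + h) h n)
      * (\<Sum>j\<le>n. vwp s h \<mu> [\<mu> + b - a, \<mu> + c - a, \<mu> + d - a, e, f, g, - (of_nat n * h)] j)"
    (is "_ = ?P * _")
proof -
  have le: "spoch s z h k \<noteq> 0" if "spoch s z h m \<noteq> 0" "k \<le> m" for z k m
    using that by (auto simp: spoch_eq_0_iff)
  define U where "U k = s (a + 2 * of_nat k * h) / s a * (spoch s e h k * spoch s f h k * spoch s g h k * spoch s (- (of_nat n * h)) h k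
        / (spoch s (a + h - e) h k * spoch s (a + h - f) h k * spoch s (a + h - g) h k * spoch s (a + h + of_nat n * h) h k))" for k
  define V where "V j = vwp s h \<mu> [] j * (spoch s (\<mu> + b - a) h j * spoch s (\<mu> + c - a) h j * spoch s (\<mu> + d - a) h j
        / (spoch s (a + h - b) h j * spoch s (a + h - c) h j * spoch s (a + h - d) h j))" for j
  define W where "W j = spoch s e h j * spoch s f h j * spoch s g h j * spoch s (- (of_nat n * h)) h j
        / (spoch s (\<mu> + h - e) h j * spoch s (\<mu> + h - f) h j * spoch s (\<mu> + h - g) h j * spoch s (\<mu> + h + of_nat n * h) h j)" for j
  \<comment> \<open>The kernel couples k and j only through k + j and k - j, which is what keeps
    both summations well-poised.\<close>
  define M where "M k j = spoch s a h (k + j) * spoch s (a - \<mu>) h (k - j) / (spoch s h h (k - j) * spoch s (\<mu> + h) h (k + j))" for k j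
  have "(\<Sum>k\<le>n. vwp s h a [b, c, d, e, f, g, - (of_nat n * h)] k)
    = (\<Sum>k\<le>n. U k * (\<Sum>j\<le>k. V j * M k j))"
  proof (rule sum.cong)
    fix k assume "k \<in> {..n}"
    then have k: "k \<le> n" by simp
    have "spoch s a h k / spoch s h h k * (spoch s b h k * spoch s c h k * spoch s d h k
      / (spoch s (a + h - b) h k * spoch s (a + h - c) h k * spoch s (a + h - d) h k)) = (\<Sum>j\<le>k. V j * M k j)"
      unfolding V_def M_def by (rule bailey_lemma_inner[OF lam]) (use k le nz in simp_all)
    moreover have "vwp s h a [b, c, d, e, f, g, - (of_nat n * h)] k = U k * (spoch s a h k / spoch s h h k * (spoch s b h k * spoch s c h k * spoch s d h k
      / (spoch s (a + h - b) h k * spoch s (a + h - c) h k * spoch s (a + h - d) h k)))"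
      by (simp add: vwp_def U_def mult_ac)
    ultimately show "vwp s h a [b, c, d, e, f, g, - (of_nat n * h)] k = U k * (\<Sum>j\<le>k. V j * M k j)" by simp
  qed simp
  also have "\<dots> = (\<Sum>k\<le>n. \<Sum>j\<le>k. V j * (U k * M k j))"
    by (simp add: sum_distrib_left mult_ac)
  also have "\<dots> = (\<Sum>j\<le>n. \<Sum>k=j..n. V j * (U k * M k j))"
    by (rule sum_swap_atMost)
  also have "\<dots> = (\<Sum>j\<le>n. V j * (?P * W j))"
  proof (rule sum.cong)
    fix j assume "j \<in> {..n}"
    have "(\<Sum>k=j..n. U k * M k j) = ?P * W j"
      unfolding U_def M_def W_def
    proof (rule bailey_lemma_outer)
      have "e + f + g = b + c + d + e + f + g - b - c - d" by simp
      then show "e + f + g = a + \<mu> + (of_nat n + 1) * h" unfolding bal by (simp add: lam algebra_simps)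
      show "spoch s (\<mu> + h) h (2 * n) \<noteq> 0" using nz(3) by (simp add: spoch_Suc_left)
    qed (use nz \<open>j \<in> {..n}\<close> in auto)
    then show "(\<Sum>k=j..n. V j * (U k * M k j)) = V j * (?P * W j)"
      by (simp add: sum_distrib_left[symmetric])
  qed simp
  also have "\<dots> = ?P * (\<Sum>j\<le>n. V j * W j)"
    unfolding sum_distrib_left by (intro sum.cong refl mult.left_commute)
  also have "(\<Sum>j\<le>n. V j * W j) = (\<Sum>j\<le>n. vwp s h \<mu> [\<mu> + b - a, \<mu> + c - a, \<mu> + d - a, e, f, g, - (of_nat n * h)] j)"
  proof (rule sum.cong)
    fix j
    \<comment> \<open>Moving a parameter by \<mu> - a along with the base point leaves its
      well-poised companion unchanged.\<close>
    have args: "\<mu> + h - (\<mu> + z - a) = a + h - z" for z by simp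
    show "V j * W j = vwp s h \<mu> [\<mu> + b - a, \<mu> + c - a, \<mu> + d - a, e, f, g, - (of_nat n * h)] j"
      
      unfolding vwp_def V_def W_def list.map prod_list.Cons prod_list.Nil args by (simp add: mult_ac)
  qed simp
  finally show ?thesis .
qed

end

section \<open>The quadratic transformation for generic parameters\<close>

context elliptic_fun begin

text \<open>The Frenkel-Turaev sum with parameters \<open>d + k\<eta>\<close>, \<open>d + (k-1)\<eta>\<close>: a pair of factors of
  base \<open>2\<eta>\<close> shifted by \<open>\<eta>\<close> merges into factors of base \<open>\<eta>\<close>, which is what makes the
  expansion mix the two bases.\<close>
lemma quadratic_expansion:
  fixes \<eta> :: complex
  defines "h \<equiv> 2 * \<eta>"
  assumes ef: "e + f = 2 * a + (2 * of_nat n + 1) * \<eta>" and k: "k \<le> n"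
    and nz: "spoch s h h n \<noteq> 0" "spoch s (a + d - \<eta>) h (2 * n + 1) \<noteq> 0" "spoch s (a + \<eta>) \<eta> (3 * n) \<noteq> 0"
      "spoch s (a + d + \<eta> - e) h n \<noteq> 0" "spoch s (a - d - e + h) h n \<noteq> 0" "spoch s (a + h - d) h n \<noteq> 0"
      "spoch s (a + \<eta> - e) \<eta> (2 * n) \<noteq> 0" "spoch s (d - \<eta>) \<eta> n \<noteq> 0"
  shows "spoch s e h k * spoch s f h k * spoch s (- (of_nat n * h)) h k
      / (spoch s (a + \<eta> - e) \<eta> k * spoch s (a + \<eta> - f) \<eta> k * spoch s (a + \<eta> + of_nat n * h) \<eta> k) / spoch s (a + h - d) h k
    = spoch s (a + \<eta>) \<eta> (2 * n) * spoch s (a + d + \<eta> - e) h n * spoch s (a - d - e + h) h n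
      / (spoch s (a + h - d) h n * spoch s (a + d - \<eta>) h (n + 1) * spoch s (a + \<eta> - e) \<eta> (2 * n))
      * (\<Sum>j=k..n. s (a + d - \<eta> + 2 * of_nat j * h) * (spoch s e h j * spoch s f h j * spoch s (- (of_nat n * h)) h j
          / (spoch s (a + d + \<eta> - e) h j * spoch s (a + d + \<eta> - f) h j * spoch s (a + d + \<eta> + of_nat n * h) h j))
        * (spoch s (a + d - \<eta>) h (j + k) * spoch s (d - \<eta>) \<eta> (2 * j - k)
          / (spoch s (d - \<eta>) \<eta> k * spoch s h h (j - k) * spoch s (a + \<eta>) \<eta> (2 * j + k))))"
    (is "?E = ?D * (\<Sum>j=k..n. ?t j)")
proof -
  define N where "N = n - k"
  have n: "n = k + N" using k by (simp add: N_def)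
  define J where "J = of_nat k * h"
  define K where "K = of_nat k * \<eta>"
  have JK: "J = 2 * K" by (simp add: J_def K_def h_def)
  \<comment> \<open>The base point is such that the companions of u and v are z3 and z3 + \<eta>:
    these two merge as well, and continue the factorial of base \<eta> from a + \<eta> after its
    first 3k factors.\<close>
  define u v a1 where uva: "u = d + K" "v = d - \<eta> + K" "a1 = a + d - \<eta> + 2 * J"
  define \<sigma> where "\<sigma> = (- 1 :: complex) ^ k"
  have \<sigma>: "\<sigma> = 1 \<or> \<sigma> = - 1" by (simp add: \<sigma>_def minus_one_power_iff)
  have f: "f = 2 * a + (2 * of_nat n + 1) * \<eta> - e" unfolding ef[symmetric] by simp
  have le: "spoch s z w i \<noteq> 0" if "spoch s z w m \<noteq> 0" "i \<le> m" for z w i m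
    using that by (auto simp: spoch_eq_0_iff)
  have sh: "spoch s (z + J) h N \<noteq> 0" if "spoch s z h n \<noteq> 0" for z
    using that by (simp add: n spoch_add J_def)
  have dbl: "spoch s z h i * spoch s (z + \<eta>) h i = spoch s z \<eta> (2 * i)" for z i
    unfolding h_def by (rule spoch_double)
  have a1: "spoch s a1 h (2 * N + 1) \<noteq> 0" "s a1 \<noteq> 0" "spoch s (a + d - \<eta>) h (2 * k) \<noteq> 0"
  proof -
    have "spoch s (a + d - \<eta>) h (2 * k + (2 * N + 1)) \<noteq> 0" using nz(2) by (simp add: n algebra_simps)
    then show "spoch s a1 h (2 * N + 1) \<noteq> 0" "spoch s (a + d - \<eta>) h (2 * k) \<noteq> 0"
      unfolding spoch_add[of s "a + d - \<eta>" h "2 * k"] by (simp_all add: uva J_def mult.assoc)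
    from this(1) show "s a1 \<noteq> 0" by (simp add: spoch_Suc_left)
  qed
  define z3 where "z3 = a + \<eta> + 3 * K"
  have z3: "spoch s (a + \<eta>) \<eta> (3 * k + 2 * i) = spoch s (a + \<eta>) \<eta> (3 * k) * (spoch s z3 h i * spoch s (z3 + \<eta>) h i)" for i
    unfolding spoch_add dbl by (simp add: z3_def K_def mult.assoc)
  have z3nz: "spoch s (a + \<eta>) \<eta> (3 * k) \<noteq> 0" "spoch s z3 h N \<noteq> 0" "spoch s (z3 + \<eta>) h N \<noteq> 0"
  proof -
    have "spoch s (a + \<eta>) \<eta> (3 * k + 2 * N) \<noteq> 0" by (rule le[OF nz(3)]) (simp add: n)
    then show "spoch s (a + \<eta>) \<eta> (3 * k) \<noteq> 0" "spoch s z3 h N \<noteq> 0" "spoch s (z3 + \<eta>) h N \<noteq> 0"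
      unfolding z3 by auto
  qed
  have args: "a1 + h - u = z3" "a1 + h - v = z3 + \<eta>" "a1 + h - (e + J) = a + d + \<eta> - e + J"
    "a1 + h - u - v = a + h - d + J" "a1 + h - u - (e + J) = a + \<eta> - e + K" "a1 + h - v - (e + J) = a + \<eta> - e + K + \<eta>"
    "a1 + h - u - v - (e + J) = a - d - e + h" "a1 + h - (f + J) = a + d + \<eta> - f + J"
    "a1 + h - (- (of_nat N * h)) = a + d + \<eta> + of_nat n * h + J" "- (of_nat N * h) = - (of_nat n * h) + J"
    by (simp_all add: uva z3_def JK h_def n J_def K_def algebra_simps)
  define C where "C = s a1 * spoch s (a + d - \<eta>) h (2 * k) * spoch s e h k * spoch s f h k * spoch s (- (of_nat n * h)) h k
      / (spoch s (a + \<eta>) \<eta> (3 * k) * spoch s (a + d + \<eta> - e) h k * spoch s (a + d + \<eta> - f) h k * spoch s (a + d + \<eta> + of_nat n * h) h k)"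
  have tm: "?t (i + k) = C * vwp s h a1 [u, v, e + J, f + J, - (of_nat N * h)] i" if "i \<le> N" for i
  proof -
    have ad: "spoch s z h (i + k) = spoch s z h k * spoch s (z + J) h i" for z
      using spoch_add[of s z h k i] by (simp add: J_def add.commute)
    have ad2: "spoch s (a + d - \<eta>) h (i + k + k) = spoch s (a + d - \<eta>) h (2 * k) * spoch s a1 h i"
    proof -
      have "spoch s (a + d - \<eta>) h (i + k + k) = spoch s (a + d - \<eta>) h (2 * k + i)" by (rule arg_cong) simp
      then show ?thesis by (simp add: spoch_add uva J_def mult.assoc)
    qed
    have ad3: "spoch s (d - \<eta>) \<eta> (2 * (i + k) - k) = spoch s (d - \<eta>) \<eta> k * (spoch s v h i * spoch s u h i)"
    proof -
      have "spoch s (d - \<eta>) \<eta> (2 * (i + k) - k) = spoch s (d - \<eta>) \<eta> (k + 2 * i)" by (rule arg_cong) simp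
      moreover have "v + \<eta> = u" by (simp add: uva)
      ultimately show ?thesis using dbl[of v i] by (simp add: spoch_add uva K_def)
    qed
    have ad4: "spoch s (a + \<eta>) \<eta> (2 * (i + k) + k) = spoch s (a + \<eta>) \<eta> (3 * k) * (spoch s z3 h i * spoch s (z3 + \<eta>) h i)"
      unfolding z3[symmetric] by (rule arg_cong) simp
    have args': "a + d - \<eta> + 2 * of_nat (i + k) * h = a1 + 2 * of_nat i * h" "i + k - k = i"
      by (simp_all add: uva J_def algebra_simps)
    have d0: "spoch s (d - \<eta>) \<eta> k \<noteq> 0" by (rule le[OF nz(8) k])
    show ?thesis
      unfolding vwp_def C_def list.map prod_list.Cons prod_list.Nil args(1-3,8,9) unfolding args(10) args' ad ad2 ad3 ad4
      using a1(2) d0 by (simp add: divide_simps)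
  qed
  define P where "P = spoch s (a1 + h) h N * spoch s (a + h - d + J) h N * spoch s (a + \<eta> - e + K) h N * spoch s (a + \<eta> - e + K + \<eta>) h N
    / (spoch s z3 h N * spoch s (z3 + \<eta>) h N * spoch s (a + d + \<eta> - e + J) h N * spoch s (a - d - e + h) h N)"
  have "(\<Sum>j=k..n. ?t j) = (\<Sum>j=0+k..N+k. ?t j)" by (simp add: n add.commute)
  also have "\<dots> = (\<Sum>i\<le>N. ?t (i + k))"
    unfolding sum.shift_bounds_cl_nat_ivl by (simp add: atMost_atLeast0)
  also have "\<dots> = C * (\<Sum>i\<le>N. vwp s h a1 [u, v, e + J, f + J, - (of_nat N * h)] i)"
    unfolding sum_distrib_left by (intro sum.cong tm) auto
  also have "(\<Sum>i\<le>N. vwp s h a1 [u, v, e + J, f + J, - (of_nat N * h)] i)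
    = P"
  proof -
    have "u + v + (e + J) + (f + J) = 2 * a1 + (of_nat N + 1) * h"
      by (simp add: f uva JK K_def h_def n algebra_simps)
    note FT = frenkel_turaev[OF this _ a1(1), unfolded args(1-3), unfolded args(4-7)]
    have args': "z3 - v = a + h - d + J" "z3 - (e + J) = a + \<eta> - e + K" "z3 + \<eta> - (e + J) = a + \<eta> - e + K + \<eta>"
      "a + h - d + J - (e + J) = a - d - e + h"
      by (simp_all add: uva z3_def JK h_def algebra_simps)
    have "N \<le> n" by (simp add: n)
    then show ?thesis
      unfolding P_def by (intro FT[unfolded args'] sh nz z3nz le[OF nz(1)] le[OF nz(5)])
  qed
  finally have "?D * (\<Sum>j=k..n. ?t j) = ?D * (C * P)" by (rule arg_cong)
  also have "?D * (C * P) = ?E"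
  proof -
    have b1: "s a1 * spoch s (a + d - \<eta>) h (2 * k) * spoch s (a1 + h) h N
        = spoch s (a + d - \<eta>) h (n + 1) * spoch s (a + d + \<eta> + of_nat n * h) h k"
    proof -
      have e: "a + d - \<eta> + of_nat (Suc (2 * k)) * h = a1 + h" "a + d - \<eta> + of_nat (2 * k) * h = a1"
        "a + d - \<eta> + of_nat (n + 1) * h = a + d + \<eta> + of_nat n * h"
        by (simp_all add: uva J_def h_def algebra_simps)
      have "spoch s (a + d - \<eta>) h (Suc (2 * k)) * spoch s (a1 + h) h N = spoch s (a + d - \<eta>) h (n + 1 + k)"
        unfolding e(1)[symmetric] spoch_add[symmetric] by (rule arg_cong) (simp add: n)
      also have "\<dots> = spoch s (a + d - \<eta>) h (n + 1) * spoch s (a + d + \<eta> + of_nat n * h) h k"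
        unfolding spoch_add e ..
      finally show ?thesis unfolding spoch_Suc e by (simp add: mult_ac)
    qed
    have b2: "spoch s (z + J) h N = spoch s z h n / spoch s z h k" if "spoch s z h n \<noteq> 0" for z
      using le[OF that k] by (simp add: n spoch_add J_def)
    have b3: "spoch s (a + \<eta> - e) \<eta> (2 * n - k) = spoch s (a + \<eta> - e) \<eta> k * (spoch s (a + \<eta> - e + K) h N * spoch s (a + \<eta> - e + K + \<eta>) h N)"
    proof -
      have "spoch s (a + \<eta> - e) \<eta> (2 * n - k) = spoch s (a + \<eta> - e) \<eta> (k + 2 * N)" by (rule arg_cong) (simp add: n)
      then show ?thesis unfolding dbl by (simp add: spoch_add K_def)
    qed
    have b4: "spoch s (a + \<eta>) \<eta> (3 * k) * (spoch s z3 h N * spoch s (z3 + \<eta>) h N)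
        = spoch s (a + \<eta>) \<eta> (2 * n) * spoch s (a + \<eta> + of_nat n * h) \<eta> k"
    proof -
      have "spoch s (a + \<eta>) \<eta> (3 * k + 2 * N) = spoch s (a + \<eta>) \<eta> (2 * n + k)" by (rule arg_cong) (simp add: n)
      moreover have "a + \<eta> + of_nat (2 * n) * \<eta> = a + \<eta> + of_nat n * h" by (simp add: h_def)
      ultimately show ?thesis unfolding z3[symmetric] by (simp only: spoch_add)
    qed
    have b6: "spoch s (a + d + \<eta> - f) h k * spoch s (a - d - e + h) h N = \<sigma> * spoch s (a - d - e + h) h n"
      unfolding N_def \<sigma>_def by (rule spoch_reverse_part[OF k]) (simp add: f h_def algebra_simps)
    \<comment> \<open>Since e + f is prescribed, the f-factorial of base \<eta>, reversed, is the
      end of the e-factorial of length 2n.\<close>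
    have "spoch s (a + \<eta> - f) \<eta> k * spoch s (a + \<eta> - e) \<eta> (2 * n - k) = \<sigma> * spoch s (a + \<eta> - e) \<eta> (2 * n)"
      unfolding \<sigma>_def by (rule spoch_reverse_part) (use k in \<open>simp_all add: f algebra_simps\<close>)
    then have b7: "spoch s (a + \<eta> - f) \<eta> k * (spoch s (a + \<eta> - e) \<eta> k * (spoch s (a + \<eta> - e + K) h N * spoch s (a + \<eta> - e + K + \<eta>) h N))
        = \<sigma> * spoch s (a + \<eta> - e) \<eta> (2 * n)"
      unfolding b3 .
    have nzs: "spoch s (a - d - e + h) h N \<noteq> 0" "spoch s (a + \<eta> - e) \<eta> k \<noteq> 0" "spoch s (a + \<eta> - e + K) h N \<noteq> 0"
      "spoch s (a + \<eta> - e + K + \<eta>) h N \<noteq> 0" "spoch s (a + \<eta>) \<eta> (2 * n) \<noteq> 0" "spoch s (a + d - \<eta>) h (n + 1) \<noteq> 0"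
      using le[OF nz(5), of N] b7 nz(7) \<sigma> le[OF nz(3), of "2 * n"] le[OF nz(2), of "n + 1"] by (auto simp: n)
    have c6: "spoch s (a + d + \<eta> - f) h k = \<sigma> * spoch s (a - d - e + h) h n / spoch s (a - d - e + h) h N"
      using b6 nzs by (simp add: field_simps)
    have c7: "spoch s (a + \<eta> - f) \<eta> k = \<sigma> * spoch s (a + \<eta> - e) \<eta> (2 * n)
        / (spoch s (a + \<eta> - e) \<eta> k * (spoch s (a + \<eta> - e + K) h N * spoch s (a + \<eta> - e + K + \<eta>) h N))"
      using b7 nzs by (simp add: field_simps)
    have c4: "spoch s (a + \<eta> + of_nat n * h) \<eta> k = spoch s (a + \<eta>) \<eta> (3 * k) * (spoch s z3 h N * spoch s (z3 + \<eta>) h N) / spoch s (a + \<eta>) \<eta> (2 * n)"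
      using b4 nzs by (simp add: field_simps)
    have c1: "spoch s (a + d + \<eta> + of_nat n * h) h k = s a1 * spoch s (a + d - \<eta>) h (2 * k) * spoch s (a1 + h) h N / spoch s (a + d - \<eta>) h (n + 1)"
      using b1 nzs by (simp add: field_simps)
    have a1h: "spoch s (a1 + h) h N \<noteq> 0"
      using le[OF a1(1), of "Suc N"] by (simp add: spoch_Suc_left)
    show ?thesis
      unfolding C_def P_def c1 c4 c6 c7 b2[OF nz(4)] b2[OF nz(6)]
      using nz nzs z3nz a1 a1h le[OF nz(4) k] le[OF nz(6) k] \<sigma>
      by (elim disjE) (simp_all add: divide_simps)
  qed
  finally show ?thesis by (rule sym)
qed

text \<open>Gasper's bibasic sum with bases \<open>\<eta>\<close> and \<open>2\<eta>\<close>, which telescopes.\<close>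
lemma gasper_sum:
  fixes \<eta> :: complex
  defines "h \<equiv> 2 * \<eta>"
  assumes bcd: "b + c + d = a + \<eta>"
    and nz: "spoch s h h j \<noteq> 0" "spoch s a \<eta> (3 * j + 1) \<noteq> 0" "spoch s (a - b) h (j + 1) \<noteq> 0" "spoch s (a - c) h (j + 1) \<noteq> 0"
      "spoch s (d - \<eta>) \<eta> (j + 1) \<noteq> 0"
  shows "(\<Sum>k\<le>j. s (a + 3 * of_nat k * \<eta>) / s a * (spoch s b \<eta> k * spoch s c \<eta> k * spoch s d \<eta> k
        / (spoch s (a + h - b) h k * spoch s (a + h - c) h k))
      * (spoch s (a + d - \<eta>) h (j + k) * spoch s (d - \<eta>) \<eta> (2 * j - k)
          / (spoch s (d - \<eta>) \<eta> k * spoch s h h (j - k) * spoch s (a + \<eta>) \<eta> (2 * j + k))))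
    = spoch s (a + d - \<eta>) h j * spoch s d \<eta> (2 * j) * spoch s (a - b) h j * spoch s (a - c) h j
      / (spoch s h h j * spoch s a \<eta> (2 * j) * spoch s (a + h - b) h j * spoch s (a + h - c) h j)"
    (is "(\<Sum>k\<le>j. ?t k) = ?R")
proof -
  have le: "spoch s z w i \<noteq> 0" if "spoch s z w m \<noteq> 0" "i \<le> m" for z w i m
    using that by (auto simp: spoch_eq_0_iff)
  have d: "d = a + \<eta> - b - c" unfolding bcd[symmetric] by simp
  define J where "J = of_nat j * h"
  define \<kappa> where "\<kappa> = s (a - b) * s (a - c) / (s (d - \<eta>) * s (a - b + J) * s (a - c + J))"
  define C where "C k = spoch s b \<eta> k * spoch s c \<eta> k * spoch s (a + d - \<eta>) h (j + k) * spoch s (d - \<eta>) \<eta> (2 * j - k)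
     / (spoch s h h (j - k) * spoch s a \<eta> (2 * j + k + 1) * spoch s (a - b) h (k + 1) * spoch s (a - c) h (k + 1))" for k
  \<comment> \<open>U k turns out to be the sum of the terms from k to j: the telescoping runs
    downwards from the top index.\<close>
  define U where "U k = C k * \<kappa> * (s (d - \<eta> + of_nat (2 * j - k) * \<eta>) * s (a + of_nat (2 * j + k) * \<eta>)
      * s (a - b + of_nat k * h) * s (a - c + of_nat k * h))" for k
  have sd: "s (d - \<eta>) \<noteq> 0" "s (a - b) \<noteq> 0" "s (a - c) \<noteq> 0" "s a \<noteq> 0"
    using nz(2-5) by (simp_all add: spoch_Suc_left)
  have sJ: "s (a - b + J) \<noteq> 0" "s (a - c + J) \<noteq> 0"
    using nz(3,4) by (simp_all add: spoch_Suc J_def)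
  have t: "?t k = C k * (s (a - b) * s (a - c) / s (d - \<eta>)) * (s (a + 3 * of_nat k * \<eta>) * s (d - \<eta> + of_nat k * \<eta>))"
    if k: "k \<le> j" for k
  proof -
    have "s (d - \<eta>) * spoch s d \<eta> k = spoch s (d - \<eta>) \<eta> k * s (d - \<eta> + of_nat k * \<eta>)"
      unfolding spoch_Suc[symmetric] by (simp add: spoch_Suc_left)
    then have c1: "spoch s d \<eta> k = spoch s (d - \<eta>) \<eta> k * s (d - \<eta> + of_nat k * \<eta>) / s (d - \<eta>)"
      using sd by (simp add: field_simps)
    have c2: "spoch s a \<eta> (2 * j + k + 1) = s a * spoch s (a + \<eta>) \<eta> (2 * j + k)"
      by (simp add: spoch_Suc_left)
    have c3: "spoch s (a - z) h (k + 1) = s (a - z) * spoch s (a + h - z) h k" for z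
      by (simp add: spoch_Suc_left) (simp add: algebra_simps)
    have "spoch s (d - \<eta>) \<eta> k \<noteq> 0" by (rule le[OF nz(5)]) (use k in simp)
    then show ?thesis unfolding C_def c1 c2 c3 using sd by (simp add: divide_simps)
  qed
  \<comment> \<open>The addition formula splits the linear factors of a term into two products; the
    first belongs to U k and the second, for k < j, to U (Suc k).\<close>
  have key: "s (a + 3 * K) * s (d - \<eta> + K) * s (a - b + J) * s (a - c + J)
      = s (d - \<eta> + J - K) * s (a + J + K) * s (a - b + 2 * K) * s (a - c + 2 * K)
        - s (b + K) * s (c + K) * s (a + d - \<eta> + J + 2 * K) * s (J - 2 * K)" for K
  proof -
    have "s (a + 3 * K) * s (d - \<eta> + K) * s (a - b + J) * s (a - c + J)
      - s (a - b + 2 * K) * s (a - c + 2 * K) * s (a + J + K) * s (d - \<eta> + J - K)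
      = s (a + d - \<eta> + J + 2 * K) * s (- (J - 2 * K)) * s (c + K) * s (b + K)"
      by (rule add_inst[where x = "a - (b + c) / 2 + 2 * K" and y = "(b + c) / 2 + K"
            and u = "a - (b + c) / 2 + J" and v = "(c - b) / 2"])
         (simp_all add: d field_simps)
    then show ?thesis unfolding odd by (simp add: algebra_simps)
  qed
  have t_C: "?t k = C k * \<kappa> * (s (d - \<eta> + of_nat (2 * j - k) * \<eta>) * s (a + of_nat (2 * j + k) * \<eta>)
      * s (a - b + of_nat k * h) * s (a - c + of_nat k * h)
      - s (b + of_nat k * \<eta>) * s (c + of_nat k * \<eta>) * s (a + d - \<eta> + of_nat (j + k) * h) * s (of_nat (j - k) * h))"
    if k: "k \<le> j" for k
  proof -
    define K where "K = of_nat k * \<eta>"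
    have args: "d - \<eta> + of_nat (2 * j - k) * \<eta> = d - \<eta> + J - K" "a + of_nat (2 * j + k) * \<eta> = a + J + K"
      "of_nat k * h = 2 * K" "a + d - \<eta> + of_nat (j + k) * h = a + d - \<eta> + J + 2 * K" "of_nat (j - k) * h = J - 2 * K"
      "a + 3 * of_nat k * \<eta> = a + 3 * K"
      using k by (simp_all add: K_def J_def h_def of_nat_diff algebra_simps)
    show ?thesis
      unfolding t[OF k] unfolding args K_def[symmetric] key[symmetric] \<kappa>_def using sd sJ by (simp add: divide_simps)
  qed
  have step: "?t k = U k - U (Suc k)" if k: "k < j" for k
  proof -
    have e1: "spoch s h h (j - k) = spoch s h h (j - Suc k) * s (of_nat (j - k) * h)"
    proof -
      have "j - k = Suc (j - Suc k)" using k by simp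
      then show ?thesis by (simp only: spoch_Suc) (simp add: algebra_simps)
    qed
    have e2: "spoch s (d - \<eta>) \<eta> (2 * j - k) = spoch s (d - \<eta>) \<eta> (2 * j - Suc k) * s (d - \<eta> + of_nat (2 * j - Suc k) * \<eta>)"
    proof -
      have "2 * j - k = Suc (2 * j - Suc k)" using k by simp
      then show ?thesis by (simp only: spoch_Suc)
    qed
    have hn: "spoch s h h (j - k) \<noteq> 0" by (rule le[OF nz(1)]) simp
    have n1: "spoch s h h (j - Suc k) \<noteq> 0" "s (of_nat (j - k) * h) \<noteq> 0" using hn unfolding e1 by auto
    have n2: "s (a + of_nat (2 * j + Suc k) * \<eta>) \<noteq> 0" "s (a - b + of_nat (Suc k) * h) \<noteq> 0" "s (a - c + of_nat (Suc k) * h) \<noteq> 0"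
      using le[OF nz(2), of "Suc (2 * j + Suc k)"] le[OF nz(3), of "Suc (Suc k)"] le[OF nz(4), of "Suc (Suc k)"] k
      unfolding spoch_Suc by auto
    have "C (Suc k) * (s (d - \<eta> + of_nat (2 * j - Suc k) * \<eta>) * s (a + of_nat (2 * j + Suc k) * \<eta>)
      * s (a - b + of_nat (Suc k) * h) * s (a - c + of_nat (Suc k) * h))
      = C k * (s (b + of_nat k * \<eta>) * s (c + of_nat k * \<eta>) * s (a + d - \<eta> + of_nat (j + k) * h) * s (of_nat (j - k) * h))"
    proof -
      have e3: "j + Suc k = Suc (j + k)" "2 * j + Suc k + 1 = Suc (2 * j + Suc k)" "2 * j + k + 1 = 2 * j + Suc k"
        "Suc k + 1 = Suc (Suc k)" "k + 1 = Suc k" by simp_all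
      show ?thesis
        unfolding C_def e1 e2 e3(1,2) unfolding e3(3,4) unfolding e3(5) spoch_Suc[of s a] spoch_Suc[of s "a - b" h "Suc k"]
          spoch_Suc[of s "a - c" h "Suc k"] spoch_Suc[of s b] spoch_Suc[of s c] spoch_Suc[of s "a + d - \<eta>"]
        using n1 n2 by (simp add: divide_simps)
    qed
    then show ?thesis
      unfolding t_C[OF less_imp_le[OF k]] U_def by (simp add: algebra_simps)
  qed
  \<comment> \<open>At the top index k = j the subtracted product contains s 0, so the last term
    equals U j and starts the induction.\<close>
  have "(\<Sum>k=j-m..j. ?t k) = U (j - m)" if "m \<le> j" for m
    using that
  proof (induction m)
    case 0
    then show ?case using t_C[of j] by (simp add: U_def)
  next
    case (Suc m)
    then have "j - Suc m < j" "Suc (j - Suc m) = j - m" by simp_all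
    moreover have "(\<Sum>k=j-Suc m..j. ?t k) = ?t (j - Suc m) + (\<Sum>k=Suc (j-Suc m)..j. ?t k)"
      by (rule sum.atLeast_Suc_atMost) simp
    ultimately show ?case using Suc step[of "j - Suc m"] by simp
  qed
  from this[of j] have "(\<Sum>k\<le>j. ?t k) = U 0" by (simp add: atMost_atLeast0)
  also have "U 0 = ?R"
  proof -
    have c3: "spoch s (a - z) h j = s (a - z) * spoch s (a + h - z) h j / s (a - z + J)" if "s (a - z + J) \<noteq> 0" for z
    proof -
      have "spoch s (a - z) h j * s (a - z + J) = s (a - z) * spoch s (a - z + h) h j"
        unfolding J_def spoch_Suc[symmetric] spoch_Suc_left ..
      then show ?thesis using that by (simp add: field_simps)
    qed
    have c4: "spoch s (d - \<eta>) \<eta> (2 * j) * s (d - \<eta> + of_nat (2 * j) * \<eta>) = s (d - \<eta>) * spoch s d \<eta> (2 * j)"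
      unfolding spoch_Suc[symmetric] spoch_Suc_left by simp
    have c5: "spoch s a \<eta> (2 * j + 1) = spoch s a \<eta> (2 * j) * s (a + of_nat (2 * j) * \<eta>)"
      by (simp add: spoch_Suc)
    have nb: "spoch s (a + h - z) h j \<noteq> 0" if "spoch s (a - z) h (j + 1) \<noteq> 0" for z
      using that by (simp add: spoch_Suc_left) (simp add: algebra_simps)
    have n2: "spoch s a \<eta> (2 * j + 1) \<noteq> 0" by (rule le[OF nz(2)]) simp
    have c6: "spoch s d \<eta> (2 * j) = spoch s (d - \<eta>) \<eta> (2 * j) * s (d - \<eta> + of_nat (2 * j) * \<eta>) / s (d - \<eta>)"
      using c4 sd by (simp add: field_simps)
    show ?thesis
      unfolding U_def C_def \<kappa>_def c3[OF sJ(1)] c3[OF sJ(2)] c6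
      using n2 nz(1) sd sJ nb[OF nz(3)] nb[OF nz(4)] unfolding c5
      by (simp add: spoch_Suc c5 divide_simps)
  qed
  finally show ?thesis .
qed

end

section \<open>Both sides in additive notation, and generic parameters\<close>

definition lhs_term ::
  "(complex \<Rightarrow> complex) \<Rightarrow> complex \<Rightarrow> nat \<Rightarrow> complex \<Rightarrow> complex \<Rightarrow> complex \<Rightarrow> complex \<Rightarrow> complex \<Rightarrow> complex \<Rightarrow> nat \<Rightarrow> complex" where
  "lhs_term s \<eta> n a b c d e f k = s (a + 3 * of_nat k * \<eta>) / s a
     * (spoch s b \<eta> k * spoch s c \<eta> k * spoch s d \<eta> k
       / (spoch s (a + 2 * \<eta> - b) (2 * \<eta>) k * spoch s (a + 2 * \<eta> - c) (2 * \<eta>) k * spoch s (a + 2 * \<eta> - d) (2 * \<eta>) k))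
     * (spoch s e (2 * \<eta>) k * spoch s f (2 * \<eta>) k * spoch s (- (of_nat n * (2 * \<eta>))) (2 * \<eta>) k
       / (spoch s (a + \<eta> - e) \<eta> k * spoch s (a + \<eta> - f) \<eta> k * spoch s (a + \<eta> + of_nat n * (2 * \<eta>)) \<eta> k))"

text \<open>The four arguments above and the four below have equal sums, so the quotient in front of
  the series has an additive form free of exponentials.\<close>

definition prefactor ::
  "(complex \<Rightarrow> complex) \<Rightarrow> complex \<Rightarrow> nat \<Rightarrow> complex \<Rightarrow> complex \<Rightarrow> complex \<Rightarrow> complex \<Rightarrow> complex \<Rightarrow> complex \<Rightarrow> complex" where
  "prefactor s h n a b c d e g = spoch s (a + h) h n * spoch s (2 * a + h - b - c - e) h n
       * spoch s (2 * a + h - b - d - e - g) h n * spoch s (a + g + h - c - d) h n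
     / (spoch s (2 * a + h - b - e - g) h n * spoch s (a + g + h - c) h n * spoch s (a + h - d) h n
       * spoch s (2 * a + h - b - c - d - e) h n)"

text \<open>Quantifying over all integers m lets one condition cover factorials of both bases \<eta>
  and 2\<eta>, whatever their start and length, while the excluded values still form a countable
  set.\<close>

definition generic :: "(complex \<Rightarrow> complex) \<Rightarrow> complex \<Rightarrow> complex \<Rightarrow> bool" where
  "generic s \<eta> z \<longleftrightarrow> (\<forall>m::int. s (z + of_int m * \<eta>) \<noteq> 0)"

lemma generic_nz:
  assumes "generic s \<eta> z" "w = z + of_int m * \<eta>"
  shows "s w \<noteq> 0"
  using assms by (simp add: generic_def)

lemma generic_spoch:
  assumes "generic s \<eta> z" "w = z + of_int m * \<eta>"
  shows "spoch s w \<eta> k \<noteq> 0"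
  unfolding spoch_eq_0_iff
proof safe
  fix i assume "s (w + of_nat i * \<eta>) = 0"
  moreover have "w + of_nat i * \<eta> = z + of_int (m + int i) * \<eta>" by (simp add: assms(2) algebra_simps)
  ultimately show False using assms(1) by (metis generic_def)
qed

lemma generic_spoch2:
  assumes "generic s \<eta> z" "w = z + of_int m * \<eta>"
  shows "spoch s w (2 * \<eta>) k \<noteq> 0"
  unfolding spoch_eq_0_iff
proof safe
  fix i assume "s (w + of_nat i * (2 * \<eta>)) = 0"
  moreover have "w + of_nat i * (2 * \<eta>) = z + of_int (m + 2 * int i) * \<eta>" by (simp add: assms(2) algebra_simps)
  ultimately show False using assms(1) by (metis generic_def)
qed

context elliptic_fun begin

text \<open>The case g = a - b with g eliminated: then a + g - c, g + h - c and b + e + g - a are a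
  + d - \<eta>, d + \<eta> and e.\<close>

lemma quadratic_transformation_b:
  fixes \<eta> :: complex
  defines "h \<equiv> 2 * \<eta>"
  assumes bcd: "b + c + d = a + \<eta>" and ef: "e + f = 2 * a + (2 * of_nat n + 1) * \<eta>"
    and h: "spoch s h h n \<noteq> 0"
    and gen: "generic s \<eta> a" "generic s \<eta> d" "generic s \<eta> (a + d)" "generic s \<eta> (a - b)" "generic s \<eta> (a - c)"
      "generic s \<eta> (a - d)" "generic s \<eta> (a - e)" "generic s \<eta> (a + d - e)" "generic s \<eta> (a - d - e)"
  shows "(\<Sum>k\<le>n. lhs_term s \<eta> n a b c d e f k)
    = spoch s (a + h) h n * spoch s (a + d + \<eta> - e) h n * spoch s (a + h - d - e) h n * spoch s (a + \<eta>) h n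
      / (spoch s (a + h - e) h n * spoch s (a + d + \<eta>) h n * spoch s (a + h - d) h n * spoch s (a + \<eta> - e) h n)
      * (\<Sum>k\<le>n. vwp s h (a + d - \<eta>) [a - c, d + \<eta>, e, d, f, a - b, - (of_nat n * h)] k)"
    (is "_ = ?P * _")
proof -
  have le: "spoch s z w i \<noteq> 0" if "spoch s z w m \<noteq> 0" "i \<le> m" for z w i m
    using that by (auto simp: spoch_eq_0_iff)
  define w where "w j = s (a + d - \<eta> + 2 * of_nat j * h) * (spoch s e h j * spoch s f h j * spoch s (- (of_nat n * h)) h j
          / (spoch s (a + d + \<eta> - e) h j * spoch s (a + d + \<eta> - f) h j * spoch s (a + d + \<eta> + of_nat n * h) h j))" for j
  \<comment> \<open>\<open>w\<close> depends on j alone and \<open>\<alpha>\<close> on k alone; the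
    kernel M is the part that \<open>gasper_sum\<close> sums over k.\<close>
  define M where "M k j = spoch s (a + d - \<eta>) h (j + k) * spoch s (d - \<eta>) \<eta> (2 * j - k)
          / (spoch s (d - \<eta>) \<eta> k * spoch s h h (j - k) * spoch s (a + \<eta>) \<eta> (2 * j + k))" for k j
  define \<alpha> where "\<alpha> k = s (a + 3 * of_nat k * \<eta>) / s a * (spoch s b \<eta> k * spoch s c \<eta> k * spoch s d \<eta> k
        / (spoch s (a + h - b) h k * spoch s (a + h - c) h k))" for k
  define D where "D = spoch s (a + \<eta>) \<eta> (2 * n) * spoch s (a + d + \<eta> - e) h n * spoch s (a - d - e + h) h n
      / (spoch s (a + h - d) h n * spoch s (a + d - \<eta>) h (n + 1) * spoch s (a + \<eta> - e) \<eta> (2 * n))"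
  have ex: "spoch s e h k * spoch s f h k * spoch s (- (of_nat n * h)) h k
      / (spoch s (a + \<eta> - e) \<eta> k * spoch s (a + \<eta> - f) \<eta> k * spoch s (a + \<eta> + of_nat n * h) \<eta> k) / spoch s (a + h - d) h k
      = D * (\<Sum>j=k..n. w j * M k j)" if "k \<le> n" for k
    unfolding D_def w_def M_def h_def
  proof (rule quadratic_expansion[OF ef that])
    show "spoch s (2 * \<eta>) (2 * \<eta>) n \<noteq> 0" using h by (simp add: h_def)
    show "spoch s (a + d - \<eta>) (2 * \<eta>) (2 * n + 1) \<noteq> 0" by (rule generic_spoch2[OF gen(3), of _ "-1"]) simp
    show "spoch s (a + \<eta>) \<eta> (3 * n) \<noteq> 0" by (rule generic_spoch[OF gen(1), of _ 1]) simp
    show "spoch s (a + d + \<eta> - e) (2 * \<eta>) n \<noteq> 0" by (rule generic_spoch2[OF gen(8), of _ 1]) simp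
    show "spoch s (a - d - e + 2 * \<eta>) (2 * \<eta>) n \<noteq> 0" by (rule generic_spoch2[OF gen(9), of _ 2]) simp
    show "spoch s (a + 2 * \<eta> - d) (2 * \<eta>) n \<noteq> 0" by (rule generic_spoch2[OF gen(6), of _ 2]) simp
    show "spoch s (a + \<eta> - e) \<eta> (2 * n) \<noteq> 0" by (rule generic_spoch[OF gen(7), of _ 1]) simp
    show "spoch s (d - \<eta>) \<eta> n \<noteq> 0" by (rule generic_spoch[OF gen(2), of _ "-1"]) simp
  qed
  have "(\<Sum>k\<le>n. lhs_term s \<eta> n a b c d e f k) = (\<Sum>k\<le>n. \<alpha> k * (D * (\<Sum>j=k..n. w j * M k j)))"
    by (intro sum.cong refl, subst ex[symmetric]) (simp_all add: lhs_term_def \<alpha>_def h_def mult_ac)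
  also have "\<dots> = (\<Sum>k\<le>n. \<Sum>j=k..n. D * (w j * (\<alpha> k * M k j)))"
    by (simp add: sum_distrib_left mult_ac)
  also have "\<dots> = (\<Sum>j\<le>n. \<Sum>k\<le>j. D * (w j * (\<alpha> k * M k j)))"
    by (rule sum_swap_atMost[symmetric])
  also have "\<dots> = (\<Sum>j\<le>n. D * (w j * (\<Sum>k\<le>j. \<alpha> k * M k j)))"
    by (simp add: sum_distrib_left)
  also have "\<dots> = (\<Sum>j\<le>n. ?P * vwp s h (a + d - \<eta>) [a - c, d + \<eta>, e, d, f, a - b, - (of_nat n * h)] j)"
  proof (rule sum.cong)
    fix j assume "j \<in> {..n}"
    have gs: "(\<Sum>k\<le>j. \<alpha> k * M k j) = spoch s (a + d - \<eta>) h j * spoch s d \<eta> (2 * j) * spoch s (a - b) h j * spoch s (a - c) h j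
      / (spoch s h h j * spoch s a \<eta> (2 * j) * spoch s (a + h - b) h j * spoch s (a + h - c) h j)"
      unfolding \<alpha>_def M_def h_def
    proof (rule gasper_sum[OF bcd])
      show "spoch s (2 * \<eta>) (2 * \<eta>) j \<noteq> 0" using le[OF h] \<open>j \<in> {..n}\<close> by (simp add: h_def)
      show "spoch s a \<eta> (3 * j + 1) \<noteq> 0" by (rule generic_spoch[OF gen(1), of _ 0]) simp
      show "spoch s (a - b) (2 * \<eta>) (j + 1) \<noteq> 0" by (rule generic_spoch2[OF gen(4), of _ 0]) simp
      show "spoch s (a - c) (2 * \<eta>) (j + 1) \<noteq> 0" by (rule generic_spoch2[OF gen(5), of _ 0]) simp
      show "spoch s (d - \<eta>) \<eta> (j + 1) \<noteq> 0" by (rule generic_spoch[OF gen(2), of _ "-1"]) simp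
    qed
    have d: "d = a + \<eta> - b - c" unfolding bcd[symmetric] by simp
    have args: "a + d - \<eta> + h - (a - c) = a + h - b" "a + d - \<eta> + h - (d + \<eta>) = a" "a + d - \<eta> + h - e = a + d + \<eta> - e"
      "a + d - \<eta> + h - d = a + \<eta>" "a + d - \<eta> + h - f = a + d + \<eta> - f" "a + d - \<eta> + h - (a - b) = a + h - c"
      "a + d - \<eta> + h - - (of_nat n * h) = a + d + \<eta> + of_nat n * h"
      by (simp_all add: d h_def)
    have dbl: "spoch s z \<eta> (2 * i) = spoch s z h i * spoch s (z + \<eta>) h i" for z i
      unfolding h_def by (rule spoch_double[symmetric])
    \<comment> \<open>The parameters d and d + \<eta> have companions a + \<eta> and a. Each pair
      merges to base \<eta>, which matches the value of the bibasic sum.\<close>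
    have vw: "vwp s h (a + d - \<eta>) [a - c, d + \<eta>, e, d, f, a - b, - (of_nat n * h)] j
      = w j / s (a + d - \<eta>) * (spoch s (a + d - \<eta>) h j / spoch s h h j * (spoch s d \<eta> (2 * j) / spoch s a \<eta> (2 * j))
        * (spoch s (a - b) h j / spoch s (a + h - c) h j * (spoch s (a - c) h j / spoch s (a + h - b) h j)))"
      unfolding vwp_def list.map prod_list.Cons prod_list.Nil args w_def dbl
      by (simp add: mult_ac)
    have D: "D * s (a + d - \<eta>) = ?P"
    proof -
      have e: "a + \<eta> + \<eta> = a + h" "a + \<eta> - e + \<eta> = a + h - e" "a - d - e + h = a + h - d - e" "a + d - \<eta> + h = a + d + \<eta>"
        by (simp_all add: h_def)
      have "s (a + d - \<eta>) \<noteq> 0" by (rule generic_nz[OF gen(3), of _ "-1"]) simp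
      then show ?thesis
        unfolding D_def dbl Suc_eq_plus1[symmetric] spoch_Suc_left e by (simp add: mult_ac)
    qed
    have "s (a + d - \<eta>) \<noteq> 0" by (rule generic_nz[OF gen(3), of _ "-1"]) simp
    then show "D * (w j * (\<Sum>k\<le>j. \<alpha> k * M k j))
        = ?P * vwp s h (a + d - \<eta>) [a - c, d + \<eta>, e, d, f, a - b, - (of_nat n * h)] j"
      unfolding gs vw D[symmetric] by (simp add: mult_ac)
  qed simp
  finally show ?thesis unfolding sum_distrib_left .
qed

lemma quadratic_transformation_generic:
  fixes \<eta> :: complex
  assumes bcd: "b + c + d = a + \<eta>" and ef: "e + f = 2 * a + (2 * of_nat n + 1) * \<eta>" and g: "g = a - b \<or> g = a - e"
    and h: "spoch s (2 * \<eta>) (2 * \<eta>) n \<noteq> 0"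
    and gen: "generic s \<eta> a" "generic s \<eta> d" "generic s \<eta> (a + d)" "generic s \<eta> (a - b)" "generic s \<eta> (a - c)"
      "generic s \<eta> (a - d)" "generic s \<eta> (a - e)" "generic s \<eta> (a + d - e)" "generic s \<eta> (a - d - e)"
      "generic s \<eta> c" "generic s \<eta> (e - b)" "generic s \<eta> (2 * a - c - e)" "generic s \<eta> (a + b - e)"
  shows "(\<Sum>k\<le>n. lhs_term s \<eta> n a b c d e f k) = prefactor s (2 * \<eta>) n a b c d e g
      * (\<Sum>k\<le>n. vwp s (2 * \<eta>) (a + g - c) [a - c, g + 2 * \<eta> - c, b + e + g - a, d, f, g, - (of_nat n * (2 * \<eta>))] k)"
proof -
  define h where "h = 2 * \<eta>"
  have d: "d = a + \<eta> - b - c" unfolding bcd[symmetric] by simp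
  have f: "f = 2 * a + (2 * of_nat n + 1) * \<eta> - e" unfolding ef[symmetric] by simp
  define P where "P = spoch s (a + h) h n * spoch s (a + d + \<eta> - e) h n * spoch s (a + h - d - e) h n * spoch s (a + \<eta>) h n
      / (spoch s (a + h - e) h n * spoch s (a + d + \<eta>) h n * spoch s (a + h - d) h n * spoch s (a + \<eta> - e) h n)"
  have 1: "(\<Sum>k\<le>n. lhs_term s \<eta> n a b c d e f k) = P
      * (\<Sum>k\<le>n. vwp s h (a + d - \<eta>) [a - c, d + \<eta>, e, d, f, a - b, - (of_nat n * h)] k)"
    unfolding P_def h_def by (rule quadratic_transformation_b[OF bcd ef h gen(1-9)])
  show ?thesis using g
  proof
    assume [simp]: "g = a - b"
    have args: "a + g - c = a + d - \<eta>" "g + 2 * \<eta> - c = d + \<eta>" "b + e + g - a = e" by (simp_all add: d)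
    have "P = prefactor s (2 * \<eta>) n a b c d e g"
    proof -
      have args': "2 * a + h - b - c - e = a + d + \<eta> - e" "2 * a + h - b - d - e - g = a + h - d - e"
        "a + d + \<eta> - d = a + \<eta>" "2 * a + h - b - e - g = a + h - e" "a + g + h - c = a + d + \<eta>"
        "2 * a + h - b - c - d - e = a + \<eta> - e"
        by (simp_all add: d h_def)
      show ?thesis unfolding P_def prefactor_def h_def[symmetric] args' ..
    qed
    then show ?thesis unfolding 1 args by (simp add: h_def)
  next
    assume [simp]: "g = a - e"
    \<comment> \<open>Bailey's transformation is applied to the triple d + \<eta>, e, a - b. Its new
      base point is \<mu> = a + g - c, the triple becomes g + h - c, b + e + g - a, g, and d, a - c,
      f stay.\<close>
    define \<mu> where "\<mu> = 2 * a - c - e"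
    define R where "R = spoch s (a + d - \<eta> + h) h n * spoch s (a + d - \<eta> + h - d - (a - c)) h n * spoch s (\<mu> + h - d) h n * spoch s (\<mu> + h - (a - c)) h n
      / (spoch s (a + d - \<eta> + h - d) h n * spoch s (a + d - \<eta> + h - (a - c)) h n * spoch s (\<mu> + h - d - (a - c)) h n * spoch s (\<mu> + h) h n)"
    have "(\<Sum>k\<le>n. vwp s h (a + d - \<eta>) [d + \<eta>, e, a - b, d, a - c, f, - (of_nat n * h)] k)
      = R * (\<Sum>j\<le>n. vwp s h \<mu> [\<mu> + (d + \<eta>) - (a + d - \<eta>), \<mu> + e - (a + d - \<eta>), \<mu> + (a - b) - (a + d - \<eta>), d, a - c, f, - (of_nat n * h)] j)"
      unfolding R_def h_def
    proof (rule bailey_transformation)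
      show "spoch s (2 * \<eta>) (2 * \<eta>) n \<noteq> 0" by (rule h)
      show "spoch s (a + d - \<eta>) (2 * \<eta>) (2 * n + 1) \<noteq> 0" by (rule generic_spoch2[OF gen(3), of _ "-1"]) simp
      show "spoch s \<mu> (2 * \<eta>) (2 * n + 1) \<noteq> 0" by (rule generic_spoch2[OF gen(12), of _ 0]) (simp add: \<mu>_def)
      show "spoch s (a + d - \<eta> + 2 * \<eta> - (d + \<eta>)) (2 * \<eta>) n \<noteq> 0" by (rule generic_spoch2[OF gen(1), of _ 0]) simp
      show "spoch s (a + d - \<eta> + 2 * \<eta> - e) (2 * \<eta>) n \<noteq> 0" by (rule generic_spoch2[OF gen(8), of _ 1]) simp
      show "spoch s (a + d - \<eta> + 2 * \<eta> - (a - b)) (2 * \<eta>) n \<noteq> 0" by (rule generic_spoch2[OF gen(5), of _ 2]) (simp add: d)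
      show "spoch s (a + d - \<eta> + 2 * \<eta> - d) (2 * \<eta>) n \<noteq> 0" by (rule generic_spoch2[OF gen(1), of _ 1]) simp
      show "spoch s (a + d - \<eta> + 2 * \<eta> - (a - c)) (2 * \<eta>) n \<noteq> 0" by (rule generic_spoch2[OF gen(4), of _ 2]) (simp add: d)
      show "spoch s (a + d - \<eta> - \<mu>) (2 * \<eta>) n \<noteq> 0" by (rule generic_spoch2[OF gen(11), of _ 0]) (simp add: d \<mu>_def)
      show "spoch s (a - b) (2 * \<eta>) n \<noteq> 0" by (rule generic_spoch2[OF gen(4), of _ 0]) simp
      show "spoch s (\<mu> + 2 * \<eta> - d - (a - c)) (2 * \<eta>) n \<noteq> 0" by (rule generic_spoch2[OF gen(9), of _ 2]) (simp add: \<mu>_def)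
      show "spoch s (a + d - \<eta> + 2 * \<eta> - d - (a - c)) (2 * \<eta>) n \<noteq> 0" by (rule generic_spoch2[OF gen(10), of _ 1]) simp
      show "spoch s (\<mu> + 2 * \<eta> - d) (2 * \<eta>) n \<noteq> 0" by (rule generic_spoch2[OF gen(13), of _ 1]) (simp add: d \<mu>_def)
      show "spoch s (\<mu> + 2 * \<eta> - (a - c)) (2 * \<eta>) n \<noteq> 0" by (rule generic_spoch2[OF gen(7), of _ 2]) (simp add: \<mu>_def)
    qed (simp_all add: d f \<mu>_def algebra_simps)
    moreover have "vwp s h (a + d - \<eta>) [a - c, d + \<eta>, e, d, f, a - b, - (of_nat n * h)]
        = vwp s h (a + d - \<eta>) [d + \<eta>, e, a - b, d, a - c, f, - (of_nat n * h)]"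
      by (simp add: vwp_def fun_eq_iff mult_ac)
    moreover have "vwp s h \<mu> [\<mu> + (d + \<eta>) - (a + d - \<eta>), \<mu> + e - (a + d - \<eta>), \<mu> + (a - b) - (a + d - \<eta>), d, a - c, f, - (of_nat n * h)]
      = vwp s h (a + g - c) [a - c, g + h - c, b + e + g - a, d, f, g, - (of_nat n * h)]"
    proof -
      have args: "\<mu> + (d + \<eta>) - (a + d - \<eta>) = g + h - c" "\<mu> + e - (a + d - \<eta>) = b + e + g - a"
        "\<mu> + (a - b) - (a + d - \<eta>) = g" "a + g - c = \<mu>"
        by (simp_all add: \<mu>_def h_def d algebra_simps)
      show ?thesis unfolding args by (simp add: vwp_def fun_eq_iff mult_ac)
    qed
    \<comment> \<open>The four factorials listed in \<open>nz\<close> cancel between P and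
      R.\<close>
    moreover have "P * R = prefactor s (2 * \<eta>) n a b c d e g"
    proof -
      have args: "a + d - \<eta> + h = a + d + \<eta>" "a + \<eta> - (a - c) = c + \<eta>" "\<mu> + h - d = a + b + \<eta> - e"
        "\<mu> + h - (a - c) = a + h - e" "a + d + \<eta> - d = a + \<eta>" "a + d + \<eta> - (a - c) = a + h - b" "a + b + \<eta> - e - (a - c) = a + h - d - e"
        by (simp_all add: \<mu>_def h_def d)
      have args': "2 * a + h - b - c - e = a + d + \<eta> - e" "2 * a + h - b - d - e - g = c + \<eta>"
        "\<mu> + h - d = a + b + \<eta> - e" "2 * a + h - b - e - g = a + h - b" "a + g + h - c = \<mu> + h"
        "2 * a + h - b - c - d - e = a + \<eta> - e"
        by (simp_all add: \<mu>_def h_def d)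
      have nz: "spoch s (a + h - d - e) h n \<noteq> 0" "spoch s (a + \<eta>) h n \<noteq> 0" "spoch s (a + h - e) h n \<noteq> 0" "spoch s (a + d + \<eta>) h n \<noteq> 0"
        unfolding h_def
        by (rule generic_spoch2[OF gen(9), of _ 2] generic_spoch2[OF gen(1), of _ 1] generic_spoch2[OF gen(7), of _ 2]
            generic_spoch2[OF gen(3), of _ 1]; simp)+
      have R: "R = spoch s (a + d + \<eta>) h n * spoch s (c + \<eta>) h n * spoch s (a + b + \<eta> - e) h n * spoch s (a + h - e) h n
        / (spoch s (a + \<eta>) h n * spoch s (a + h - b) h n * spoch s (a + h - d - e) h n * spoch s (\<mu> + h) h n)"
        unfolding R_def args(1) unfolding args(2-6) unfolding args(7) ..
      have Q: "prefactor s h n a b c d e g = spoch s (a + h) h n * spoch s (a + d + \<eta> - e) h n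
       * spoch s (c + \<eta>) h n * spoch s (a + b + \<eta> - e) h n
        / (spoch s (a + h - b) h n * spoch s (\<mu> + h) h n * spoch s (a + h - d) h n * spoch s (a + \<eta> - e) h n)"
        unfolding prefactor_def args' ..
      show ?thesis unfolding h_def[symmetric] Q R P_def using nz by (simp add: divide_simps)
    qed
    ultimately show ?thesis unfolding 1 by (simp add: h_def mult.assoc[symmetric])
  qed
qed

end

section \<open>Removing genericity\<close>

lemma elliptic_fun_s_theta: "cmod p < 1 \<Longrightarrow> elliptic_fun (s_theta p)"
  by unfold_locales (rule s_theta_minus s_theta_addition; assumption)+

lemma countable_not_generic:
  assumes "cmod p < 1" "w \<noteq> 0"
  shows "countable {t. \<not> generic (s_theta p) \<eta> (z + w * t)}"
proof -
  have "{t. \<not> generic (s_theta p) \<eta> (z + w * t)}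
      = (\<Union>m::int. {t. s_theta p (z + of_int m * \<eta> + w * t) = 0})"
    by (auto simp: generic_def algebra_simps)
  then show ?thesis
    using countable_s_theta_affine_zeros[OF assms] by (simp only:) (intro countable_UN, auto)
qed

lemma isCont_spoch:
  assumes "cmod p < 1" "isCont f x"
  shows "isCont (\<lambda>t. spoch (s_theta p) (f t) h k) x"
  unfolding spoch_def using assms(2)
  by (intro continuous_prod isCont_o2[OF _ isCont_s_theta[OF assms(1)]] continuous_intros)

text \<open>The nonvanishing denominators give continuity at t = 0 of both sides along a line of
  parameters that respects the constraints; off a countable set of t the generic version
  applies.\<close>

theorem quadratic_transformation:
  fixes \<eta> :: complex and p :: complex
  defines "h \<equiv> 2 * \<eta>" and "s \<equiv> s_theta p"
  assumes p: "cmod p < 1"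
    and bcd: "b + c + d = a + \<eta>" and ef: "e + f = 2 * a + (2 * of_nat n + 1) * \<eta>" and g: "g = a - b \<or> g = a - e"
    and h: "spoch s h h n \<noteq> 0"
    and nz: "s a \<noteq> 0" "spoch s (a + h - b) h n \<noteq> 0" "spoch s (a + h - c) h n \<noteq> 0" "spoch s (a + h - d) h n \<noteq> 0"
      "spoch s (a + \<eta> - e) \<eta> n \<noteq> 0" "spoch s (a + \<eta> - f) \<eta> n \<noteq> 0" "spoch s (a + \<eta> + of_nat n * h) \<eta> n \<noteq> 0"
    and nz2: "spoch s (2 * a + h - b - e - g) h n \<noteq> 0" "spoch s (a + g + h - c) h n \<noteq> 0" "spoch s (2 * a + h - b - c - d - e) h n \<noteq> 0"
    and nz3: "s (a + g - c) \<noteq> 0"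
      "\<And>x. x \<in> set [a - c, g + h - c, b + e + g - a, d, f, g, - (of_nat n * h)] \<Longrightarrow> spoch s (a + g - c + h - x) h n \<noteq> 0"
  shows "(\<Sum>k\<le>n. lhs_term s \<eta> n a b c d e f k) = prefactor s h n a b c d e g
      * (\<Sum>k\<le>n. vwp s h (a + g - c) [a - c, g + h - c, b + e + g - a, d, f, g, - (of_nat n * h)] k)"
proof -
  interpret elliptic_fun s unfolding s_def by (rule elliptic_fun_s_theta[OF p])
  have le: "spoch s z w i \<noteq> 0" if "spoch s z w m \<noteq> 0" "i \<le> m" for z w i m
    using that by (auto simp: spoch_eq_0_iff)
  \<comment> \<open>The speeds are such that none of the thirteen linear forms in the generic case is stationary.\<close>
  define wg :: complex where "wg = (if g = a - b then - 9 else - 999)"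
  \<comment> \<open>10 + 100 - 109 = 1 preserves b + c + d = a + \<eta>, and 1000 - 998 = 2
    preserves the relation for e + f. \<open>wg\<close> is 1 - 10 or 1 - 1000, so that g follows a -
    b or a - e.\<close>
  define L where "L t = (\<Sum>k\<le>n. lhs_term s \<eta> n (a + t) (b + 10 * t) (c + 100 * t) (d - 109 * t) (e + 1000 * t) (f - 998 * t) k)" for t
  define R where "R t = prefactor s h n (a + t) (b + 10 * t) (c + 100 * t) (d - 109 * t) (e + 1000 * t) (g + wg * t)
      * (\<Sum>k\<le>n. vwp s h (a + t + (g + wg * t) - (c + 100 * t)) [a + t - (c + 100 * t), g + wg * t + h - (c + 100 * t),
          b + 10 * t + (e + 1000 * t) + (g + wg * t) - (a + t), d - 109 * t, f - 998 * t, g + wg * t, - (of_nat n * h)] k)" for t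
  have "L 0 = R 0"
  proof (rule isCont_eq_of_countable_neq[of 0 L R])
    have ct: "isCont (\<lambda>t. s (F t)) 0" if "isCont F 0" for F :: "complex \<Rightarrow> complex"
      unfolding s_def using that by (rule isCont_o2[OF _ isCont_s_theta[OF p]])
    have cb: "isCont (\<lambda>t. spoch s (F t) w k) 0" if "isCont F 0" for F :: "complex \<Rightarrow> complex" and w k
      unfolding s_def using that by (rule isCont_spoch[OF p])
    have *: "spoch s (a + h - b) h k \<noteq> 0" "spoch s (a + h - c) h k \<noteq> 0" "spoch s (a + h - d) h k \<noteq> 0"
      "spoch s (a + \<eta> - e) \<eta> k \<noteq> 0" "spoch s (a + \<eta> - f) \<eta> k \<noteq> 0" "spoch s (a + \<eta> + of_nat n * h) \<eta> k \<noteq> 0"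
      "spoch s h h k \<noteq> 0" if "k \<le> n" for k
      using le[OF _ that] nz h by auto
    have **: "spoch s (a + g - c + h - x) h k \<noteq> 0"
      if "k \<le> n" "x \<in> set [a - c, g + h - c, b + e + g - a, d, f, g, - (of_nat n * h)]" for k x
      using le[OF nz3(2)[OF that(2)] that(1)] .
    note cont = continuous_sum isCont_divide isCont_mult isCont_add isCont_diff isCont_minus
      continuous_const continuous_ident ct cb
    note zero_simps = mult_zero_right add_0_right diff_0_right
    show "isCont L 0"
      unfolding L_def lhs_term_def h_def[symmetric]
      by (intro cont; (simp only: zero_simps mult_eq_0_iff atMost_iff * nz(1) simp_thms)?)
    show "isCont R 0"
      unfolding R_def prefactor_def vwp_def list.map prod_list.Cons prod_list.Nil
      by (intro cont;
          (simp only: zero_simps mult_eq_0_iff atMost_iff * ** nz(4) nz2 nz3(1) list.set insert_iff simp_thms)?)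
    let ?gen = "\<lambda>z w. {t. \<not> generic (s_theta p) \<eta> (z + w * t)}"
    have "{t. L t \<noteq> R t} \<subseteq> ?gen a 1 \<union> ?gen d (- 109) \<union> ?gen (a + d) (- 108) \<union> ?gen (a - b) (- 9) \<union> ?gen (a - c) (- 99)
      \<union> ?gen (a - d) 110 \<union> ?gen (a - e) (- 999) \<union> ?gen (a + d - e) (- 1108) \<union> ?gen (a - d - e) (- 890)
      \<union> ?gen c 100 \<union> ?gen (e - b) 990 \<union> ?gen (2 * a - c - e) (- 1098) \<union> ?gen (a + b - e) (- 989)"
    proof (rule subsetI, rule ccontr)
      fix t
      assume t: "t \<in> {t. L t \<noteq> R t}" and "t \<notin> ?gen a 1 \<union> ?gen d (- 109) \<union> ?gen (a + d) (- 108) \<union> ?gen (a - b) (- 9) \<union> ?gen (a - c) (- 99)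
      \<union> ?gen (a - d) 110 \<union> ?gen (a - e) (- 999) \<union> ?gen (a + d - e) (- 1108) \<union> ?gen (a - d - e) (- 890)
      \<union> ?gen c 100 \<union> ?gen (e - b) 990 \<union> ?gen (2 * a - c - e) (- 1098) \<union> ?gen (a + b - e) (- 989)"
      then have gen: "generic s \<eta> (a + 1 * t)" "generic s \<eta> (d + - 109 * t)" "generic s \<eta> (a + d + - 108 * t)"
        "generic s \<eta> (a - b + - 9 * t)" "generic s \<eta> (a - c + - 99 * t)" "generic s \<eta> (a - d + 110 * t)"
        "generic s \<eta> (a - e + - 999 * t)" "generic s \<eta> (a + d - e + - 1108 * t)" "generic s \<eta> (a - d - e + - 890 * t)"
        "generic s \<eta> (c + 100 * t)" "generic s \<eta> (e - b + 990 * t)" "generic s \<eta> (2 * a - c - e + - 1098 * t)"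
        "generic s \<eta> (a + b - e + - 989 * t)"
        unfolding s_def by blast+
      have "L t = R t"
        unfolding L_def R_def h_def
      proof (rule quadratic_transformation_generic)
        show "b + 10 * t + (c + 100 * t) + (d - 109 * t) = a + t + \<eta>"
          using bcd by (simp add: algebra_simps)
        show "e + 1000 * t + (f - 998 * t) = 2 * (a + t) + (2 * of_nat n + 1) * \<eta>"
          using ef by (simp add: algebra_simps)
        show "g + wg * t = a + t - (b + 10 * t) \<or> g + wg * t = a + t - (e + 1000 * t)"
          using g by (auto simp: wg_def)
        show "spoch s (2 * \<eta>) (2 * \<eta>) n \<noteq> 0" using h by (simp add: h_def)
      qed (insert gen, simp_all add: algebra_simps)
      then show False using t by simp
    qed
    then show "countable {t. L t \<noteq> R t}"
      by (rule countable_subset) (intro countable_Un countable_not_generic[OF p]; simp)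
  qed
  then show ?thesis by (simp add: L_def R_def)
qed

section \<open>Multiplicative notation\<close>

text \<open>The number k(k-1)/2, kept as a sum; it measures the powers of the base and cancels from
  every balanced quotient.\<close>

definition triangular :: "nat \<Rightarrow> complex" where
  "triangular k = (\<Sum>i<k. of_nat i)"

lemma ell_theta_exp: "ell_theta p (exp z) = exp (z / 2) * s_theta p z"
  by (simp add: s_theta_def mult.assoc[symmetric] flip: exp_add)

lemma ell_poch_exp:
  "ell_poch (exp z) (exp h) p k = exp ((of_nat k * z + triangular k * h) / 2) * spoch (s_theta p) z h k"
proof (induction k)
  case 0
  show ?case by (simp add: ell_poch_def triangular_def)
next
  case (Suc k)
  have "exp z * exp h ^ k = exp (z + of_nat k * h)"
    by (simp add: exp_add exp_of_nat_mult)
  then have "ell_poch (exp z) (exp h) p (Suc k)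
      = ell_poch (exp z) (exp h) p k * (exp ((z + of_nat k * h) / 2) * s_theta p (z + of_nat k * h))"
    by (simp add: ell_poch_def ell_theta_exp)
  also have "\<dots> = exp ((of_nat k * z + triangular k * h) / 2 + (z + of_nat k * h) / 2)
      * (spoch (s_theta p) z h k * s_theta p (z + of_nat k * h))"
    unfolding Suc.IH exp_add by (simp add: mult_ac)
  also have "(of_nat k * z + triangular k * h) / 2 + (z + of_nat k * h) / 2 = (of_nat (Suc k) * z + triangular (Suc k) * h) / 2"
    by (simp add: triangular_def field_simps)
  finally show ?case by (simp only: spoch_Suc)
qed

lemma ell_pochs_exp:
  "ell_pochs (map exp zs) (exp h) p k
    = exp ((of_nat k * sum_list zs + of_nat (length zs) * triangular k * h) / 2) * prod_list (map (\<lambda>z. spoch (s_theta p) z h k) zs)"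
proof (induction zs)
  case Nil
  show ?case by (simp add: ell_pochs_def)
next
  case (Cons z zs)
  have "ell_pochs (map exp (z # zs)) (exp h) p k = ell_poch (exp z) (exp h) p k * ell_pochs (map exp zs) (exp h) p k"
    by (simp add: ell_pochs_def)
  also have "\<dots> = exp ((of_nat k * z + triangular k * h) / 2 + (of_nat k * sum_list zs + of_nat (length zs) * triangular k * h) / 2)
      * (spoch (s_theta p) z h k * prod_list (map (\<lambda>z. spoch (s_theta p) z h k) zs))"
    unfolding Cons.IH ell_poch_exp exp_add by (simp add: mult_ac)
  also have "(of_nat k * z + triangular k * h) / 2 + (of_nat k * sum_list zs + of_nat (length zs) * triangular k * h) / 2
      = (of_nat k * sum_list (z # zs) + of_nat (length (z # zs)) * triangular k * h) / 2"
    by (simp add: field_simps)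
  finally show ?case by simp
qed

lemma ell_pochs_exp_nonzero:
  assumes "ell_pochs (map exp zs) (exp h) p k \<noteq> 0" "z \<in> set zs"
  shows "spoch (s_theta p) z h k \<noteq> 0"
  using assms by (auto simp: ell_pochs_exp prod_list_zero_iff image_iff)

text \<open>The shape is that of the summands on both sides of the theorem; its hypothesis gathers
  all exponents into one linear equation, to be checked from the balancing conditions.\<close>

lemma exp_cancel:
  fixes t0 :: complex
  assumes "A0 - A1 + L1 - L2 + L3 - L4 + K = 0"
  shows "exp A0 * t0 / (exp A1 * t1) * (exp L1 * u1) / (exp L2 * u2) * (exp L3 * u3) / (exp L4 * u4) * exp K
    = t0 / t1 * (u1 / u2) * (u3 / u4)"
proof -
  have "exp (A0 - A1 + L1 - L2 + L3 - L4 + K) = (1 :: complex)" by (simp add: assms)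
  then have "exp A0 / exp A1 * exp L1 / exp L2 * exp L3 / exp L4 * exp K = (1 :: complex)"
    by (simp add: exp_add exp_diff)
  then have "t0 / t1 * (u1 / u2) * (u3 / u4)
      = (exp A0 / exp A1 * exp L1 / exp L2 * exp L3 / exp L4 * exp K) * (t0 / t1 * (u1 / u2) * (u3 / u4))"
    by simp
  then show ?thesis by (simp add: mult_ac)
qed

lemma prod_list_map_divide:
  "prod_list (map (\<lambda>x. f x / g x) xs) = prod_list (map f xs) / prod_list (map (g :: _ \<Rightarrow> complex) xs)"
  by (induction xs) auto

lemma ell_pochs_ratio:
  assumes "sum_list zs = sum_list ws" "length zs = length ws"
  shows "ell_pochs (map exp zs) (exp h) p n / ell_pochs (map exp ws) (exp h) p n
    = prod_list (map (\<lambda>z. spoch (s_theta p) z h n) zs) / prod_list (map (\<lambda>z. spoch (s_theta p) z h n) ws)"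
  unfolding ell_pochs_exp assms by simp

text \<open>The two constraints make all exponents, including the one of q^k, add up to
  zero.\<close>

lemma ell_lhs_term:
  assumes bcd: "b + c + d = a + \<eta>" and ef: "e + f = 2 * a + (2 * of_nat n + 1) * \<eta>"
  defines "q \<equiv> exp \<eta>"
  shows "ell_theta p (exp a * q ^ (3 * k)) / ell_theta p (exp a)
            * ell_pochs [exp b, exp c, exp d] q p k
            / ell_pochs [exp a * q^2 / exp b, exp a * q^2 / exp c, exp a * q^2 / exp d] (q^2) p k
            * ell_pochs [exp e, exp f, inverse (q ^ (2 * n))] (q^2) p k
            / ell_pochs [exp a * q / exp e, exp a * q / exp f, exp a * q ^ (2 * n + 1)] q p k * q ^ k
    = lhs_term (s_theta p) \<eta> n a b c d e f k"
proof -
  have q2: "q ^ 2 = exp (2 * \<eta>)" by (simp add: q_def exp_double)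
  have l1: "[exp b, exp c, exp d] = map exp [b, c, d]" by simp
  have l2: "[exp a * q^2 / exp b, exp a * q^2 / exp c, exp a * q^2 / exp d]
      = map exp [a + 2 * \<eta> - b, a + 2 * \<eta> - c, a + 2 * \<eta> - d]"
    by (simp add: exp_add exp_diff q2)
  have l3: "[exp e, exp f, inverse (q ^ (2 * n))] = map exp [e, f, - (of_nat n * (2 * \<eta>))]"
    by (simp add: exp_minus exp_of_nat_mult q_def power_mult exp_double)
  have l4: "[exp a * q / exp e, exp a * q / exp f, exp a * q ^ (2 * n + 1)]
      = map exp [a + \<eta> - e, a + \<eta> - f, a + \<eta> + of_nat n * (2 * \<eta>)]"
    by (simp add: exp_add exp_diff exp_of_nat_mult q_def power_mult exp_double)
  have t: "ell_theta p (exp a * q ^ (3 * k)) = exp ((a + 3 * of_nat k * \<eta>) / 2) * s_theta p (a + 3 * of_nat k * \<eta>)"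
  proof -
    have "exp a * q ^ (3 * k) = exp (a + of_nat (3 * k) * \<eta>)"
      by (simp only: exp_add exp_of_nat_mult q_def)
    then show ?thesis by (simp only: ell_theta_exp) simp
  qed
  have K: "q ^ k = exp (of_nat k * \<eta>)" by (simp add: exp_of_nat_mult q_def)
  show ?thesis
    unfolding l1 l2 l3 l4 t ell_theta_exp[of p a] K unfolding q2 unfolding q_def ell_pochs_exp
  proof (subst exp_cancel, goal_cases)
    case 1
    have d: "d = a + \<eta> - b - c" unfolding bcd[symmetric] by simp
    have f: "f = 2 * a + (2 * of_nat n + 1) * \<eta> - e" unfolding ef[symmetric] by simp
    show ?case by (simp add: d f field_simps)
  next
    case 2
    show ?case by (simp add: lhs_term_def mult_ac)
  qed
qed

text \<open>For r = 9 the balancing condition reads (a_4 ... a_10)^2 = a_1^6 Q^4; the hypothesis is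
  its square root in logarithms, with the positive sign, and makes all exponentials including Q^k
  cancel.\<close>

lemma ell_omega_term:
  assumes "sum_list zs = 3 * a + 2 * h" "length zs = 7"
  shows "ell_theta p (exp a * exp h ^ (2 * k)) / ell_theta p (exp a)
      * ell_pochs (exp a # map exp zs) (exp h) p k * exp h ^ k
      / (ell_poch (exp h) (exp h) p k * ell_pochs (map (\<lambda>ai. exp a * exp h / ai) (map exp zs)) (exp h) p k)
    = vwp (s_theta p) h a zs k"
proof -
  have l1: "exp a # map exp zs = map exp (a # zs)" by simp
  have l2: "map (\<lambda>ai. exp a * exp h / ai) (map exp zs) = map exp (map (\<lambda>z. a + h - z) zs)"
    by (simp add: exp_add exp_diff)
  have t: "ell_theta p (exp a * exp h ^ (2 * k)) = exp ((a + 2 * of_nat k * h) / 2) * s_theta p (a + 2 * of_nat k * h)"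
  proof -
    have "exp a * exp h ^ (2 * k) = exp (a + of_nat (2 * k) * h)"
      by (simp only: exp_add exp_of_nat_mult)
    then show ?thesis by (simp only: ell_theta_exp) simp
  qed
  have K: "exp h ^ k = exp (of_nat k * h)" by (simp add: exp_of_nat_mult)
  have len: "(of_nat (length zs) :: complex) = 7" by (simp add: assms(2))
  have sl: "sum_list (map (\<lambda>z. a + h - z) zs) = of_nat (length zs) * (a + h) - sum_list zs"
    by (induction zs) (auto simp: algebra_simps)
  \<comment> \<open>A dummy numerator \<open>exp 0 * 1\<close> brings the term into the shape of
    \<open>exp_cancel\<close>.\<close>
  have "ell_theta p (exp a * exp h ^ (2 * k)) / ell_theta p (exp a)
      * ell_pochs (exp a # map exp zs) (exp h) p k * exp h ^ k
      / (ell_poch (exp h) (exp h) p k * ell_pochs (map (\<lambda>ai. exp a * exp h / ai) (map exp zs)) (exp h) p k)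
    = ell_theta p (exp a * exp h ^ (2 * k)) / ell_theta p (exp a)
      * ell_pochs (exp a # map exp zs) (exp h) p k / ell_poch (exp h) (exp h) p k
      * (exp 0 * 1) / ell_pochs (map (\<lambda>ai. exp a * exp h / ai) (map exp zs)) (exp h) p k * exp h ^ k"
    by (simp add: mult_ac)
  also have "\<dots> = vwp (s_theta p) h a zs k"
    unfolding l1 l2 t ell_theta_exp[of p a] K ell_pochs_exp ell_poch_exp
  proof (subst exp_cancel, goal_cases)
    case 1
    show ?case
      by (simp add: sl len assms(1) field_simps)
  next
    case 2
    show ?case by (simp add: vwp_def prod_list_map_divide o_def mult_ac)
  qed
  finally show ?thesis .
qed

text \<open>For k > n the factorial starting at -nh contains s 0 = 0, so the infinite series is a
  finite sum.\<close>

lemma ell_omega_eq: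
  assumes "cmod p < 1" "sum_list zs = 3 * a + 2 * h" "length zs = 7" "- (of_nat n * h) \<in> set zs"
  shows "ell_omega (exp a) (map exp zs) (exp h) p = (\<Sum>k\<le>n. vwp (s_theta p) h a zs k)"
proof -
  have "vwp (s_theta p) h a zs k = 0" if "k \<notin> {..n}" for k
  proof -
    have "s_theta p (- (of_nat n * h) + of_nat n * h) = 0" using assms(1) by simp
    then have "spoch (s_theta p) (- (of_nat n * h)) h k = 0"
      using that unfolding spoch_eq_0_iff by (metis atMost_iff not_le)
    then show ?thesis
      using assms(4) by (force simp: vwp_def prod_list_zero_iff)
  qed
  then show ?thesis
    unfolding ell_omega_def ell_omega_term[OF assms(2,3)] by (intro suminf_finite) auto
qed

theorem theorem4p2:
  fixes p q a b c d e f g :: complex and n :: nat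
  assumes hp: "cmod p < 1" and hq: "q \<noteq> 0"
    and hnz: "a \<noteq> 0" "b \<noteq> 0" "c \<noteq> 0" "d \<noteq> 0" "e \<noteq> 0" "f \<noteq> 0" "g \<noteq> 0"
    and hbcd: "b * c * d = a * q"
    and hef: "e * f = a ^ 2 * q ^ (2 * n + 1)"
    and hg: "g = a / b \<or> g = a / e"
    and gen1: "ell_theta p a \<noteq> 0"
    and gen2: "ell_pochs [a * q^2 / b, a * q^2 / c, a * q^2 / d] (q^2) p n \<noteq> 0"
    and gen3: "ell_pochs [a * q / e, a * q / f, a * q ^ (2 * n + 1)] q p n \<noteq> 0"
    and gen4: "ell_pochs [a^2 * q^2 / (b * e * g), a * g * q^2 / c, a * q^2 / d,
                          a^2 * q^2 / (b * c * d * e)] (q^2) p n \<noteq> 0"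
    and gen5: "ell_theta p (a * g / c) \<noteq> 0"
    and gen6: "ell_poch (q^2) (q^2) p n \<noteq> 0"
    and gen7: "ell_pochs (map (\<lambda>ai. (a * g / c) * q^2 / ai)
                 [a / c, g * q^2 / c, b * e * g / a, d, f, g, inverse (q ^ (2 * n))]) (q^2) p n \<noteq> 0"
  shows "(\<Sum>k\<le>n. ell_theta p (a * q ^ (3 * k)) / ell_theta p a
            * ell_pochs [b, c, d] q p k / ell_pochs [a * q^2 / b, a * q^2 / c, a * q^2 / d] (q^2) p k
            * ell_pochs [e, f, inverse (q ^ (2 * n))] (q^2) p k
            / ell_pochs [a * q / e, a * q / f, a * q ^ (2 * n + 1)] q p k * q ^ k)
       = ell_pochs [a * q^2, a^2 * q^2 / (b * c * e), a^2 * q^2 / (b * d * e * g), a * g * q^2 / (c * d)] (q^2) p n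
         / ell_pochs [a^2 * q^2 / (b * e * g), a * g * q^2 / c, a * q^2 / d,
                      a^2 * q^2 / (b * c * d * e)] (q^2) p n
         * ell_omega (a * g / c) [a / c, g * q^2 / c, b * e * g / a, d, f, g, inverse (q ^ (2 * n))] (q^2) p"
proof -
  obtain A B C E \<eta> where logs: "a = exp A" "b = exp B" "c = exp C" "e = exp E" "q = exp \<eta>"
    using hnz hq exp_Ln by metis
  \<comment> \<open>Only A, B, C, E and \<eta> are free choices of logarithms. D, F and G are
    defined from them, so the constraints hold exactly and not merely modulo 2 pi i.\<close>
  define D where "D = A + \<eta> - B - C"
  define F where "F = 2 * A + (2 * of_nat n + 1) * \<eta> - E"
  define G where "G = (if g = a / b then A - B else A - E)"
  define h where "h = 2 * \<eta>"
  have q2: "q ^ 2 = exp h" by (simp add: h_def logs exp_double)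
  have d: "d = exp D"
    using hbcd hnz by (simp add: D_def logs exp_add exp_diff field_simps)
  have f: "f = exp F"
  proof -
    have "exp F = (exp A)^2 * (exp \<eta>) ^ (2 * n + 1) / exp E"
    proof -
      have "F = 2 * A + of_nat (2 * n + 1) * \<eta> - E" by (simp add: F_def)
      then show ?thesis by (simp only: exp_add exp_diff exp_of_nat_mult exp_double)
    qed
    also have "\<dots> = f"
      using hef by (simp only: logs(1,4,5)[symmetric]) (simp add: hnz nonzero_divide_eq_eq mult.commute)
    finally show ?thesis by (rule sym)
  qed
  have g: "g = exp G"
    using hg by (auto simp: G_def logs exp_diff)
  have qn: "inverse (q ^ (2 * n)) = exp (- (of_nat n * h))"
    by (simp add: exp_minus exp_of_nat_mult power_mult q2)
  have qn': "a * q ^ (2 * n + 1) = exp (A + \<eta> + of_nat n * h)"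
    by (simp add: exp_add exp_of_nat_mult power_mult q2 logs[symmetric])
  define zs where "zs = [A - C, G + h - C, B + E + G - A, D, F, G, - (of_nat n * h)]"
  have ag: "a * g / c = exp (A + G - C)" by (simp add: logs(1,3) g exp_add exp_diff)
  have zs: "[a / c, g * q^2 / c, b * e * g / a, d, f, g, inverse (q ^ (2 * n))] = map exp zs"
    by (simp add: zs_def qn q2 exp_add exp_diff d f g logs(1-4))
  have w1: "[a * q^2 / b, a * q^2 / c, a * q^2 / d] = map exp [A + h - B, A + h - C, A + h - D]"
    by (simp add: q2 exp_add exp_diff d logs(1-4))
  have w2: "[a * q / e, a * q / f, a * q ^ (2 * n + 1)] = map exp [A + \<eta> - E, A + \<eta> - F, A + \<eta> + of_nat n * h]"
    unfolding qn' by (simp add: exp_add exp_diff f logs)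
  have w3: "[a^2 * q^2 / (b * e * g), a * g * q^2 / c, a * q^2 / d, a^2 * q^2 / (b * c * d * e)]
      = map exp [2 * A + h - B - E - G, A + G + h - C, A + h - D, 2 * A + h - B - C - D - E]"
    by (simp add: q2 exp_add exp_diff exp_double d g logs(1-4))
  have w4: "[a * q^2, a^2 * q^2 / (b * c * e), a^2 * q^2 / (b * d * e * g), a * g * q^2 / (c * d)]
      = map exp [A + h, 2 * A + h - B - C - E, 2 * A + h - B - D - E - G, A + G + h - C - D]"
    by (simp add: q2 exp_add exp_diff exp_double d g logs(1-4))
  have w5: "map (\<lambda>ai. (a * g / c) * q^2 / ai) (map exp zs) = map exp (map (\<lambda>x. A + G - C + h - x) zs)"
    unfolding ag q2 by (simp add: exp_add exp_diff)
  let ?s = "s_theta p"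
  have bcd: "B + C + D = A + \<eta>" and ef: "E + F = 2 * A + (2 * of_nat n + 1) * \<eta>"
    by (simp_all add: D_def F_def)
  have "(\<Sum>k\<le>n. lhs_term ?s \<eta> n A B C D E F k) = prefactor ?s (2 * \<eta>) n A B C D E G
      * (\<Sum>k\<le>n. vwp ?s (2 * \<eta>) (A + G - C) [A - C, G + 2 * \<eta> - C, B + E + G - A, D, F, G, - (of_nat n * (2 * \<eta>))] k)"
    unfolding h_def[symmetric]
  proof (rule quadratic_transformation[OF hp bcd ef, folded h_def])
    show "G = A - B \<or> G = A - E" by (simp add: G_def)
    show "spoch ?s h h n \<noteq> 0" using gen6 unfolding q2 ell_poch_exp by simp
    show "?s A \<noteq> 0" using gen1 unfolding logs(1) ell_theta_exp by simp
    show "?s (A + G - C) \<noteq> 0" using gen5 unfolding ag ell_theta_exp by simp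
    note gen2' = ell_pochs_exp_nonzero[OF gen2[unfolded w1, unfolded q2]]
    show "spoch ?s (A + h - B) h n \<noteq> 0" "spoch ?s (A + h - C) h n \<noteq> 0" "spoch ?s (A + h - D) h n \<noteq> 0"
      by (rule gen2'; simp)+
    note gen3' = ell_pochs_exp_nonzero[OF gen3[unfolded w2, unfolded logs(5)]]
    show "spoch ?s (A + \<eta> - E) \<eta> n \<noteq> 0" "spoch ?s (A + \<eta> - F) \<eta> n \<noteq> 0" "spoch ?s (A + \<eta> + of_nat n * h) \<eta> n \<noteq> 0"
      by (rule gen3'; simp)+
    note gen4' = ell_pochs_exp_nonzero[OF gen4[unfolded w3, unfolded q2]]
    show "spoch ?s (2 * A + h - B - E - G) h n \<noteq> 0" "spoch ?s (A + G + h - C) h n \<noteq> 0" "spoch ?s (2 * A + h - B - C - D - E) h n \<noteq> 0"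
      by (rule gen4'; simp)+
    show "spoch ?s (A + G - C + h - x) h n \<noteq> 0"
      if "x \<in> set [A - C, G + h - C, B + E + G - A, D, F, G, - (of_nat n * h)]" for x
      by (rule ell_pochs_exp_nonzero[OF gen7[unfolded zs w5, unfolded q2]]) (unfold set_map, rule imageI, unfold zs_def, rule that)
  qed
  moreover have "ell_omega (a * g / c) (map exp zs) (q^2) p = (\<Sum>k\<le>n. vwp ?s h (A + G - C) zs k)"
    unfolding ag q2 by (rule ell_omega_eq[OF hp]) (simp_all add: zs_def D_def F_def h_def algebra_simps)
  moreover have "ell_pochs [a * q^2, a^2 * q^2 / (b * c * e), a^2 * q^2 / (b * d * e * g), a * g * q^2 / (c * d)] (q^2) p n
         / ell_pochs [a^2 * q^2 / (b * e * g), a * g * q^2 / c, a * q^2 / d, a^2 * q^2 / (b * c * d * e)] (q^2) p n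
    = prefactor ?s h n A B C D E G"
    unfolding w3 w4 unfolding q2 by (subst ell_pochs_ratio) (simp_all add: prefactor_def mult.assoc)
  ultimately show ?thesis
    unfolding zs using ell_lhs_term[OF bcd ef, of p] by (simp add: logs d f zs_def h_def)
qed

end
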